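(* Let $1\le p,q\le\infty$ with $q\neq 1$. As $n\to\infty$ (with $p,q$ fixed), the $(p,q)$-Bohr radius satisfies $$K(B_{\ell_p^n},B_{\ell_q^n})\sim\begin{cases}1 & \text{if (I): } 2\le p\le\infty \text{ and } \frac12+\frac1p\le\frac1q,\\[4pt] \dfrac{\sqrt{\log (n)}}{n^{\frac12+\frac1p-\frac1q}} & \text{if (II): } 2\le p\le\infty \text{ and } \frac12+\frac1p>\frac1q,\\[8pt] \dfrac{\log(n)^{1-\frac1p}}{n^{1-\frac1q}} & \text{if (III): } 1\le p\le 2.\end{cases}$$ For $q=1$ and every $1\le p\le\infty$, $K(B_{\ell_p^n},B_{\ell_1^n})\sim 1$.
   Context: For $1\le r\le\infty$, $\ell_r^n$ is $\mathbb{C}^n$ with the norm $\|z\|_r=(\sum_{i=1}^n|z_i|^r)^{1/r}$ ($\|z\|_\infty=\max_i|z_i|$ if $r=\infty$), and $B_{\ell_r^n}$ is its closed unit ball; $1/\infty=0$. $K(B_{\ell_p^n},B_{\ell_q^n})$ denotes the greatest constant $r\ge 0$ such that for every entire function $f(z)=\sum_{\alpha\in\mathbb{N}_0^n} a_\alpha z^\alpha$ on $\mathbb{C}^n$, $$\sup_{z\in r\cdot B_{\ell_q^n}}\sum_{\alpha}|a_\alpha z^\alpha|\le\sup_{z\in B_{\ell_p^n}}|f(z)|.$$ For sequences of nonnegative real numbers indexed by $n\ge 2$, $a_n\ll b_n$ means that there is a constant $C>0$ independent of $n$ (possibly depending on $p,q$) with $a_n\le C b_n$ for all $n$, and $a_n\sim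 b_n$ means $a_n\ll b_n$ and $b_n\ll a_n$. *)

theory Defs
  imports "HOL-Analysis.Analysis"
begin

text \<open>Points of \<open>\<complex>\<^sup>n\<close> and multi-indices in \<open>\<nat>\<^sub>0\<^sup>n\<close> are functions on \<open>nat\<close> that vanish outside
  \<open>{..<n}\<close>, so that \<open>n\<close> can tend to infinity inside a single formula.\<close>

definition cspace :: "nat \<Rightarrow> (nat \<Rightarrow> complex) set" where
  "cspace n = {z. \<forall>i\<ge>n. z i = 0}"

definition multiindices :: "nat \<Rightarrow> (nat \<Rightarrow> nat) set" where
  "multiindices n = {\<alpha>. \<forall>i\<ge>n. \<alpha> i = 0}"

definition monomial :: "nat \<Rightarrow> (nat \<Rightarrow> nat) \<Rightarrow> (nat \<Rightarrow> complex) \<Rightarrow> complex" where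
  "monomial n \<alpha> z = (\<Prod>i<n. z i ^ \<alpha> i)"

text \<open>Exponents range over \<open>ereal\<close>; there \<open>1 / \<infinity> = 0\<close>.\<close>

definition recip :: "ereal \<Rightarrow> real" where
  "recip p = real_of_ereal (1 / p)"

definition lnorm :: "ereal \<Rightarrow> nat \<Rightarrow> (nat \<Rightarrow> complex) \<Rightarrow> real" where
  "lnorm p n z =
     (if p = \<infinity> then Max ((\<lambda>i. cmod (z i)) ` {..<n})
      else (\<Sum>i<n. cmod (z i) powr real_of_ereal p) powr recip p)"

definition lball :: "ereal \<Rightarrow> nat \<Rightarrow> (nat \<Rightarrow> complex) set" where
  "lball p n = {z \<in> cspace n. lnorm p n z \<le> 1}"

definition scaled :: "real \<Rightarrow> (nat \<Rightarrow> complex) set \<Rightarrow> (nat \<Rightarrow> complex) set" where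
  "scaled r B = (\<lambda>z i. complex_of_real r * z i) ` B"

text \<open>\<open>f\<close> is the entire function on \<open>\<complex>\<^sup>n\<close> with power series coefficients \<open>a\<close>. For complex-valued
  families, \<open>has_sum\<close> is unconditional, i.e. absolute, convergence.\<close>

definition entire_series ::
    "nat \<Rightarrow> ((nat \<Rightarrow> nat) \<Rightarrow> complex) \<Rightarrow> ((nat \<Rightarrow> complex) \<Rightarrow> complex) \<Rightarrow> bool" where
  "entire_series n a f \<longleftrightarrow>
     (\<forall>z\<in>cspace n. ((\<lambda>\<alpha>. a \<alpha> * monomial n \<alpha> z) has_sum f z) (multiindices n))"

definition bohr_ineq :: "ereal \<Rightarrow> ereal \<Rightarrow> nat \<Rightarrow> real \<Rightarrow> bool" where
  "bohr_ineq p q n r \<longleftrightarrow>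
     (\<forall>a f. entire_series n a f \<longrightarrow>
        (SUP z\<in>scaled r (lball q n). \<Sum>\<^sub>\<infinity>\<alpha>\<in>multiindices n. ennreal (cmod (a \<alpha> * monomial n \<alpha> z)))
          \<le> (SUP z\<in>lball p n. ennreal (cmod (f z))))"

definition bohr_radius :: "ereal \<Rightarrow> ereal \<Rightarrow> nat \<Rightarrow> real" where
  "bohr_radius p q n = (GREATEST r. 0 \<le> r \<and> bohr_ineq p q n r)"

definition dominated :: "(nat \<Rightarrow> real) \<Rightarrow> (nat \<Rightarrow> real) \<Rightarrow> bool" (infix "\<lless>" 50) where
  "a \<lless> b \<longleftrightarrow> (\<exists>C>0. \<forall>n\<ge>2. a n \<le> C * b n)"

definition same_order :: "(nat \<Rightarrow> real) \<Rightarrow> (nat \<Rightarrow> real) \<Rightarrow> bool" (infix "\<asymp>" 50) where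
  "a \<asymp> b \<longleftrightarrow> a \<lless> b \<and> b \<lless> a"

end

theory Submission imports Defs "HOL-Complex_Analysis.Complex_Analysis" begin

text \<open>Everything is reduced to homogeneous polynomials. Averaging over the circle shows that the degree
\<open>m\<close> part of \<open>f\<close>, for \<open>m \<ge> 1\<close>, is at most \<open>2 (F - \<bar>a\<^sub>0\<bar>)\<close> on the ball when \<open>\<bar>f\<bar> \<le> F\<close> there. Hence
\<open>r\<close> is admissible as soon as, for every \<open>m\<close>-homogeneous \<open>P = \<Sum> b\<^sub>\<alpha> z\<^sup>\<alpha>\<close> with \<open>\<bar>P\<bar> \<le> G\<close> on the
\<open>p\<close>-ball, \<open>\<Sum> \<bar>b\<^sub>\<alpha> z\<^sup>\<alpha>\<bar> \<le> \<kappa>\<^sub>m G\<close> on \<open>r\<close> times the \<open>q\<close>-ball with \<open>\<Sum> \<kappa>\<^sub>m \<le> 1/2\<close>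
(\<open>bohr_ineq_if_homogeneous\<close>). Conversely, each single \<open>P\<close> bounds the Bohr radius from above.

\<^emph>\<open>Lower bounds, \<open>p \<ge> 2\<close>.\<close> A point of the \<open>q\<close>-ball is written as a product \<open>y w\<close> with \<open>y\<close> in the
\<open>p\<close>-ball, so \<open>v \<mapsto> P (y v)\<close> is bounded on the polydisc. If \<open>1/2 + 1/p \<le> 1/q\<close>, then \<open>w\<close> can be taken in
the \<open>2\<close>-ball, and Parseval with Cauchy-Schwarz gives a constant radius. Otherwise Cauchy-Schwarz is
applied to each partial derivative of \<open>P\<close>: their \<open>L\<^sup>2\<close> norms are controlled by their \<open>L\<^sup>1\<close> norms up to a
factor \<open>C\<^sup>m\<close> (\<open>L2_le_L1\<close>), and the sum of all \<open>\<bar>\<partial>\<^sub>k P\<bar>\<close> at a point is a directional derivative, at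
most \<open>e m G\<close>. This is \<open>sum_norm_coeff_polydisc\<close>. The remaining sum \<open>\<Sum> w\<^sup>2\<^sup>\<beta>\<close> over degree \<open>m - 1\<close> is
at most \<open>t\<^sup>1\<^sup>-\<^sup>m exp (2 t \<Sum> w\<^sub>i\<^sup>2)\<close> for \<open>t w\<^sub>i\<^sup>2 \<le> 1/2\<close>, and with \<open>\<Sum> w\<^sub>i\<^sup>2 \<le> c\<^sup>2 ln n\<close> the exponential is only a small power of
\<open>n\<close>; it is absorbed by the factor \<open>max w\<^sub>i\<close>, which is a negative power of \<open>n\<close>.

\<^emph>\<open>Lower bounds, \<open>p \<le> 2\<close>.\<close> The same derivative, now in a direction of the \<open>p\<close>-ball, is estimated
coefficient by coefficient with Cauchy's inequality at the point of the ball where the monomial is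
largest (\<open>sum_norm_coeff_lball\<close>). This leaves \<open>\<Sum> (M!/\<beta>!)\<^sup>1\<^sup>/\<^sup>p z\<^sup>\<beta>\<close>, which is interpolated between
the multinomial theorem and the exponential bound above. For \<open>p = 1\<close> the multinomial theorem alone
suffices, and enlarging the ball from \<open>1\<close> to \<open>p\<close> settles \<open>q = 1\<close>.

\<^emph>\<open>Upper bounds.\<close> The test polynomial is \<open>\<Sum> \<plusminus> m!/\<alpha>! z\<^sup>\<alpha>\<close> with \<open>m \<approx> ln n\<close>, at the point with equal
coordinates. Since \<open>n \<le> e\<^sup>m\<close>, any power of \<open>n\<close> may be lost in estimating it. Signs chosen one at a
time make the polynomial, and all its slices \<open>\<Sum> \<plusminus> M!/\<gamma>! z\<^sup>\<gamma>\<close>, at most \<open>e\<^sup>7\<^sup>m sqrt (M!)\<close> on the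
\<open>2\<close>-ball (\<open>exists_flat_signs\<close>). For \<open>p \<ge> 2\<close> the \<open>p\<close>-ball is compared with the \<open>2\<close>-ball. For \<open>p \<le> 2\<close>
a point is split into its coordinates above and below \<open>m\<^sup>-\<^sup>1\<^sup>/\<^sup>p\<close>; the large ones have small \<open>1\<close>-norm,
the small ones have small \<open>2\<close>-norm, and the slices handle the mixed terms
(\<open>norm_split_polynomial_le\<close>).\<close>

section \<open>Multi-indices of fixed degree\<close>

text \<open>Points of a finite grid in any number of coordinates, continued by zero. Multi-indices, tuples of
roots of unity and the nets used below are all of this form, so one product formula serves for
counting, for generating functions and for orthogonality.\<close>
definition choices :: "nat \<Rightarrow> (nat \<Rightarrow> 'b set) \<Rightarrow> (nat \<Rightarrow> 'b::zero) set" where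
  "choices n B = {u. (\<forall>i<n. u i \<in> B i) \<and> (\<forall>i\<ge>n. u i = 0)}"

definition hom_indices :: "nat \<Rightarrow> nat \<Rightarrow> (nat \<Rightarrow> nat) set" where
  "hom_indices n m = {\<alpha> \<in> multiindices n. (\<Sum>i<n. \<alpha> i) = m}"

definition rmonomial :: "nat \<Rightarrow> (nat \<Rightarrow> nat) \<Rightarrow> (nat \<Rightarrow> real) \<Rightarrow> real" where
  "rmonomial n \<alpha> x = (\<Prod>i<n. x i ^ \<alpha> i)"

definition index_fact :: "nat \<Rightarrow> (nat \<Rightarrow> nat) \<Rightarrow> real" where
  "index_fact n \<alpha> = (\<Prod>i<n. fact (\<alpha> i))"

lemma choices_0: "choices 0 B = {\<lambda>i. 0}"
  by (auto simp: choices_def)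

lemma choices_Suc: "choices (Suc n) B = (\<lambda>(u, x). u(n := x)) ` (choices n B \<times> B n)"
proof -
  have "v \<in> (\<lambda>(u, x). u(n := x)) ` (choices n B \<times> B n)" if "v \<in> choices (Suc n) B" for v
  proof (rule image_eqI)
    show "v = (\<lambda>(u, x). u(n := x)) (v(n := 0), v n)" by auto
    show "(v(n := 0), v n) \<in> choices n B \<times> B n"
      using that by (auto simp: choices_def)
  qed
  then show ?thesis by (auto simp: choices_def less_Suc_eq)
qed

lemma inj_choices_Suc: "inj_on (\<lambda>(u, x). u(n := x)) (choices n B \<times> B n)"
proof (rule inj_onI, clarify)
  fix u x v y assume *: "u \<in> choices n B" "v \<in> choices n B" "u(n := x) = v(n := y)"
  have "u i = v i" for i
    using fun_cong[OF *(3), of i] *(1,2) by (cases "i = n") (auto simp: choices_def)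
  moreover have "x = y" using fun_cong[OF *(3), of n] by simp
  ultimately show "u = v \<and> x = y" by auto
qed

lemma finite_choices: "(\<And>i. i < n \<Longrightarrow> finite (B i)) \<Longrightarrow> finite (choices n B)"
  by (induction n) (auto simp: choices_0 choices_Suc)

lemma sum_choices_prod:
  fixes g :: "nat \<Rightarrow> 'b::zero \<Rightarrow> 'c::comm_semiring_1"
  assumes "\<And>i. i < n \<Longrightarrow> finite (B i)"
  shows "(\<Sum>u\<in>choices n B. \<Prod>i<n. g i (u i)) = (\<Prod>i<n. \<Sum>x\<in>B i. g i x)"
  using assms
proof (induction n)
  case (Suc n)
  have "(\<Sum>u\<in>choices (Suc n) B. \<Prod>i<Suc n. g i (u i))
      = (\<Sum>(u, x)\<in>choices n B \<times> B n. (\<Prod>i<n. g i (u i)) * g n x)"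
    unfolding choices_Suc by (subst sum.reindex[OF inj_choices_Suc]) (auto intro!: sum.cong prod.cong)
  also have "\<dots> = (\<Sum>u\<in>choices n B. \<Prod>i<n. g i (u i)) * (\<Sum>x\<in>B n. g n x)"
    by (simp add: sum.cartesian_product[symmetric] sum_product)
  finally show ?case using Suc by simp
qed (simp add: choices_0)

lemma card_choices:
  assumes "\<And>i. i < n \<Longrightarrow> finite (B i)"
  shows "card (choices n B) = (\<Prod>i<n. card (B i))"
  using sum_choices_prod[where g = "\<lambda>_ _. 1::nat" and n = n and B = B, OF assms] by simp

lemma hom_indices_subset_choices: "hom_indices n m \<subseteq> choices n (\<lambda>_. {..m})"
proof
  fix \<alpha> assume a: "\<alpha> \<in> hom_indices n m"
  have "\<alpha> i \<le> m" if "i < n" for i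
    using a that member_le_sum[of i "{..<n}" \<alpha>] by (auto simp: hom_indices_def)
  then show "\<alpha> \<in> choices n (\<lambda>_. {..m})"
    using a by (auto simp: hom_indices_def multiindices_def choices_def)
qed

lemma hom_indices_le: "\<alpha> \<in> hom_indices n m \<Longrightarrow> \<alpha> i \<le> m"
  using hom_indices_subset_choices[of n m] by (cases "i < n") (auto simp: choices_def)

lemma finite_hom_indices [simp]: "finite (hom_indices n m)"
  by (rule finite_subset[OF hom_indices_subset_choices]) (simp add: finite_choices)

lemma hom_indices_0: "hom_indices n 0 = {\<lambda>_. 0}"
  by (auto simp: hom_indices_def multiindices_def fun_eq_iff) (metis lessThan_iff not_le)

lemma sum_upd_Suc:
  fixes \<beta> :: "nat \<Rightarrow> nat"
  assumes "k < n" shows "(\<Sum>i<n. (\<beta>(k := Suc (\<beta> k))) i) = Suc (\<Sum>i<n. \<beta> i)"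
  using assms by (subst (1 2) sum.remove[of _ k]) auto

text \<open>A multi-index of degree \<open>M + 1\<close> with a marked unit, the unit lying in coordinate \<open>k\<close>, is the same as
a multi-index of degree \<open>M\<close> together with \<open>k\<close>. In this form the identity covers differentiation,
Euler's formula and the induction in the multinomial theorem.\<close>
lemma sum_hom_indices_Suc:
  fixes \<phi> :: "(nat \<Rightarrow> nat) \<Rightarrow> nat \<Rightarrow> 'c::comm_semiring_1"
  shows "(\<Sum>\<alpha>\<in>hom_indices n (Suc M). \<Sum>k<n. of_nat (\<alpha> k) * \<phi> \<alpha> k)
       = (\<Sum>\<beta>\<in>hom_indices n M. \<Sum>k<n. of_nat (Suc (\<beta> k)) * \<phi> (\<beta>(k := Suc (\<beta> k))) k)"
proof -
  let ?A = "{(\<alpha>, k). \<alpha> \<in> hom_indices n (Suc M) \<and> k < n \<and> \<alpha> k > 0}"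
  have "(\<Sum>\<alpha>\<in>hom_indices n (Suc M). \<Sum>k<n. of_nat (\<alpha> k) * \<phi> \<alpha> k)
      = (\<Sum>(\<alpha>, k)\<in>hom_indices n (Suc M) \<times> {..<n}. of_nat (\<alpha> k) * \<phi> \<alpha> k)"
    by (simp add: sum.cartesian_product)
  also have "\<dots> = (\<Sum>(\<alpha>, k)\<in>?A. of_nat (\<alpha> k) * \<phi> \<alpha> k)"
    by (rule sum.mono_neutral_right) (auto intro!: gr0I)
  also have "\<dots> = (\<Sum>(\<beta>, k)\<in>hom_indices n M \<times> {..<n}.
                     of_nat (Suc (\<beta> k)) * \<phi> (\<beta>(k := Suc (\<beta> k))) k)"
  proof (rule sum.reindex_bij_witness[where i = "\<lambda>(\<beta>, k). (\<beta>(k := Suc (\<beta> k)), k)"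
        and j = "\<lambda>(\<alpha>, k). (\<alpha>(k := \<alpha> k - 1), k)"], goal_cases)
    case (2 a)
    then obtain \<alpha> k where a: "a = (\<alpha>, k)" "\<alpha> \<in> hom_indices n (Suc M)" "k < n" "\<alpha> k > 0" by auto
    have "\<alpha> = (\<alpha>(k := \<alpha> k - 1))(k := Suc ((\<alpha>(k := \<alpha> k - 1)) k))" using a(4) by auto
    then have "Suc M = Suc (\<Sum>i<n. (\<alpha>(k := \<alpha> k - 1)) i)"
      using a(2) sum_upd_Suc[OF a(3), of "\<alpha>(k := \<alpha> k - 1)"] by (simp add: hom_indices_def)
    then show ?case using a by (auto simp: hom_indices_def multiindices_def)
  next
    case (4 b)
    then show ?case by (auto simp: hom_indices_def multiindices_def sum_upd_Suc simp del: fun_upd_apply)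
        (auto)
  next
    case (5 a)
    then show ?case by (auto simp: fun_eq_iff simp flip: of_nat_Suc)
  qed (auto simp: fun_eq_iff)
  finally show ?thesis by (simp add: sum.cartesian_product)
qed

lemma rmonomial_upd:
  "k < n \<Longrightarrow> rmonomial n (\<beta>(k := Suc (\<beta> k))) x = x k * rmonomial n \<beta> x"
  unfolding rmonomial_def by (subst (1 2) prod.remove[of _ k]) (auto intro!: prod.cong)

lemma index_fact_upd:
  "k < n \<Longrightarrow> index_fact n (\<beta>(k := Suc (\<beta> k))) = Suc (\<beta> k) * index_fact n \<beta>"
  unfolding index_fact_def by (subst (1 2) prod.remove[of _ k]) (auto intro!: prod.cong)

lemma index_fact_pos: "index_fact n \<alpha> > 0"
  by (auto simp: index_fact_def intro!: prod_pos)

lemma index_fact_le_fact: "\<alpha> \<in> hom_indices n m \<Longrightarrow> index_fact n \<alpha> \<le> fact m"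
proof -
  have "(\<Prod>i<n. fact (\<alpha> i)) \<le> (fact (\<Sum>i<n. \<alpha> i)::real)"
  proof (induction n)
    case (Suc n)
    have "(\<Prod>i<Suc n. fact (\<alpha> i)) \<le> fact (\<Sum>i<n. \<alpha> i) * (fact (\<alpha> n)::real)"
      using Suc by (simp add: mult_right_mono)
    also have "\<dots> \<le> fact (\<Sum>i<Suc n. \<alpha> i)"
      using fact_fact_dvd_fact[of "\<Sum>i<n. \<alpha> i" "\<alpha> n"]
      by (metis dvd_imp_le fact_gt_zero of_nat_fact of_nat_le_iff of_nat_mult sum.lessThan_Suc)
    finally show ?case .
  qed simp
  then show "\<alpha> \<in> hom_indices n m \<Longrightarrow> index_fact n \<alpha> \<le> fact m"
    by (simp add: index_fact_def hom_indices_def)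
qed

lemma rmonomial_nonneg: "(\<And>i. i < n \<Longrightarrow> 0 \<le> x i) \<Longrightarrow> 0 \<le> rmonomial n \<alpha> x"
  by (auto simp: rmonomial_def intro!: prod_nonneg)

section \<open>Multinomial sums\<close>

text \<open>Induction on the degree: weighting each \<open>\<alpha>\<close> by its degree \<open>m + 1\<close>, the marked-unit identity splits off one
factor \<open>\<Sum> x\<^sub>i\<close>.\<close>
lemma multinomial_theorem:
  "(\<Sum>\<alpha>\<in>hom_indices n m. fact m / index_fact n \<alpha> * rmonomial n \<alpha> x) = (\<Sum>i<n. x i) ^ m"
proof (induction m)
  case 0
  show ?case by (simp add: hom_indices_0 index_fact_def rmonomial_def)
next
  case (Suc m)
  let ?\<phi> = "\<lambda>\<alpha>. fact (Suc m) / index_fact n \<alpha> * rmonomial n \<alpha> x"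
  have "real (Suc m) * (\<Sum>\<alpha>\<in>hom_indices n (Suc m). ?\<phi> \<alpha>)
      = (\<Sum>\<alpha>\<in>hom_indices n (Suc m). \<Sum>k<n. of_nat (\<alpha> k) * ?\<phi> \<alpha>)"
    unfolding sum_distrib_left
    by (intro sum.cong refl)
      (auto simp: hom_indices_def simp flip: of_nat_sum sum_distrib_right simp del: times_divide_eq_left)
  also have "\<dots> = (\<Sum>\<beta>\<in>hom_indices n m. \<Sum>k<n. of_nat (Suc (\<beta> k)) * ?\<phi> (\<beta>(k := Suc (\<beta> k))))"
    by (rule sum_hom_indices_Suc)
  also have "\<dots> = (\<Sum>\<beta>\<in>hom_indices n m. \<Sum>k<n.
                    real (Suc m) * (x k * (fact m / index_fact n \<beta> * rmonomial n \<beta> x)))"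
    by (intro sum.cong refl) (simp add: rmonomial_upd index_fact_upd del: of_nat_Suc)
  also have "\<dots> = real (Suc m) * ((\<Sum>i<n. x i) * (\<Sum>i<n. x i) ^ m)"
    by (simp only: Suc.IH[symmetric] sum_distrib_left sum_distrib_right)
  finally show ?case by (simp del: of_nat_Suc)
qed

lemma sum_rmonomial_le_power:
  assumes "\<And>i. i < n \<Longrightarrow> 0 \<le> x i"
  shows "(\<Sum>\<alpha>\<in>hom_indices n m. rmonomial n \<alpha> x) \<le> (\<Sum>i<n. x i) ^ m"
  unfolding multinomial_theorem[symmetric]
proof (rule sum_mono)
  fix \<alpha> assume a: "\<alpha> \<in> hom_indices n m"
  have "1 \<le> fact m / index_fact n \<alpha>" using index_fact_le_fact[OF a] index_fact_pos[of n \<alpha>] by simp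
  then show "rmonomial n \<alpha> x \<le> fact m / index_fact n \<alpha> * rmonomial n \<alpha> x"
    using mult_right_mono[OF _ rmonomial_nonneg[OF assms], of 1] by fastforce
qed

text \<open>The sum is the coefficient of \<open>t\<^sup>m\<close> in \<open>\<Prod> 1 / (1 - t x\<^sub>i)\<close>, and \<open>1 / (1 - y) \<le> exp (2 y)\<close> for
\<open>0 \<le> y \<le> 1/2\<close>. The free parameter \<open>t\<close> replaces a case distinction on the size of \<open>m\<close>.\<close>
lemma sum_rmonomial_le_exp:
  assumes x: "\<And>i. i < n \<Longrightarrow> 0 \<le> x i" and t: "0 \<le> t" and tx: "\<And>i. i < n \<Longrightarrow> t * x i \<le> 1/2"
  shows "t ^ m * (\<Sum>\<alpha>\<in>hom_indices n m. rmonomial n \<alpha> x) \<le> exp (2 * t * (\<Sum>i<n. x i))"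
proof -
  have "t ^ m * rmonomial n \<alpha> x = (\<Prod>i<n. (t * x i) ^ \<alpha> i)" if "\<alpha> \<in> hom_indices n m" for \<alpha>
    using that by (auto simp: rmonomial_def power_mult_distrib prod.distrib hom_indices_def power_sum)
  then have "t ^ m * (\<Sum>\<alpha>\<in>hom_indices n m. rmonomial n \<alpha> x)
      = (\<Sum>\<alpha>\<in>hom_indices n m. \<Prod>i<n. (t * x i) ^ \<alpha> i)"
    by (simp add: sum_distrib_left)
  also have "\<dots> \<le> (\<Sum>\<alpha>\<in>choices n (\<lambda>_. {..m}). \<Prod>i<n. (t * x i) ^ \<alpha> i)"
    using x t by (intro sum_mono2 finite_choices hom_indices_subset_choices)
       (auto intro!: prod_nonneg)
  also have "\<dots> = (\<Prod>i<n. \<Sum>j\<le>m. (t * x i) ^ j)"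
    by (rule sum_choices_prod) auto
  also have "\<dots> \<le> (\<Prod>i<n. exp (2 * (t * x i)))"
  proof (rule prod_mono, intro conjI)
    fix i assume "i \<in> {..<n}"
    then have y: "0 \<le> t * x i" "t * x i \<le> 1/2" using x t tx by auto
    show "0 \<le> (\<Sum>j\<le>m. (t * x i) ^ j)" using y by (auto intro!: sum_nonneg)
    have "(\<Sum>j\<le>m. (t * x i) ^ j) = (1 - (t * x i) ^ Suc m) / (1 - t * x i)"
      using y by (subst sum_gp0) auto
    also have "\<dots> \<le> 1 / (1 - t * x i)"
      using y by (intro divide_right_mono) auto
    also have "\<dots> \<le> 1 + 2 * (t * x i)"
    proof -
      have "(t * x i) * (t * x i) \<le> (t * x i) * (1/2)" using y by (intro mult_left_mono) auto
      then show ?thesis using y by (simp add: divide_simps algebra_simps)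
    qed
    also have "\<dots> \<le> exp (2 * (t * x i))" by (rule exp_ge_add_one_self)
    finally show "(\<Sum>j\<le>m. (t * x i) ^ j) \<le> exp (2 * (t * x i))" .
  qed
  also have "\<dots> = exp (2 * t * (\<Sum>i<n. x i))"
    by (simp add: exp_sum[symmetric] sum_distrib_left mult_ac)
  finally show ?thesis .
qed

section \<open>Orthogonality of monomials on roots of unity\<close>

text \<open>For polynomials of degree below \<open>N\<close>, integrals over the torus are exact averages over \<open>N\<close>-th roots of unity.
Finite averages keep all \<open>L\<^sup>p\<close> norms on the torus elementary.\<close>
definition unity_roots :: "nat \<Rightarrow> complex set" where
  "unity_roots N = {w. w ^ N = 1}"

lemma finite_unity_roots: "N > 0 \<Longrightarrow> finite (unity_roots N)"
  unfolding unity_roots_def by (rule finite_roots_unity) simp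

lemma card_unity_roots: "N > 0 \<Longrightarrow> card (unity_roots N) = N"
  unfolding unity_roots_def by (rule card_roots_unity_eq) simp

lemma norm_unity_roots: "N > 0 \<Longrightarrow> w \<in> unity_roots N \<Longrightarrow> cmod w = 1"
  unfolding unity_roots_def using power_eq_1_iff by force

lemma unity_roots_orthogonal:
  assumes "a < N" "b < N"
  shows "(\<Sum>w\<in>unity_roots N. w ^ a * cnj w ^ b) = (if a = b then of_nat N else 0)"
proof (cases "a = b")
  case True
  have N: "N > 0" using assms by simp
  have "w ^ a * cnj w ^ b = 1" if "w \<in> unity_roots N" for w
  proof -
    have "w ^ a * cnj w ^ b = (w * cnj w) ^ a" using True by (simp add: power_mult_distrib)
    also have "w * cnj w = 1"
      using norm_unity_roots[OF N that] by (simp flip: complex_norm_square)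
    finally show ?thesis by simp
  qed
  then show ?thesis using True card_unity_roots[OF N] by simp
next
  case False
  have N: "N > 0" using assms by simp
  \<comment> \<open>multiplication by a primitive root permutes the roots and multiplies the sum by a number other than \<open>1\<close>\<close>
  define v where "v = cis (2 * pi / real N)"
  have "v ^ N = cis (real N * (2 * pi / real N))" unfolding v_def by (rule Complex.DeMoivre)
  also have "real N * (2 * pi / real N) = 2 * pi" using N by simp
  finally have v: "v \<in> unity_roots N" by (simp add: unity_roots_def)
  have v1: "v * cnj v = 1" using norm_unity_roots[OF N v] by (simp flip: complex_norm_square)
  have vk: "v ^ k = cis (2 * pi * real k / real N)" for k
    by (simp add: v_def Complex.DeMoivre mult_ac)
  have "inj_on (\<lambda>k. v ^ k) {..<N}"
    using Complex.bij_betw_roots_unity[OF N] unfolding bij_betw_def vk by blast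
  then have ne: "v ^ a \<noteq> v ^ b" using assms False by (auto dest: inj_onD)
  let ?S = "\<Sum>w\<in>unity_roots N. w ^ a * cnj w ^ b"
  have "?S = (\<Sum>w\<in>unity_roots N. (v * w) ^ a * cnj (v * w) ^ b)"
  proof (rule sum.reindex_bij_witness[where i = "\<lambda>w. v * w" and j = "\<lambda>w. cnj v * w"])
    fix w assume "w \<in> unity_roots N"
    then show "cnj v * w \<in> unity_roots N" "v * w \<in> unity_roots N"
      using v by (auto simp: unity_roots_def power_mult_distrib simp flip: complex_cnj_power)
    show "cnj v * (v * w) = w" "v * (cnj v * w) = w" using v1 by (simp_all add: mult_ac(1)[symmetric] mult.commute[of "cnj v"])
    show "(v * (cnj v * w)) ^ a * cnj (v * (cnj v * w)) ^ b = w ^ a * cnj w ^ b"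
      by (simp only: \<open>v * (cnj v * w) = w\<close>)
  qed
  also have "\<dots> = (v ^ a * cnj v ^ b) * ?S"
    by (simp add: sum_distrib_left power_mult_distrib mult_ac)
  finally have "(1 - v ^ a * cnj v ^ b) * ?S = 0" by (simp add: algebra_simps)
  moreover have "v ^ a * cnj v ^ b \<noteq> 1"
  proof
    assume "v ^ a * cnj v ^ b = 1"
    then have "v ^ a * (cnj v * v) ^ b = v ^ b" by (simp add: power_mult_distrib)
    then show False using v1 ne by (simp add: mult.commute)
  qed
  ultimately show ?thesis using False by simp
qed

definition torus_grid :: "nat \<Rightarrow> nat \<Rightarrow> (nat \<Rightarrow> complex) set" where
  "torus_grid n N = choices n (\<lambda>_. unity_roots N)"

lemma finite_torus_grid: "N > 0 \<Longrightarrow> finite (torus_grid n N)"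
  by (simp add: torus_grid_def finite_choices finite_unity_roots)

lemma card_torus_grid: "N > 0 \<Longrightarrow> card (torus_grid n N) = N ^ n"
  unfolding torus_grid_def by (subst card_choices) (auto simp: finite_unity_roots card_unity_roots)

lemma norm_torus_grid: "N > 0 \<Longrightarrow> u \<in> torus_grid n N \<Longrightarrow> cmod (u i) \<le> 1"
  by (cases "i < n") (auto simp: torus_grid_def choices_def norm_unity_roots)

lemma torus_grid_in_cspace: "u \<in> torus_grid n N \<Longrightarrow> u \<in> cspace n"
  by (auto simp: torus_grid_def choices_def cspace_def)

lemma monomials_orthogonal:
  assumes "\<alpha> \<in> multiindices n" "\<beta> \<in> multiindices n"
    and "\<And>i. i < n \<Longrightarrow> \<alpha> i < N" "\<And>i. i < n \<Longrightarrow> \<beta> i < N" "N > 0"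
  shows "(\<Sum>u\<in>torus_grid n N. monomial n \<alpha> u * cnj (monomial n \<beta> u))
       = (if \<alpha> = \<beta> then of_nat (N ^ n) else 0)"
proof -
  have "(\<Sum>u\<in>torus_grid n N. monomial n \<alpha> u * cnj (monomial n \<beta> u))
      = (\<Sum>u\<in>torus_grid n N. \<Prod>i<n. u i ^ \<alpha> i * cnj (u i) ^ \<beta> i)"
    by (simp add: monomial_def prod.distrib)
  also have "\<dots> = (\<Prod>i<n. \<Sum>w\<in>unity_roots N. w ^ \<alpha> i * cnj w ^ \<beta> i)"
    unfolding torus_grid_def
    using assms by (intro sum_choices_prod[where g = "\<lambda>i w. w ^ \<alpha> i * cnj w ^ \<beta> i"]) (simp add: finite_unity_roots)
  also have "\<dots> = (\<Prod>i<n. if \<alpha> i = \<beta> i then of_nat N else 0)"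
    using assms by (intro prod.cong) (auto simp: unity_roots_orthogonal)
  also have "\<dots> = (if \<alpha> = \<beta> then of_nat (N ^ n) else 0)"
  proof (cases "\<alpha> = \<beta>")
    case False
    then obtain i where i: "\<alpha> i \<noteq> \<beta> i" by auto
    have "i < n"
    proof (rule ccontr)
      assume "\<not> i < n"
      then show False using assms(1,2) i by (auto simp: multiindices_def)
    qed
    then show ?thesis using i False by (auto intro!: prod_zero)
  qed simp
  finally show ?thesis .
qed

lemma parseval_grid:
  assumes A: "finite A" "A \<subseteq> multiindices n" and N: "N > 0"
    and AN: "\<And>\<alpha> i. \<alpha> \<in> A \<Longrightarrow> i < n \<Longrightarrow> \<alpha> i < N"
  shows "(\<Sum>u\<in>torus_grid n N. (cmod (\<Sum>\<alpha>\<in>A. b \<alpha> * monomial n \<alpha> u))\<^sup>2)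
       = real (N ^ n) * (\<Sum>\<alpha>\<in>A. (cmod (b \<alpha>))\<^sup>2)"
proof -
  let ?T = "torus_grid n N"
  have "complex_of_real (\<Sum>u\<in>?T. (cmod (\<Sum>\<alpha>\<in>A. b \<alpha> * monomial n \<alpha> u))\<^sup>2)
      = (\<Sum>u\<in>?T. \<Sum>\<alpha>\<in>A. \<Sum>\<beta>\<in>A. b \<alpha> * cnj (b \<beta>) * (monomial n \<alpha> u * cnj (monomial n \<beta> u)))"
    unfolding of_real_sum complex_norm_square
    by (simp add: sum_product mult_ac)
  also have "\<dots> = (\<Sum>\<alpha>\<in>A. \<Sum>\<beta>\<in>A. b \<alpha> * cnj (b \<beta>) *
                     (\<Sum>u\<in>?T. monomial n \<alpha> u * cnj (monomial n \<beta> u)))"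
    by (subst sum.swap, rule sum.cong[OF refl], subst sum.swap) (simp add: sum_distrib_left)
  also have "\<dots> = (\<Sum>\<alpha>\<in>A. \<Sum>\<beta>\<in>A. b \<alpha> * cnj (b \<beta>) * (if \<alpha> = \<beta> then of_nat (N ^ n) else 0))"
    using assms by (intro sum.cong refl) (subst monomials_orthogonal, auto)
  also have "\<dots> = (\<Sum>\<alpha>\<in>A. b \<alpha> * cnj (b \<alpha>) * of_nat (N ^ n))"
    using A by (simp add: if_distrib cong: if_cong)
  also have "\<dots> = complex_of_real (real (N ^ n) * (\<Sum>\<alpha>\<in>A. (cmod (b \<alpha>))\<^sup>2))"
    by (simp only: complex_norm_square[symmetric]) (simp add: sum_distrib_left mult_ac)
  finally show ?thesis using of_real_eq_iff by blast
qed

lemma parseval_homogeneous: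
  assumes "N > m"
  shows "(\<Sum>u\<in>torus_grid n N. (cmod (\<Sum>\<alpha>\<in>hom_indices n m. b \<alpha> * monomial n \<alpha> u))\<^sup>2)
       = real (N ^ n) * (\<Sum>\<alpha>\<in>hom_indices n m. (cmod (b \<alpha>))\<^sup>2)"
  using assms hom_indices_le[of _ n m]
  by (intro parseval_grid) (auto intro: le_less_trans, auto simp: hom_indices_def)

text \<open>Parseval: the mean square over the torus is at most the square of the supremum.\<close>
lemma sum_norm_coeff_square_le:
  assumes F: "\<And>u. u \<in> cspace n \<Longrightarrow> (\<And>i. cmod (u i) \<le> 1) \<Longrightarrow>
     cmod (\<Sum>\<alpha>\<in>hom_indices n m. b \<alpha> * monomial n \<alpha> u) \<le> F"
  shows "(\<Sum>\<alpha>\<in>hom_indices n m. (cmod (b \<alpha>))\<^sup>2) \<le> F\<^sup>2"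
proof -
  let ?N = "Suc m"
  have "real (?N ^ n) * (\<Sum>\<alpha>\<in>hom_indices n m. (cmod (b \<alpha>))\<^sup>2)
      = (\<Sum>u\<in>torus_grid n ?N. (cmod (\<Sum>\<alpha>\<in>hom_indices n m. b \<alpha> * monomial n \<alpha> u))\<^sup>2)"
    by (rule parseval_homogeneous[symmetric]) simp
  also have "\<dots> \<le> (\<Sum>u\<in>torus_grid n ?N. F\<^sup>2)"
    by (intro sum_mono power_mono F norm_torus_grid[of ?N]) (auto dest: torus_grid_in_cspace)
  also have "\<dots> = real (?N ^ n) * F\<^sup>2" by (simp add: card_torus_grid)
  finally show ?thesis by (simp del: of_nat_Suc of_nat_power)
qed

lemma norm_coeff_le:
  assumes F: "\<And>u. u \<in> cspace n \<Longrightarrow> (\<And>i. cmod (u i) \<le> 1) \<Longrightarrow>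
     cmod (\<Sum>\<alpha>\<in>hom_indices n m. b \<alpha> * monomial n \<alpha> u) \<le> F"
    and \<alpha>: "\<alpha> \<in> hom_indices n m"
  shows "cmod (b \<alpha>) \<le> F"
proof -
  have "(cmod (b \<alpha>))\<^sup>2 \<le> (\<Sum>\<alpha>\<in>hom_indices n m. (cmod (b \<alpha>))\<^sup>2)"
    using \<alpha> by (intro member_le_sum) auto
  also have "\<dots> \<le> F\<^sup>2" using F by (rule sum_norm_coeff_square_le)
  finally have "(cmod (b \<alpha>))\<^sup>2 \<le> F\<^sup>2" .
  moreover have "0 \<le> F"
    using F[of "\<lambda>_. 0"] order_trans[OF norm_ge_zero] by (force simp: cspace_def)
  ultimately show ?thesis by (rule power2_le_imp_le)
qed

lemma monomial_add: "monomial n (\<lambda>i. \<alpha> i + \<beta> i) u = monomial n \<alpha> u * monomial n \<beta> u"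
  by (simp add: monomial_def power_add prod.distrib)

section \<open>Comparing norms of homogeneous polynomials on the torus\<close>

text \<open>The coefficient of \<open>z\<^sup>\<gamma>\<close> in \<open>Q\<^sup>2\<close> is a sum over the pairs \<open>\<alpha> + \<beta> = \<gamma>\<close>. There are at most
\<open>\<Prod> (\<gamma>\<^sub>i + 1) \<le> 2\<^bsup>\<Sum> \<gamma>\<^sub>i\<^esup> = 4\<^sup>M\<close> of them, so Cauchy-Schwarz and Parseval for \<open>Q\<^sup>2\<close> bound the fourth moment.\<close>
lemma L4_le_L2:
  assumes N: "N > 2 * M"
  shows "(\<Sum>u\<in>torus_grid n N. cmod (\<Sum>\<beta>\<in>hom_indices n M. b \<beta> * monomial n \<beta> u) ^ 4)
       \<le> real (N ^ n) * (4 ^ M * (\<Sum>\<beta>\<in>hom_indices n M. (cmod (b \<beta>))\<^sup>2)\<^sup>2)"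
proof -
  let ?H = "hom_indices n M" and ?G = "hom_indices n (2 * M)" and ?T = "torus_grid n N"
  define add :: "(nat \<Rightarrow> nat) \<times> (nat \<Rightarrow> nat) \<Rightarrow> nat \<Rightarrow> nat"
    where "add s = (\<lambda>i. fst s i + snd s i)" for s
  define S where "S \<gamma> = {s \<in> ?H \<times> ?H. add s = \<gamma>}" for \<gamma>
  define d where "d \<gamma> = (\<Sum>s\<in>S \<gamma>. b (fst s) * b (snd s))" for \<gamma>
  have SG: "add ` (?H \<times> ?H) \<subseteq> ?G"
    by (auto simp: add_def hom_indices_def multiindices_def sum.distrib)
  have fS: "finite (S \<gamma>)" for \<gamma>
    by (rule finite_subset[of _ "?H \<times> ?H"]) (auto simp: S_def)
  have cS: "real (card (S \<gamma>)) \<le> 4 ^ M" if \<gamma>: "\<gamma> \<in> ?G" for \<gamma>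
  proof -
    have "inj_on fst (S \<gamma>)"
    proof (rule inj_onI, clarify)
      fix \<alpha> \<beta> \<alpha>' \<beta>' assume "(\<alpha>, \<beta>) \<in> S \<gamma>" "(\<alpha>', \<beta>') \<in> S \<gamma>" "fst (\<alpha>, \<beta>) = fst (\<alpha>', \<beta>')"
      then have "\<alpha> i + \<beta> i = \<alpha> i + \<beta>' i" "\<alpha> = \<alpha>'" for i by (auto simp: S_def add_def fun_eq_iff)
      then show "\<alpha> = \<alpha>' \<and> \<beta> = \<beta>'" by auto
    qed
    moreover have "fst ` S \<gamma> \<subseteq> choices n (\<lambda>i. {..\<gamma> i})"
      by (auto simp: S_def add_def choices_def hom_indices_def multiindices_def)
    ultimately have "card (S \<gamma>) \<le> card (choices n (\<lambda>i. {..\<gamma> i}))"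
      by (intro card_inj_on_le[of fst]) (auto intro: finite_choices)
    also have "\<dots> = (\<Prod>i<n. Suc (\<gamma> i))" by (subst card_choices) auto
    also have "\<dots> \<le> (\<Prod>i<n. 2 ^ \<gamma> i)"
      by (intro prod_mono) (auto simp: Suc_le_eq less_exp)
    also have "\<dots> = 2 ^ (2 * M)" using \<gamma> by (simp add: power_sum[symmetric] hom_indices_def)
    also have "\<dots> = (4::nat) ^ M" by (simp add: power_mult)
    finally show ?thesis by (metis of_nat_le_iff of_nat_numeral of_nat_power)
  qed
  have group: "(\<Sum>\<gamma>\<in>?G. \<Sum>s\<in>S \<gamma>. h s) = (\<Sum>s\<in>?H \<times> ?H. h s)"
    for h :: "_ \<Rightarrow> 'c::comm_monoid_add"
    unfolding S_def by (rule sum.group[OF _ _ SG]) auto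
  have sq: "(\<Sum>\<beta>\<in>?H. b \<beta> * monomial n \<beta> u)\<^sup>2 = (\<Sum>\<gamma>\<in>?G. d \<gamma> * monomial n \<gamma> u)" for u
  proof -
    have "(\<Sum>\<beta>\<in>?H. b \<beta> * monomial n \<beta> u)\<^sup>2
        = (\<Sum>s\<in>?H \<times> ?H. b (fst s) * b (snd s) * monomial n (add s) u)"
      by (simp add: power2_eq_square sum_product sum.cartesian_product monomial_add mult_ac
          add_def case_prod_unfold)
    also have "\<dots> = (\<Sum>\<gamma>\<in>?G. \<Sum>s\<in>S \<gamma>. b (fst s) * b (snd s) * monomial n (add s) u)"
      by (rule group[symmetric])
    also have "\<dots> = (\<Sum>\<gamma>\<in>?G. d \<gamma> * monomial n \<gamma> u)"
      unfolding d_def sum_distrib_right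
      by (intro sum.cong refl) (auto simp: S_def)
    finally show ?thesis .
  qed
  have "(\<Sum>u\<in>?T. cmod (\<Sum>\<beta>\<in>?H. b \<beta> * monomial n \<beta> u) ^ 4)
      = (\<Sum>u\<in>?T. (cmod (\<Sum>\<gamma>\<in>?G. d \<gamma> * monomial n \<gamma> u))\<^sup>2)"
    by (simp add: sq[symmetric] norm_power flip: power_mult)
  also have "\<dots> = real (N ^ n) * (\<Sum>\<gamma>\<in>?G. (cmod (d \<gamma>))\<^sup>2)"
    using N by (intro parseval_homogeneous) auto
  also have "(\<Sum>\<gamma>\<in>?G. (cmod (d \<gamma>))\<^sup>2)
      \<le> (\<Sum>\<gamma>\<in>?G. 4 ^ M * (\<Sum>s\<in>S \<gamma>. (cmod (b (fst s) * b (snd s)))\<^sup>2))"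
  proof (rule sum_mono)
    fix \<gamma> assume \<gamma>: "\<gamma> \<in> ?G"
    have "(cmod (d \<gamma>))\<^sup>2 \<le> (\<Sum>s\<in>S \<gamma>. 1 * cmod (b (fst s) * b (snd s)))\<^sup>2"
      unfolding d_def by (intro power_mono) (auto intro: norm_sum)
    also have "\<dots> \<le> (\<Sum>s\<in>S \<gamma>. 1\<^sup>2) * (\<Sum>s\<in>S \<gamma>. (cmod (b (fst s) * b (snd s)))\<^sup>2)"
      by (rule Cauchy_Schwarz_ineq_sum)
    also have "\<dots> \<le> 4 ^ M * (\<Sum>s\<in>S \<gamma>. (cmod (b (fst s) * b (snd s)))\<^sup>2)"
      using cS[OF \<gamma>] by (intro mult_right_mono) (auto intro: sum_nonneg)
    finally show "(cmod (d \<gamma>))\<^sup>2 \<le> 4 ^ M * (\<Sum>s\<in>S \<gamma>. (cmod (b (fst s) * b (snd s)))\<^sup>2)" .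
  qed
  also have "\<dots> = 4 ^ M * (\<Sum>s\<in>?H \<times> ?H. (cmod (b (fst s) * b (snd s)))\<^sup>2)"
    by (simp only: sum_distrib_left[symmetric] group)
  also have "\<dots> = 4 ^ M * (\<Sum>\<beta>\<in>?H. (cmod (b \<beta>))\<^sup>2)\<^sup>2"
    by (simp add: power2_eq_square[of "sum _ _"] sum_product sum.cartesian_product
        norm_mult power_mult_distrib case_prod_unfold)
  finally show ?thesis by (simp add: mult_left_mono)
qed

text \<open>Where \<open>\<bar>Q\<bar> \<le> t\<close> the second moment is controlled by \<open>t\<close> times the first, elsewhere by \<open>1 / t\<^sup>2\<close> times the
fourth. The threshold \<open>t\<close> is chosen so that the fourth moment accounts for at most half of the
second moment.\<close>
lemma L2_le_L1:
  assumes N: "N > 2 * M"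
  shows "real (N ^ n) * sqrt (\<Sum>\<beta>\<in>hom_indices n M. (cmod (b \<beta>))\<^sup>2)
       \<le> 2 * sqrt 2 * 2 ^ M * (\<Sum>u\<in>torus_grid n N. cmod (\<Sum>\<beta>\<in>hom_indices n M. b \<beta> * monomial n \<beta> u))"
proof -
  let ?T = "torus_grid n N"
  define Q where "Q u = cmod (\<Sum>\<beta>\<in>hom_indices n M. b \<beta> * monomial n \<beta> u)" for u
  define V where "V = (\<Sum>\<beta>\<in>hom_indices n M. (cmod (b \<beta>))\<^sup>2)"
  have V0: "V \<ge> 0" by (simp add: V_def sum_nonneg)
  have "real (N ^ n) * sqrt V \<le> 2 * sqrt 2 * 2 ^ M * (\<Sum>u\<in>?T. Q u)"
  proof (cases "V = 0")
    case False
    then have V: "V > 0" using V0 by simp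
    \<comment> \<open>\<open>t\<^sup>2\<close> is twice the bound \<open>4\<^sup>M V\<close> for the quotient of the fourth and the second moment\<close>
    define t where "t = sqrt 2 * 2 ^ M * sqrt V"
    have t: "t > 0" using V by (simp add: t_def)
    have t2: "t\<^sup>2 = 2 * 4 ^ M * V"
      using V by (simp add: t_def power_mult_distrib)
         (simp add: power2_eq_square flip: power_mult_distrib)
    have le: "x\<^sup>2 \<le> t * x + x ^ 4 / t\<^sup>2" if "x \<ge> 0" for x
    proof (cases "x \<le> t")
      case True
      then have "x * x \<le> t * x" using that by (intro mult_right_mono)
      moreover have "0 \<le> x ^ 4 / t\<^sup>2" by simp
      ultimately show ?thesis unfolding power2_eq_square[of x] by linarith
    next
      case False
      then have "t\<^sup>2 \<le> x\<^sup>2" using t by (intro power_mono) auto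
      then have "x\<^sup>2 * t\<^sup>2 \<le> x\<^sup>2 * x\<^sup>2" by (intro mult_left_mono) auto
      then have "x\<^sup>2 \<le> x ^ 4 / t\<^sup>2" using t by (simp add: divide_simps flip: power_add)
      moreover have "0 \<le> t * x" using t that by simp
      ultimately show ?thesis by linarith
    qed
    have "real (N ^ n) * V = (\<Sum>u\<in>?T. (Q u)\<^sup>2)"
      unfolding V_def Q_def using N by (intro parseval_homogeneous[symmetric]) simp
    also have "\<dots> \<le> (\<Sum>u\<in>?T. t * Q u + Q u ^ 4 / t\<^sup>2)"
      by (intro sum_mono le) (simp add: Q_def)
    also have "\<dots> = t * (\<Sum>u\<in>?T. Q u) + (\<Sum>u\<in>?T. Q u ^ 4) / t\<^sup>2"
      by (simp add: sum.distrib sum_distrib_left sum_divide_distrib)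
    also have "\<dots> \<le> t * (\<Sum>u\<in>?T. Q u) + real (N ^ n) * (4 ^ M * V\<^sup>2) / t\<^sup>2"
      unfolding Q_def V_def using L4_le_L2[OF N] by (intro add_left_mono divide_right_mono) auto
    also have "real (N ^ n) * (4 ^ M * V\<^sup>2) / t\<^sup>2 = real (N ^ n) * V / 2"
      using V unfolding t2 by (simp add: field_simps power2_eq_square)
    finally have "real (N ^ n) * V \<le> 2 * t * (\<Sum>u\<in>?T. Q u)" by simp
    also have "\<dots> = sqrt V * (2 * sqrt 2 * 2 ^ M * (\<Sum>u\<in>?T. Q u))" by (simp add: t_def)
    finally have "sqrt V * (real (N ^ n) * sqrt V) \<le> sqrt V * (2 * sqrt 2 * 2 ^ M * (\<Sum>u\<in>?T. Q u))"
      using V by (simp add: mult.left_commute[of "sqrt V"] flip: real_sqrt_mult)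
    moreover have "sqrt V > 0" using V by simp
    ultimately show ?thesis by (simp only: mult_le_cancel_left_pos)
  qed (auto simp: Q_def intro!: sum_nonneg mult_nonneg_nonneg)
  then show ?thesis by (simp add: Q_def V_def)
qed

section \<open>Coefficients of a bounded function\<close>

text \<open>Let \<open>s\<close> be unimodular with \<open>s c\<^sub>0 = \<bar>c\<^sub>0\<bar>\<close>. The \<open>m\<close>-th Fourier coefficient of \<open>cnj (s g)\<close> and of a constant
vanishes, so \<open>s c\<^sub>m\<close> is also the \<open>m\<close>-th coefficient of \<open>2 (Re (s g) - F)\<close>. This function has constant
sign, and its mean is \<open>2 (\<bar>c\<^sub>0\<bar> - F)\<close>.\<close>
lemma norm_coeff_le_Re_gap:
  fixes c :: "nat \<Rightarrow> complex"
  assumes F: "\<And>w. cmod w = 1 \<Longrightarrow> cmod (\<Sum>k\<le>N. c k * w ^ k) \<le> F" and m: "1 \<le> m" "m \<le> N"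
  shows "cmod (c m) \<le> 2 * (F - cmod (c 0))"
proof -
  define K where "K = Suc (2 * N)"
  let ?R = "unity_roots K"
  define g where "g w = (\<Sum>k\<le>N. c k * w ^ k)" for w
  have K: "K > 0" by (simp add: K_def)
  note fin = finite_unity_roots[OF K]
  obtain s where s: "cmod s = 1" "s * c 0 = of_real (cmod (c 0))"
  proof (cases "c 0 = 0")
    case False
    then show ?thesis
      by (intro that[of "cnj (c 0) / of_real (cmod (c 0))"])
         (auto simp: norm_divide complex_norm_square[symmetric] mult.commute power2_eq_square)
  qed (auto intro: that[of 1])
  have avg: "(\<Sum>w\<in>?R. g w * cnj w ^ j) = of_nat K * c j" if "j \<le> N" for j
  proof -
    have "(\<Sum>w\<in>?R. g w * cnj w ^ j) = (\<Sum>k\<le>N. c k * (\<Sum>w\<in>?R. w ^ k * cnj w ^ j))"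
      unfolding g_def sum_distrib_right sum_distrib_left by (subst sum.swap) (simp add: mult_ac)
    also have "\<dots> = (\<Sum>k\<le>N. if k = j then of_nat K * c k else 0)"
      using that by (intro sum.cong refl) (subst unity_roots_orthogonal, auto simp: K_def)
    finally show ?thesis using that by simp
  qed
  have avg': "(\<Sum>w\<in>?R. cnj (g w) * cnj w ^ m) = 0"
  proof -
    have "(\<Sum>w\<in>?R. cnj (g w) * cnj w ^ m) = (\<Sum>k\<le>N. cnj (c k) * (\<Sum>w\<in>?R. w ^ 0 * cnj w ^ (k + m)))"
      unfolding g_def cnj_sum sum_distrib_right sum_distrib_left
      by (subst sum.swap) (simp add: mult_ac power_add)
    also have "\<dots> = 0"
      using m by (intro sum.neutral ballI) (subst unity_roots_orthogonal, auto simp: K_def)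
    finally show ?thesis .
  qed
  have avg0: "(\<Sum>w\<in>?R. cnj w ^ m) = 0"
    using unity_roots_orthogonal[of 0 K m] m by (simp add: K_def)
  have "real K * cmod (c m) = cmod (s * (\<Sum>w\<in>?R. g w * cnj w ^ m))"
    using s m by (simp add: avg norm_mult)
  also have "s * (\<Sum>w\<in>?R. g w * cnj w ^ m)
      = s * (\<Sum>w\<in>?R. g w * cnj w ^ m) + cnj s * (\<Sum>w\<in>?R. cnj (g w) * cnj w ^ m)
        - 2 * of_real F * (\<Sum>w\<in>?R. cnj w ^ m)"
    by (simp add: avg' avg0)
  also have "\<dots> = (\<Sum>w\<in>?R. (s * g w + cnj (s * g w) - 2 * of_real F) * cnj w ^ m)"
    by (simp add: sum_distrib_left sum.distrib sum_subtractf algebra_simps)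
  also have "\<dots> = (\<Sum>w\<in>?R. of_real (2 * (Re (s * g w) - F)) * cnj w ^ m)"
  proof (rule sum.cong[OF refl])
    have "of_real (2 * x) - 2 * of_real F = complex_of_real (2 * (x - F))" for x
      by (simp add: algebra_simps)
    then show "(s * g w + cnj (s * g w) - 2 * of_real F) * cnj w ^ m
        = of_real (2 * (Re (s * g w) - F)) * cnj w ^ m" for w
      by (simp only: complex_add_cnj)
  qed
  also have "cmod \<dots> \<le> (\<Sum>w\<in>?R. 2 * (F - Re (s * g w)))"
  proof (rule sum_norm_le)
    fix w assume w: "w \<in> ?R"
    have 1: "cmod w = 1" using norm_unity_roots[OF K w] .
    have "Re (s * g w) \<le> cmod (s * g w)" by (rule complex_Re_le_cmod)
    also have "\<dots> \<le> F" using F[OF 1] s by (simp add: norm_mult g_def)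
    finally show "cmod (of_real (2 * (Re (s * g w) - F)) * cnj w ^ m) \<le> 2 * (F - Re (s * g w))"
      using 1 by (simp add: norm_mult norm_power del: of_real_mult of_real_diff)
  qed
  also have "\<dots> = 2 * (real K * F - Re (s * (\<Sum>w\<in>?R. g w * cnj w ^ 0)))"
    by (simp add: sum_subtractf card_unity_roots[OF K] flip: sum_distrib_left Re_sum)
  also have "\<dots> = 2 * (real K * F - Re (of_nat K * (s * c 0)))"
    unfolding avg[OF le0] by (simp add: mult_ac)
  also have "\<dots> = real K * (2 * (F - cmod (c 0)))"
    using s by (simp add: algebra_simps)
  finally show ?thesis using K by simp
qed

section \<open>Directional derivatives of homogeneous polynomials\<close>
lemma DERIV_monomial:
  "((\<lambda>l. monomial n \<alpha> (\<lambda>i. z i + l * w i)) has_field_derivative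
     (\<Sum>k<n. of_nat (\<alpha> k) * (w k * monomial n (\<alpha>(k := \<alpha> k - 1)) z))) (at 0)"
proof -
  have "((\<lambda>l. \<Prod>i\<in>{..<n}. (z i + l * w i) ^ \<alpha> i) has_field_derivative
     (\<Sum>k\<in>{..<n}. (of_nat (\<alpha> k) * (w k * z k ^ (\<alpha> k - 1))) * (\<Prod>i\<in>{..<n} - {k}. (z i + 0 * w i) ^ \<alpha> i))) (at 0)"
    by (rule has_field_derivative_prod) (auto intro!: derivative_eq_intros)
  also have "(\<Sum>k\<in>{..<n}. (of_nat (\<alpha> k) * (w k * z k ^ (\<alpha> k - 1))) * (\<Prod>i\<in>{..<n} - {k}. (z i + 0 * w i) ^ \<alpha> i))
     = (\<Sum>k<n. of_nat (\<alpha> k) * (w k * monomial n (\<alpha>(k := \<alpha> k - 1)) z))"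
  proof (rule sum.cong[OF refl])
    fix k assume "k \<in> {..<n}"
    then have "monomial n (\<alpha>(k := \<alpha> k - 1)) z = z k ^ (\<alpha> k - 1) * (\<Prod>i\<in>{..<n} - {k}. z i ^ \<alpha> i)"
      unfolding monomial_def by (subst prod.remove[of _ k]) (auto intro!: prod.cong)
    then show "(of_nat (\<alpha> k) * (w k * z k ^ (\<alpha> k - 1))) * (\<Prod>i\<in>{..<n} - {k}. (z i + 0 * w i) ^ \<alpha> i)
       = of_nat (\<alpha> k) * (w k * monomial n (\<alpha>(k := \<alpha> k - 1)) z)" by simp
  qed
  finally show ?thesis by (simp add: monomial_def)
qed

text \<open>The coefficients of \<open>\<Sum>\<^sub>k w\<^sub>k \<partial>\<^sub>k P\<close>, where \<open>P\<close> has coefficients \<open>a\<close> and degree \<open>M + 1\<close>.\<close>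
definition dir_deriv ::
    "nat \<Rightarrow> nat \<Rightarrow> ((nat \<Rightarrow> nat) \<Rightarrow> complex) \<Rightarrow> (nat \<Rightarrow> complex) \<Rightarrow> (nat \<Rightarrow> nat) \<Rightarrow> complex" where
  "dir_deriv n M a w \<beta> = (\<Sum>k<n. w k * (of_nat (Suc (\<beta> k)) * a (\<beta>(k := Suc (\<beta> k)))))"

text \<open>Cauchy's inequality for the derivative at \<open>0\<close> of \<open>l \<mapsto> P (z + l w)\<close> on the disc of radius \<open>1 / (M + 1)\<close>.\<close>
lemma norm_dir_deriv_le:
  assumes B: "\<And>l. cmod l = 1 / real (Suc M) \<Longrightarrow>
      cmod (\<Sum>\<alpha>\<in>hom_indices n (Suc M). a \<alpha> * monomial n \<alpha> (\<lambda>i. z i + l * w i)) \<le> B"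
  shows "cmod (\<Sum>\<beta>\<in>hom_indices n M. dir_deriv n M a w \<beta> * monomial n \<beta> z) \<le> real (Suc M) * B"
proof -
  define g where "g l = (\<Sum>\<alpha>\<in>hom_indices n (Suc M). a \<alpha> * monomial n \<alpha> (\<lambda>i. z i + l * w i))" for l
  define D where "D = (\<Sum>\<alpha>\<in>hom_indices n (Suc M). a \<alpha> *
     (\<Sum>k<n. of_nat (\<alpha> k) * (w k * monomial n (\<alpha>(k := \<alpha> k - 1)) z)))"
  have "(g has_field_derivative D) (at 0)"
    unfolding g_def D_def by (intro DERIV_sum DERIV_cmult DERIV_monomial)
  then have "deriv g 0 = D" by (rule DERIV_imp_deriv)
  moreover have "cmod ((deriv ^^ 1) g 0) \<le> fact 1 * B / (1 / real (Suc M)) ^ 1"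
  proof (rule Cauchy_inequality)
    show "g holomorphic_on ball 0 (1 / real (Suc M))"
      unfolding g_def monomial_def by (intro holomorphic_intros)
    show "continuous_on (cball 0 (1 / real (Suc M))) g"
      unfolding g_def monomial_def by (intro continuous_intros)
    show "cmod (g x) \<le> B" if "cmod (0 - x) = 1 / real (Suc M)" for x
      using B[of x] that by (simp add: g_def)
  qed simp
  moreover have "D = (\<Sum>\<beta>\<in>hom_indices n M. dir_deriv n M a w \<beta> * monomial n \<beta> z)"
  proof -
    have "D = (\<Sum>\<alpha>\<in>hom_indices n (Suc M). \<Sum>k<n. of_nat (\<alpha> k) *
               (a \<alpha> * (w k * monomial n (\<alpha>(k := \<alpha> k - 1)) z)))"
      by (simp add: D_def sum_distrib_left mult_ac)
    also have "\<dots> = (\<Sum>\<beta>\<in>hom_indices n M. \<Sum>k<n. of_nat (Suc (\<beta> k)) *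
               (a (\<beta>(k := Suc (\<beta> k))) * (w k * monomial n \<beta> z)))"
      by (subst sum_hom_indices_Suc) (simp del: of_nat_Suc)
    also have "\<dots> = (\<Sum>\<beta>\<in>hom_indices n M. dir_deriv n M a w \<beta> * monomial n \<beta> z)"
      unfolding dir_deriv_def sum_distrib_right by (simp add: mult_ac del: of_nat_Suc)
    finally show ?thesis .
  qed
  ultimately show ?thesis by (simp add: mult.commute)
qed

lemma monomial_scale:
  "\<alpha> \<in> hom_indices n m \<Longrightarrow> monomial n \<alpha> (\<lambda>i. r * z i) = r ^ m * monomial n \<alpha> z"
  by (auto simp: monomial_def power_mult_distrib prod.distrib hom_indices_def power_sum)

lemma one_plus_inverse_power_le_exp: "(1 + 1 / real (Suc M)) ^ Suc M \<le> exp 1"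
proof -
  have "(1 + 1 / real (Suc M)) ^ Suc M \<le> exp (1 / real (Suc M)) ^ Suc M"
    by (intro power_mono) auto
  also have "\<dots> = exp (real (Suc M) * (1 / real (Suc M)))"
    by (rule exp_of_nat_mult[symmetric])
  finally show ?thesis by (simp del: of_nat_Suc)
qed

text \<open>For \<open>z\<close> and \<open>w\<close> in a ball, \<open>z + l w\<close> lies in \<open>1 + 1 / (M + 1)\<close> times the ball. By homogeneity this costs
only the factor \<open>(1 + 1 / (M + 1))\<^bsup>M + 1\<^esup> \<le> e\<close>.\<close>
lemma norm_dir_deriv_le_sup:
  assumes F: "\<And>z. z \<in> K \<Longrightarrow> cmod (\<Sum>\<alpha>\<in>hom_indices n (Suc M). a \<alpha> * monomial n \<alpha> z) \<le> F"
    and K: "\<And>l. cmod l = 1 / real (Suc M) \<Longrightarrow>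
      (\<lambda>i. (z i + l * w i) / of_real (1 + 1 / real (Suc M))) \<in> K"
  shows "cmod (\<Sum>\<beta>\<in>hom_indices n M. dir_deriv n M a w \<beta> * monomial n \<beta> z)
          \<le> real (Suc M) * (exp 1 * F)"
proof (rule norm_dir_deriv_le)
  fix l assume l: "cmod l = 1 / real (Suc M)"
  define R where "R = 1 + 1 / real (Suc M)"
  have R: "R > 0" by (simp add: R_def add_pos_pos)
  let ?v = "\<lambda>i. (z i + l * w i) / of_real R"
  have eq: "(\<lambda>i. z i + l * w i) = (\<lambda>i. of_real R * ?v i)" using R by simp
  have "cmod (\<Sum>\<alpha>\<in>hom_indices n (Suc M). a \<alpha> * monomial n \<alpha> (\<lambda>i. z i + l * w i))
      = cmod (of_real R ^ Suc M * (\<Sum>\<alpha>\<in>hom_indices n (Suc M). a \<alpha> * monomial n \<alpha> ?v))"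
    unfolding sum_distrib_left
    by (subst eq, intro arg_cong[where f = cmod] sum.cong refl, subst monomial_scale)
       (auto simp: mult_ac)
  also have "\<dots> = R ^ Suc M * cmod (\<Sum>\<alpha>\<in>hom_indices n (Suc M). a \<alpha> * monomial n \<alpha> ?v)"
    using R by (simp add: norm_mult norm_power)
  also have "\<dots> \<le> exp 1 * F"
  proof (rule mult_mono)
    show "R ^ Suc M \<le> exp 1" unfolding R_def by (rule one_plus_inverse_power_le_exp)
    show "cmod (\<Sum>\<alpha>\<in>hom_indices n (Suc M). a \<alpha> * monomial n \<alpha> ?v) \<le> F"
      using F K[OF l] unfolding R_def .
  qed auto
  finally show "cmod (\<Sum>\<alpha>\<in>hom_indices n (Suc M). a \<alpha> * monomial n \<alpha> (\<lambda>i. z i + l * w i)) \<le> exp 1 * F" .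
qed

section \<open>Unit balls of the finite-dimensional spaces\<close>
lemma recip_ereal [simp]: "recip (ereal P) = 1 / P"
  by (simp add: recip_def one_ereal_def)

lemma recip_infty [simp]: "recip \<infinity> = 0"
  by (simp add: recip_def)

lemma ge1_ereal_cases:
  assumes "1 \<le> (p::ereal)"
  obtains (infty) "p = \<infinity>" | (real) P where "p = ereal P" "1 \<le> P"
  using assms by (cases p) auto

lemma lball_infty_iff:
  assumes "n > 0"
  shows "z \<in> lball \<infinity> n \<longleftrightarrow> z \<in> cspace n \<and> (\<forall>i<n. cmod (z i) \<le> 1)"
proof -
  have "{..<n} \<noteq> {}" using assms by auto
  then have "Max ((\<lambda>i. cmod (z i)) ` {..<n}) \<le> 1 \<longleftrightarrow> (\<forall>i<n. cmod (z i) \<le> 1)"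
    by (subst Max_le_iff) auto
  then show ?thesis by (simp add: lball_def lnorm_def)
qed

lemma lball_real_iff:
  assumes "0 < P"
  shows "z \<in> lball (ereal P) n \<longleftrightarrow> z \<in> cspace n \<and> (\<Sum>i<n. cmod (z i) powr P) \<le> 1"
proof -
  let ?S = "\<Sum>i<n. cmod (z i) powr P"
  have "?S powr (1 / P) \<le> 1 \<longleftrightarrow> ?S \<le> 1"
    using powr_mono2[of "1 / P" ?S 1] powr_less_mono2[of "1 / P" 1 ?S] assms
    by (force simp: sum_nonneg not_le[symmetric])
  then show ?thesis by (simp add: lball_def lnorm_def)
qed

lemma norm_le_1_of_lball:
  assumes "1 \<le> p" "n > 0" "z \<in> lball p n"
  shows "cmod (z i) \<le> 1"
proof (cases "i < n")
  case True
  from assms(1) show ?thesis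
  proof (cases p rule: ge1_ereal_cases)
    case infty
    then show ?thesis using assms True by (simp add: lball_infty_iff)
  next
    case (real P)
    have "cmod (z i) powr P \<le> (\<Sum>i<n. cmod (z i) powr P)"
      using True by (intro member_le_sum) auto
    also have "\<dots> \<le> 1" using assms real by (simp add: lball_real_iff)
    finally have "cmod (z i) powr P \<le> 1" .
    then show ?thesis using real powr_less_mono2[of P 1 "cmod (z i)"] by (force simp: not_le[symmetric])
  qed
next
  case False
  then show ?thesis using assms by (simp add: lball_def cspace_def)
qed

lemma lball_solid:
  assumes "1 \<le> p" "n > 0" "z \<in> lball p n" "y \<in> cspace n" "\<And>i. i < n \<Longrightarrow> cmod (y i) \<le> cmod (z i)"
  shows "y \<in> lball p n"
  using assms(1)
proof (cases p rule: ge1_ereal_cases)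
  case infty
  then show ?thesis using assms by (auto simp: lball_infty_iff intro: order_trans)
next
  case (real P)
  have "(\<Sum>i<n. cmod (y i) powr P) \<le> (\<Sum>i<n. cmod (z i) powr P)"
    using assms real by (intro sum_mono powr_mono2) auto
  then show ?thesis using assms real by (auto simp: lball_real_iff)
qed

lemma sum_powr_le_1_of_lball:
  assumes "1 \<le> Q" "Q \<le> s" "n > 0" "z \<in> lball (ereal Q) n"
  shows "(\<Sum>i<n. cmod (z i) powr s) \<le> 1"
proof -
  have "(\<Sum>i<n. cmod (z i) powr s) \<le> (\<Sum>i<n. cmod (z i) powr Q)"
    using assms norm_le_1_of_lball[of "ereal Q" n z] by (intro sum_mono powr_mono') auto
  also have "\<dots> \<le> 1" using assms by (simp add: lball_real_iff)
  finally show ?thesis .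
qed

text \<open>The tangent of the concave power at the mean value \<open>1/n\<close>, that is, the weighted inequality of
arithmetic and geometric means for \<open>a\<^sub>i n\<close> and \<open>1\<close>.\<close>
lemma sum_powr_le_power_mean:
  fixes a :: "nat \<Rightarrow> real"
  assumes "0 \<le> \<theta>" "\<theta> \<le> 1" "n > 0" "\<And>i. i < n \<Longrightarrow> 0 \<le> a i" "(\<Sum>i<n. a i) \<le> 1"
  shows "(\<Sum>i<n. a i powr \<theta>) \<le> real n powr (1 - \<theta>)"
proof -
  have "a i powr \<theta> \<le> real n powr (- \<theta>) * (\<theta> * (a i * real n) + (1 - \<theta>))" if "i < n" for i
  proof (cases "a i = 0")
    case True
    then show ?thesis using assms by simp
  next
    case False
    then have a: "a i > 0" using assms(4)[OF that] by simp
    have "a i powr \<theta> = real n powr (- \<theta>) * ((a i * real n) powr \<theta> * 1 powr (1 - \<theta>))"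
      using a assms(3) by (simp add: powr_mult powr_minus field_simps)
    also have "(a i * real n) powr \<theta> * 1 powr (1 - \<theta>) \<le> \<theta> * (a i * real n) + (1 - \<theta>) * 1"
      using assms a by (intro Youngs_inequality_0) auto
    finally show ?thesis using assms(3) by (simp add: mult_left_mono)
  qed
  then have "(\<Sum>i<n. a i powr \<theta>) \<le> (\<Sum>i<n. real n powr (- \<theta>) * (\<theta> * (a i * real n) + (1 - \<theta>)))"
    by (intro sum_mono) auto
  also have "\<dots> = real n powr (- \<theta>) * (real n * (\<theta> * (\<Sum>i<n. a i) + (1 - \<theta>)))"
    by (simp add: sum.distrib flip: sum_distrib_left sum_distrib_right) (simp add: algebra_simps)
  also have "\<dots> \<le> real n powr (- \<theta>) * (real n * (\<theta> * 1 + (1 - \<theta>)))"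
    using assms by (intro mult_left_mono add_right_mono) auto
  also have "\<dots> = real n powr (1 - \<theta>)"
    using assms(3) by (simp add: powr_diff powr_minus field_simps)
  finally show ?thesis .
qed

text \<open>Hoelder's comparison of norms: for \<open>s \<le> q\<close> the worst point of the \<open>q\<close>-ball has equal coordinates.\<close>
lemma sum_powr_le_of_lball:
  assumes "1 \<le> q" "0 \<le> s" "s * recip q \<le> 1" "n > 0" "z \<in> lball q n"
  shows "(\<Sum>i<n. cmod (z i) powr s) \<le> real n powr (1 - s * recip q)"
  using assms(1)
proof (cases q rule: ge1_ereal_cases)
  case infty
  have "(\<Sum>i<n. cmod (z i) powr s) \<le> (\<Sum>i<n. 1)"
    using assms norm_le_1_of_lball[of q n z] by (intro sum_mono powr_le1) auto
  then show ?thesis using infty assms by simp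
next
  case (real Q)
  have "(\<Sum>i<n. (cmod (z i) powr Q) powr (s / Q)) \<le> real n powr (1 - s / Q)"
    using assms real by (intro sum_powr_le_power_mean) (auto simp: lball_real_iff)
  then show ?thesis using real by (simp add: powr_powr)
qed

lemma lball_convex_combination:
  assumes "1 \<le> p" "n > 0" "z \<in> lball p n" "w \<in> lball p n"
  shows "(\<lambda>i. (z i + l * w i) / of_real (1 + cmod l)) \<in> lball p n"
proof -
  define \<rho> where "\<rho> = cmod l"
  define v where "v = (\<lambda>i. (z i + l * w i) / of_real (1 + \<rho>))"
  have \<rho>: "\<rho> \<ge> 0" by (simp add: \<rho>_def)
  have vc: "v \<in> cspace n" using assms by (auto simp: v_def lball_def cspace_def)
  have nv: "cmod (v i) \<le> (1 / (1 + \<rho>)) * cmod (z i) + (\<rho> / (1 + \<rho>)) * cmod (w i)" for i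
  proof -
    have "cmod (v i) = cmod (z i + l * w i) / (1 + \<rho>)"
      unfolding v_def norm_divide norm_of_real using \<rho> by simp
    also have "\<dots> \<le> (cmod (z i) + \<rho> * cmod (w i)) / (1 + \<rho>)"
      using \<rho> norm_triangle_ineq[of "z i" "l * w i"]
      by (intro divide_right_mono) (auto simp: norm_mult \<rho>_def)
    finally show ?thesis by (simp add: add_divide_distrib)
  qed
  have w1: "1 / (1 + \<rho>) \<ge> 0" "\<rho> / (1 + \<rho>) \<ge> 0" "1 / (1 + \<rho>) + \<rho> / (1 + \<rho>) = 1"
    using \<rho> by (auto simp: field_simps)
  have "v \<in> lball p n"
    using assms(1)
  proof (cases p rule: ge1_ereal_cases)
    case infty
    have "cmod (v i) \<le> 1" for i
    proof -
      have "(1 / (1 + \<rho>)) * cmod (z i) + (\<rho> / (1 + \<rho>)) * cmod (w i) \<le> (1 / (1 + \<rho>)) * 1 + (\<rho> / (1 + \<rho>)) * 1"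
        using assms by (intro add_mono mult_left_mono w1 norm_le_1_of_lball[of p n]) auto
      then show ?thesis using nv[of i] w1(3) by linarith
    qed
    then show ?thesis using vc infty assms by (simp add: lball_infty_iff)
  next
    case (real P)
    have conv: "((1 / (1 + \<rho>)) * x + (\<rho> / (1 + \<rho>)) * y) powr P
        \<le> (1 / (1 + \<rho>)) * x powr P + (\<rho> / (1 + \<rho>)) * y powr P" if "0 \<le> x" "0 \<le> y" for x y
    proof -
      have tpow: "(t * x) powr P \<le> t * x powr P" if "0 \<le> t" "t \<le> 1" "0 \<le> x" for t x
      proof -
        have "t powr P \<le> t powr 1" using that real by (intro powr_mono') auto
        then show ?thesis using that by (simp add: powr_mult mult_right_mono)
      qed
      have r1: "1 / (1 + \<rho>) \<le> 1" "\<rho> / (1 + \<rho>) \<le> 1" using \<rho> by (auto simp: field_simps)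
      show ?thesis
      proof (cases "x = 0 \<or> y = 0")
        case True
        then show ?thesis using tpow[OF w1(1) r1(1) \<open>0 \<le> x\<close>] tpow[OF w1(2) r1(2) \<open>0 \<le> y\<close>] real
          by (auto simp del: times_divide_eq_left)
      next
        case False
        then have "((1 - \<rho> / (1 + \<rho>)) *\<^sub>R x + (\<rho> / (1 + \<rho>)) *\<^sub>R y) powr P
            \<le> (1 - \<rho> / (1 + \<rho>)) * x powr P + (\<rho> / (1 + \<rho>)) * y powr P"
          using w1 r1 that by (intro convex_onD[OF powr_convex[OF real(2)]]) auto
        moreover have "1 - \<rho> / (1 + \<rho>) = 1 / (1 + \<rho>)" using w1(3) by linarith
        ultimately show ?thesis by simp
      qed
    qed
    have "(\<Sum>i<n. cmod (v i) powr P)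
        \<le> (\<Sum>i<n. (1 / (1 + \<rho>)) * cmod (z i) powr P + (\<rho> / (1 + \<rho>)) * cmod (w i) powr P)"
    proof (rule sum_mono)
      fix i
      have "cmod (v i) powr P \<le> ((1 / (1 + \<rho>)) * cmod (z i) + (\<rho> / (1 + \<rho>)) * cmod (w i)) powr P"
        using nv[of i] real by (intro powr_mono2) auto
      also have "\<dots> \<le> (1 / (1 + \<rho>)) * cmod (z i) powr P + (\<rho> / (1 + \<rho>)) * cmod (w i) powr P"
        by (rule conv) auto
      finally show "cmod (v i) powr P \<le> (1 / (1 + \<rho>)) * cmod (z i) powr P + (\<rho> / (1 + \<rho>)) * cmod (w i) powr P" .
    qed
    also have "\<dots> = (1 / (1 + \<rho>)) * (\<Sum>i<n. cmod (z i) powr P) + (\<rho> / (1 + \<rho>)) * (\<Sum>i<n. cmod (w i) powr P)"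
      by (simp add: sum.distrib sum_distrib_left)
    also have "\<dots> \<le> (1 / (1 + \<rho>)) * 1 + (\<rho> / (1 + \<rho>)) * 1"
      using assms real by (intro add_mono mult_left_mono w1) (auto simp: lball_real_iff)
    also have "\<dots> = 1" using w1(3) by simp
    finally show ?thesis using vc real by (simp add: lball_real_iff)
  qed
  then show ?thesis by (simp add: v_def \<rho>_def)
qed

lemma zero_in_lball: "1 \<le> p \<Longrightarrow> n > 0 \<Longrightarrow> (\<lambda>_. 0) \<in> lball p n"
  by (erule ge1_ereal_cases) (auto simp: lball_infty_iff lball_real_iff cspace_def)

lemma norm_monomial: "cmod (monomial n \<alpha> z) = rmonomial n \<alpha> (\<lambda>i. cmod (z i))"
  by (simp add: monomial_def rmonomial_def norm_power flip: prod_norm)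

lemma rmonomial_scale:
  "\<alpha> \<in> hom_indices n m \<Longrightarrow> rmonomial n \<alpha> (\<lambda>i. r * x i) = r ^ m * rmonomial n \<alpha> x"
  by (auto simp: rmonomial_def power_mult_distrib prod.distrib hom_indices_def power_sum)

lemma rmonomial_mult: "rmonomial n \<alpha> (\<lambda>i. x i * y i) = rmonomial n \<alpha> x * rmonomial n \<alpha> y"
  by (simp add: rmonomial_def power_mult_distrib prod.distrib)

lemma monomial_mult: "monomial n \<alpha> (\<lambda>i. x i * y i) = monomial n \<alpha> x * monomial n \<alpha> y"
  by (simp add: monomial_def power_mult_distrib prod.distrib)

section \<open>The Bohr inequality and homogeneous polynomials\<close>
definition low_indices :: "nat \<Rightarrow> nat \<Rightarrow> (nat \<Rightarrow> nat) set" where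
  "low_indices n N = (\<Union>k\<le>N. hom_indices n k)"

lemma hom_indices_subset_multiindices: "hom_indices n m \<subseteq> multiindices n"
  by (auto simp: hom_indices_def)

lemma finite_low_indices [simp]: "finite (low_indices n N)"
  by (simp add: low_indices_def)

lemma low_indices_subset: "low_indices n N \<subseteq> multiindices n"
  by (auto simp: low_indices_def hom_indices_def)

lemma sum_low_indices:
  fixes g :: "_ \<Rightarrow> 'a::comm_monoid_add"
  shows "sum g (low_indices n N) = (\<Sum>k\<le>N. \<Sum>\<alpha>\<in>hom_indices n k. g \<alpha>)"
  unfolding low_indices_def
  by (rule sum.UNION_disjoint) (simp_all, auto simp: hom_indices_def)

lemma finite_subset_low_indices:
  assumes "finite X" "X \<subseteq> multiindices n"
  obtains N where "m \<le> N" "X \<subseteq> low_indices n N"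
proof
  define N where "N = m + (\<Sum>\<alpha>\<in>X. \<Sum>i<n. \<alpha> i)"
  show "m \<le> N" by (simp add: N_def)
  show "X \<subseteq> low_indices n N"
  proof
    fix \<alpha> assume a: "\<alpha> \<in> X"
    then have "(\<Sum>i<n. \<alpha> i) \<le> (\<Sum>\<alpha>\<in>X. \<Sum>i<n. \<alpha> i)"
      using assms by (intro member_le_sum) auto
    then show "\<alpha> \<in> low_indices n N"
      using a assms by (auto simp: low_indices_def hom_indices_def N_def)
  qed
qed

text \<open>Along the circle \<open>w \<mapsto> w z\<close>, the function \<open>f\<close> is up to \<open>e / 2\<close> a polynomial in \<open>w\<close> whose coefficients are
the values of the homogeneous parts at \<open>z\<close>; the error is uniform since the series converges
absolutely.\<close>
lemma homogeneous_part_le: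
  assumes f: "entire_series n a f" and p: "1 \<le> p" "n > 0"
    and F: "\<And>z. z \<in> lball p n \<Longrightarrow> cmod (f z) \<le> F"
    and m: "1 \<le> m" and z: "z \<in> lball p n"
  shows "cmod (\<Sum>\<alpha>\<in>hom_indices n m. a \<alpha> * monomial n \<alpha> z) \<le> 2 * (F - cmod (a (\<lambda>_. 0)))"
proof (rule field_le_epsilon)
  fix e :: real assume e: "e > 0"
  have zc: "z \<in> cspace n" using z by (simp add: lball_def)
  define g where "g \<alpha> = cmod (a \<alpha> * monomial n \<alpha> z)" for \<alpha>
  have "((\<lambda>\<alpha>. a \<alpha> * monomial n \<alpha> z) has_sum f z) (multiindices n)"
    using f zc by (simp add: entire_series_def)
  then have "(\<lambda>\<alpha>. a \<alpha> * monomial n \<alpha> z) summable_on multiindices n"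
    by (rule has_sum_imp_summable)
  then have gs: "g summable_on multiindices n"
    unfolding g_def by (rule summable_on_iff_abs_summable_on_complex[THEN iffD1])
  define S where "S = infsum g (multiindices n)"
  have "(g has_sum S) (multiindices n)" using gs by (simp add: S_def)
  then obtain X where X: "finite X" "X \<subseteq> multiindices n" "dist (sum g X) S \<le> e / 2"
    using has_sum_finite_approximation[of g "multiindices n" S "e / 2"] e by auto
  obtain N where N: "m \<le> N" "X \<subseteq> low_indices n N"
    using finite_subset_low_indices[OF X(1,2)] .
  let ?T = "low_indices n N" and ?U = "multiindices n - low_indices n N"
  have un: "multiindices n = ?T \<union> ?U" using low_indices_subset[of n N] by auto
  have gU: "g summable_on ?U" by (rule summable_on_subset[OF gs]) auto
  have "S = sum g ?T + infsum g ?U"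
    unfolding S_def by (subst un, subst infsum_Un_disjoint) (auto intro: gU)
  moreover have "sum g X \<le> sum g ?T" by (intro sum_mono2 N) (auto simp: g_def)
  ultimately have tail: "infsum g ?U \<le> e / 2" using X(3) unfolding dist_real_def by linarith
  define c where "c k = (\<Sum>\<alpha>\<in>hom_indices n k. a \<alpha> * monomial n \<alpha> z)" for k
  have "cmod (\<Sum>k\<le>N. c k * w ^ k) \<le> F + e / 2" if w: "cmod w = 1" for w
  proof -
    let ?wz = "\<lambda>i. w * z i"
    define h where "h \<alpha> = a \<alpha> * monomial n \<alpha> ?wz" for \<alpha>
    have wzc: "?wz \<in> cspace n" using zc by (simp add: cspace_def)
    have "?wz \<in> lball p n"
      by (rule lball_solid[OF p z wzc]) (simp add: norm_mult w)
    then have Fw: "cmod (f ?wz) \<le> F" by (rule F)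
    have nh: "norm (h \<alpha>) = g \<alpha>" for \<alpha>
      by (simp add: h_def g_def norm_mult norm_monomial w)
    have hs: "(h has_sum f ?wz) (multiindices n)"
      unfolding h_def using f wzc by (simp add: entire_series_def)
    have hU: "h summable_on ?U" by (rule summable_on_subset[OF has_sum_imp_summable[OF hs]]) auto
    have "f ?wz = infsum h (multiindices n)" using hs by (simp add: infsumI)
    also have "\<dots> = sum h ?T + infsum h ?U"
      by (subst un, subst infsum_Un_disjoint) (auto intro: hU)
    finally have "sum h ?T = f ?wz - infsum h ?U" by simp
    moreover have "cmod (infsum h ?U) \<le> e / 2"
      using norm_infsum_bound[of h ?U] gU tail by (simp add: nh)
    ultimately have "cmod (sum h ?T) \<le> F + e / 2"
      using Fw norm_triangle_ineq4[of "f ?wz" "infsum h ?U"] by simp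
    also have "sum h ?T = (\<Sum>k\<le>N. c k * w ^ k)"
      unfolding sum_low_indices c_def sum_distrib_right h_def
      by (intro sum.cong refl) (simp add: monomial_scale mult_ac)
    finally show ?thesis .
  qed
  then have "cmod (c m) \<le> 2 * (F + e / 2 - cmod (c 0))"
    using m N(1) by (rule norm_coeff_le_Re_gap)
  moreover have "c 0 = a (\<lambda>_. 0)" by (simp add: c_def hom_indices_0 monomial_def)
  ultimately show "cmod (\<Sum>\<alpha>\<in>hom_indices n m. a \<alpha> * monomial n \<alpha> z) \<le> 2 * (F - cmod (a (\<lambda>_. 0))) + e"
    by (simp add: c_def)
qed

text \<open>The positive degrees contribute at most \<open>\<Sum> \<kappa>\<^sub>m 2 (F - \<bar>a\<^sub>0\<bar>) \<le> F - \<bar>a\<^sub>0\<bar>\<close>, which leaves exactly room for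
the constant term.\<close>
lemma bohr_ineq_if_homogeneous:
  fixes \<kappa> :: "nat \<Rightarrow> real"
  assumes p: "1 \<le> p" "n > 0" and r: "r \<ge> 0"
    and \<kappa>: "\<And>N. (\<Sum>m=1..N. \<kappa> m) \<le> 1 / 2"
    and hom: "\<And>m b G u. m \<ge> 1 \<Longrightarrow>
       (\<And>z. z \<in> lball p n \<Longrightarrow> cmod (\<Sum>\<alpha>\<in>hom_indices n m. b \<alpha> * monomial n \<alpha> z) \<le> G) \<Longrightarrow>
       u \<in> lball q n \<Longrightarrow>
       (\<Sum>\<alpha>\<in>hom_indices n m. cmod (b \<alpha>) * rmonomial n \<alpha> (\<lambda>i. r * cmod (u i))) \<le> \<kappa> m * G"
  shows "bohr_ineq p q n r"
  unfolding bohr_ineq_def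
proof (intro allI impI)
  fix a f assume f: "entire_series n a f"
  let ?R = "SUP z\<in>lball p n. ennreal (cmod (f z))"
  show "(SUP z\<in>scaled r (lball q n). \<Sum>\<^sub>\<infinity>\<alpha>\<in>multiindices n. ennreal (cmod (a \<alpha> * monomial n \<alpha> z))) \<le> ?R"
  proof (cases "?R = top")
    case False
    then obtain F where F: "?R = ennreal F" "F \<ge> 0"
      by (metis ennreal_cases)
    have fF: "cmod (f z) \<le> F" if "z \<in> lball p n" for z
    proof -
      have "ennreal (cmod (f z)) \<le> ?R" using that by (rule SUP_upper)
      then show ?thesis using F by simp
    qed
    let ?a0 = "cmod (a (\<lambda>_. 0))"
    note part = homogeneous_part_le[OF f p fF]
    have a0: "?a0 \<le> F"
      using order_trans[OF norm_ge_zero part[of 1, OF _ _ zero_in_lball[OF p]]] by simp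
    show ?thesis
    proof (rule SUP_least)
      fix z assume "z \<in> scaled r (lball q n)"
      then obtain u where u: "u \<in> lball q n" "z = (\<lambda>i. of_real r * u i)"
        by (auto simp: scaled_def)
      define g where "g \<alpha> = cmod (a \<alpha> * monomial n \<alpha> z)" for \<alpha>
      have g: "g \<alpha> = cmod (a \<alpha>) * rmonomial n \<alpha> (\<lambda>i. r * cmod (u i))" for \<alpha>
        using r by (simp add: g_def u norm_mult norm_monomial)
      have "(\<Sum>\<^sub>\<infinity>\<alpha>\<in>multiindices n. ennreal (g \<alpha>)) \<le> ennreal F"
      proof (rule infsum_le_finite_sums)
        show "(\<lambda>\<alpha>. ennreal (g \<alpha>)) summable_on multiindices n"
          by (rule nonneg_summable_on_complete) simp
        fix X assume X: "finite X" "X \<subseteq> multiindices n"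
        obtain N where N: "0 \<le> N" "X \<subseteq> low_indices n N" using finite_subset_low_indices[OF X] .
        have "sum g X \<le> sum g (low_indices n N)" by (intro sum_mono2 N) (auto simp: g_def)
        also have "\<dots> = (\<Sum>k\<le>N. \<Sum>\<alpha>\<in>hom_indices n k. g \<alpha>)" by (rule sum_low_indices)
        also have "\<dots> = g (\<lambda>_. 0) + (\<Sum>k=1..N. \<Sum>\<alpha>\<in>hom_indices n k. g \<alpha>)"
          by (simp add: sum.atMost_shift hom_indices_0 sum.atLeast1_atMost_eq lessThan_atLeast0)
        finally have 1: "sum g X \<le> g (\<lambda>_. 0) + (\<Sum>k=1..N. \<Sum>\<alpha>\<in>hom_indices n k. g \<alpha>)" .
        have "(\<Sum>k=1..N. \<Sum>\<alpha>\<in>hom_indices n k. g \<alpha>) \<le> (\<Sum>k=1..N. \<kappa> k * (2 * (F - ?a0)))"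
          unfolding g by (intro sum_mono hom part u) auto
        also have "\<dots> = (\<Sum>k=1..N. \<kappa> k) * (2 * (F - ?a0))" by (simp add: sum_distrib_right)
        also have "\<dots> \<le> 1 / 2 * (2 * (F - ?a0))"
          using \<kappa> a0 by (intro mult_right_mono) auto
        also have "\<dots> = F - g (\<lambda>_. 0)" by (simp add: g rmonomial_def)
        finally have "sum g X \<le> F" using 1 by simp
        then show "(\<Sum>\<alpha>\<in>X. ennreal (g \<alpha>)) \<le> ennreal F"
          by (simp add: g_def sum_ennreal ennreal_leI)
      qed
      then show "(\<Sum>\<^sub>\<infinity>\<alpha>\<in>multiindices n. ennreal (cmod (a \<alpha> * monomial n \<alpha> z))) \<le> ?R"
        by (simp add: F g_def)
    qed
  qed (simp only: top_greatest)
qed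

lemma bohr_ineq_finite_sum:
  assumes "bohr_ineq p q n r" "entire_series n a f" "\<And>z. z \<in> lball p n \<Longrightarrow> cmod (f z) \<le> F"
    and "u \<in> lball q n" "finite X" "X \<subseteq> multiindices n"
  shows "(\<Sum>\<alpha>\<in>X. cmod (a \<alpha> * monomial n \<alpha> (\<lambda>i. of_real r * u i))) \<le> max F 0"
proof -
  let ?g = "\<lambda>\<alpha>. cmod (a \<alpha> * monomial n \<alpha> (\<lambda>i. of_real r * u i))"
  have "ennreal (\<Sum>\<alpha>\<in>X. ?g \<alpha>) = (\<Sum>\<alpha>\<in>X. ennreal (?g \<alpha>))" by (rule sum_ennreal[symmetric]) simp
  also have "\<dots> = (\<Sum>\<^sub>\<infinity>\<alpha>\<in>X. ennreal (?g \<alpha>))" using assms by simp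
  also have "\<dots> \<le> (\<Sum>\<^sub>\<infinity>\<alpha>\<in>multiindices n. ennreal (?g \<alpha>))"
    using assms by (intro infsum_mono_neutral nonneg_summable_on_complete) auto
  also have "\<dots> \<le> (SUP z\<in>scaled r (lball q n). \<Sum>\<^sub>\<infinity>\<alpha>\<in>multiindices n. ennreal (cmod (a \<alpha> * monomial n \<alpha> z)))"
    using assms by (intro SUP_upper) (auto simp: scaled_def)
  also have "\<dots> \<le> (SUP z\<in>lball p n. ennreal (cmod (f z)))"
    using assms by (auto simp: bohr_ineq_def)
  also have "\<dots> \<le> ennreal (max F 0)"
    using assms(3) by (intro SUP_least ennreal_leI) (auto simp: le_max_iff_disj)
  finally show ?thesis by simp
qed

text \<open>A homogeneous polynomial is itself an entire function, hence a test for the Bohr inequality.\<close>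
lemma bohr_ineq_homogeneous:
  assumes "bohr_ineq p q n r" "r \<ge> 0" "1 \<le> p" "n > 0"
    and G: "\<And>z. z \<in> lball p n \<Longrightarrow> cmod (\<Sum>\<alpha>\<in>hom_indices n m. b \<alpha> * monomial n \<alpha> z) \<le> G"
    and "u \<in> lball q n"
  shows "r ^ m * (\<Sum>\<alpha>\<in>hom_indices n m. cmod (b \<alpha>) * rmonomial n \<alpha> (\<lambda>i. cmod (u i))) \<le> G"
proof -
  define a where "a \<alpha> = (if \<alpha> \<in> hom_indices n m then b \<alpha> else 0)" for \<alpha>
  let ?P = "\<lambda>z. \<Sum>\<alpha>\<in>hom_indices n m. b \<alpha> * monomial n \<alpha> z"
  have "entire_series n a ?P"
    unfolding entire_series_def
  proof
    fix z
    show "((\<lambda>\<alpha>. a \<alpha> * monomial n \<alpha> z) has_sum ?P z) (multiindices n)"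
      by (rule has_sum_finite_neutralI[OF finite_hom_indices hom_indices_subset_multiindices])
        (auto simp: a_def)
  qed
  then have "(\<Sum>\<alpha>\<in>hom_indices n m. cmod (a \<alpha> * monomial n \<alpha> (\<lambda>i. of_real r * u i))) \<le> max G 0"
    using G assms(6) by (rule bohr_ineq_finite_sum[OF assms(1) _ _ _ finite_hom_indices hom_indices_subset_multiindices])
  moreover have "G \<ge> 0"
    using order_trans[OF norm_ge_zero G[OF zero_in_lball]] assms by simp
  moreover have "cmod (a \<alpha> * monomial n \<alpha> (\<lambda>i. of_real r * u i))
      = r ^ m * (cmod (b \<alpha>) * rmonomial n \<alpha> (\<lambda>i. cmod (u i)))" if "\<alpha> \<in> hom_indices n m" for \<alpha>
    using that \<open>r \<ge> 0\<close> by (simp add: a_def norm_mult norm_monomial rmonomial_scale norm_power)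
  ultimately show ?thesis by (simp add: sum_distrib_left)
qed

text \<open>The test polynomial is the first coordinate, with multi-index \<open>e\<close>.\<close>
lemma bohr_ineq_le_1:
  assumes r: "bohr_ineq p q n r" "r \<ge> 0" and p: "1 \<le> p" "1 \<le> q" "n > 0"
  shows "r \<le> 1"
proof -
  define e :: "nat \<Rightarrow> nat" where "e i = (if i = 0 then 1 else 0)" for i
  define b :: "(nat \<Rightarrow> nat) \<Rightarrow> complex" where "b \<alpha> = (if \<alpha> = e then 1 else 0)" for \<alpha>
  define u :: "nat \<Rightarrow> complex" where "u i = (if i = 0 then 1 else 0)" for i
  have e: "e \<in> hom_indices n 1" using p by (auto simp: e_def hom_indices_def multiindices_def)
  have z0: "(\<Prod>i<n. x i ^ e i) = x 0" for x :: "nat \<Rightarrow> 'c::comm_semiring_1"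
    using p by (subst prod.remove[of _ 0]) (auto simp: e_def intro!: prod.neutral)
  have u: "u \<in> lball q n"
    using p(2)
  proof (cases q rule: ge1_ereal_cases)
    case (real Q)
    have "(\<Sum>i<n. cmod (u i) powr Q) = 1"
      using p by (subst sum.remove[of _ 0]) (auto simp: u_def)
    then show ?thesis using real p by (auto simp: lball_real_iff u_def cspace_def)
  qed (use p in \<open>auto simp: lball_infty_iff u_def cspace_def\<close>)
  have sum_b: "(\<Sum>\<alpha>\<in>hom_indices n 1. g (b \<alpha>) * h \<alpha>) = h e" if "g 0 = 0" "g 1 = 1"
    for g :: "complex \<Rightarrow> 'c::comm_semiring_1" and h
    using e that by (subst sum.remove[of _ e]) (auto simp: b_def intro!: sum.neutral)
  have "r ^ 1 * (\<Sum>\<alpha>\<in>hom_indices n 1. cmod (b \<alpha>) * rmonomial n \<alpha> (\<lambda>i. cmod (u i))) \<le> 1"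
  proof (rule bohr_ineq_homogeneous[OF r p(1,3) _ u])
    fix z assume "z \<in> lball p n"
    then have "cmod (z 0) \<le> 1" using p by (intro norm_le_1_of_lball)
    then show "cmod (\<Sum>\<alpha>\<in>hom_indices n 1. b \<alpha> * monomial n \<alpha> z) \<le> 1"
      using sum_b[of "\<lambda>x. x"] by (simp add: monomial_def z0)
  qed
  moreover have "(\<Sum>\<alpha>\<in>hom_indices n 1. cmod (b \<alpha>) * rmonomial n \<alpha> (\<lambda>i. cmod (u i))) = 1"
    using sum_b[of cmod] by (simp add: rmonomial_def z0) (simp add: u_def)
  ultimately show ?thesis by simp
qed

lemma bohr_ineq_0: "1 \<le> p \<Longrightarrow> n > 0 \<Longrightarrow> bohr_ineq p q n 0"
proof (rule bohr_ineq_if_homogeneous[where \<kappa> = "\<lambda>_. 0"])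
  fix m b G u assume "1 \<le> (m::nat)"
  then have "rmonomial n \<alpha> (\<lambda>i. 0 * cmod (u i)) = 0" if "\<alpha> \<in> hom_indices n m" for \<alpha>
    using rmonomial_scale[OF that, of 0 "\<lambda>i. cmod (u i)"] by (simp add: power_0_left)
  then show "(\<Sum>\<alpha>\<in>hom_indices n m. cmod (b \<alpha>) * rmonomial n \<alpha> (\<lambda>i. 0 * cmod (u i))) \<le> 0 * G"
    by simp
qed auto

text \<open>The maximum is attained: admissible radii are bounded by \<open>1\<close>, and for every finite partial sum the
inequality is closed in \<open>r\<close>.\<close>
lemma bohr_radius_greatest:
  assumes p: "1 \<le> p" "1 \<le> q" "n > 0"
  shows "bohr_radius p q n \<ge> 0" "bohr_ineq p q n (bohr_radius p q n)"
    "\<And>r. r \<ge> 0 \<Longrightarrow> bohr_ineq p q n r \<Longrightarrow> r \<le> bohr_radius p q n"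
proof -
  define R where "R = {r. 0 \<le> r \<and> bohr_ineq p q n r}"
  have R0: "0 \<in> R" using bohr_ineq_0 p by (simp add: R_def)
  have bdd: "bdd_above R" using bohr_ineq_le_1 p by (auto simp: R_def intro!: bdd_aboveI[of _ 1])
  define s where "s = Sup R"
  have s0: "0 \<le> s" using R0 bdd by (simp add: s_def cSup_upper)
  have "s \<in> closure R" using R0 bdd closure_contains_Sup by (auto simp: s_def)
  have "bohr_ineq p q n s"
    unfolding bohr_ineq_def
  proof (intro allI impI)
    fix a f assume f: "entire_series n a f"
    let ?R = "SUP z\<in>lball p n. ennreal (cmod (f z))"
    show "(SUP z\<in>scaled s (lball q n). \<Sum>\<^sub>\<infinity>\<alpha>\<in>multiindices n. ennreal (cmod (a \<alpha> * monomial n \<alpha> z))) \<le> ?R"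
    proof (cases "?R = top")
      case False
      then obtain F where F: "?R = ennreal F" "F \<ge> 0" by (metis ennreal_cases)
      have fF: "cmod (f z) \<le> F" if "z \<in> lball p n" for z
      proof -
        have "ennreal (cmod (f z)) \<le> ?R" using that by (rule SUP_upper)
        then show ?thesis using F by simp
      qed
      show ?thesis
      proof (rule SUP_least)
        fix z assume "z \<in> scaled s (lball q n)"
        then obtain u where u: "u \<in> lball q n" "z = (\<lambda>i. of_real s * u i)"
          by (auto simp: scaled_def)
        have "(\<Sum>\<^sub>\<infinity>\<alpha>\<in>multiindices n. ennreal (cmod (a \<alpha> * monomial n \<alpha> z))) \<le> ennreal F"
        proof (rule infsum_le_finite_sums)
          show "(\<lambda>\<alpha>. ennreal (cmod (a \<alpha> * monomial n \<alpha> z))) summable_on multiindices n"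
            by (rule nonneg_summable_on_complete) simp
          fix X assume X: "finite X" "X \<subseteq> multiindices n"
          let ?C = "{r. (\<Sum>\<alpha>\<in>X. cmod (a \<alpha> * monomial n \<alpha> (\<lambda>i. of_real r * u i))) \<le> F}"
          have "closed ?C"
            unfolding monomial_def by (intro closed_Collect_le continuous_intros)
          moreover have "R \<subseteq> ?C"
            using bohr_ineq_finite_sum[OF _ f fF u(1) X] F by (auto simp: R_def max_def)
          ultimately have "s \<in> ?C" using \<open>s \<in> closure R\<close> closure_minimal by blast
          then show "(\<Sum>\<alpha>\<in>X. ennreal (cmod (a \<alpha> * monomial n \<alpha> z))) \<le> ennreal F"
            by (simp add: u sum_ennreal ennreal_leI)
        qed
        then show "(\<Sum>\<^sub>\<infinity>\<alpha>\<in>multiindices n. ennreal (cmod (a \<alpha> * monomial n \<alpha> z))) \<le> ?R"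
          by (simp add: F)
      qed
    qed (simp only: top_greatest)
  qed
  then have s: "s \<in> R" using s0 by (simp add: R_def)
  have "bohr_radius p q n = s"
    unfolding bohr_radius_def
    by (rule Greatest_equality) (use s bdd in \<open>auto simp: R_def s_def intro!: cSup_upper\<close>)
  then show "bohr_radius p q n \<ge> 0" "bohr_ineq p q n (bohr_radius p q n)"
    "\<And>r. r \<ge> 0 \<Longrightarrow> bohr_ineq p q n r \<Longrightarrow> r \<le> bohr_radius p q n"
    using s bdd by (auto simp: R_def s_def intro!: cSup_upper)
qed

section \<open>Absolute sums over the monomials of a bounded polynomial\<close>
lemma euler_identity_coefficients:
  fixes g :: "(nat \<Rightarrow> nat) \<Rightarrow> real"
  shows "real (Suc M) * (\<Sum>\<alpha>\<in>hom_indices n (Suc M). g \<alpha> * rmonomial n \<alpha> x)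
    = (\<Sum>\<beta>\<in>hom_indices n M. rmonomial n \<beta> x * (\<Sum>k<n. real (Suc (\<beta> k)) * g (\<beta>(k := Suc (\<beta> k))) * x k))"
proof -
  have "real (Suc M) * (\<Sum>\<alpha>\<in>hom_indices n (Suc M). g \<alpha> * rmonomial n \<alpha> x)
      = (\<Sum>\<alpha>\<in>hom_indices n (Suc M). \<Sum>k<n. of_nat (\<alpha> k) * (g \<alpha> * rmonomial n \<alpha> x))"
    unfolding sum_distrib_left
    by (intro sum.cong refl) (auto simp: hom_indices_def simp flip: of_nat_sum sum_distrib_right)
  also have "\<dots> = (\<Sum>\<beta>\<in>hom_indices n M. \<Sum>k<n. of_nat (Suc (\<beta> k)) *
                    (g (\<beta>(k := Suc (\<beta> k))) * rmonomial n (\<beta>(k := Suc (\<beta> k))) x))"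
    by (rule sum_hom_indices_Suc)
  also have "\<dots> = (\<Sum>\<beta>\<in>hom_indices n M. rmonomial n \<beta> x * (\<Sum>k<n. real (Suc (\<beta> k)) * g (\<beta>(k := Suc (\<beta> k))) * x k))"
    unfolding sum_distrib_left by (intro sum.cong refl) (simp add: rmonomial_upd mult_ac del: of_nat_Suc)
  finally show ?thesis .
qed

lemma cnj_sgn_mult: "cnj (sgn z) * z = of_real (cmod z)"
  by (cases "z = 0") (auto simp: sgn_eq complex_norm_square[symmetric] mult.commute power2_eq_square)

lemma norm_cnj_sgn_le: "cmod (cnj (sgn z)) \<le> 1"
  by (simp add: norm_sgn)

text \<open>By Euler's formula the left-hand side is \<open>1 / (M + 1)\<close> times the sum over \<open>k\<close> of \<open>x\<^sub>k\<close> times the same sum for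
\<open>\<partial>\<^sub>k b\<close>. Cauchy-Schwarz turns the latter into the \<open>L\<^sup>2\<close> norm of the \<open>k\<close>-th partial derivative. Passing to
\<open>L\<^sup>1\<close> norms is what makes the sum over \<open>k\<close> harmless: at each point of the torus, the moduli of all partial derivatives add
up to one directional derivative in a suitable unimodular direction.\<close>
lemma sum_norm_coeff_polydisc:
  assumes G: "\<And>v. v \<in> cspace n \<Longrightarrow> (\<And>i. cmod (v i) \<le> 1) \<Longrightarrow>
     cmod (\<Sum>\<alpha>\<in>hom_indices n (Suc M). b \<alpha> * monomial n \<alpha> v) \<le> G"
    and x: "\<And>i. i < n \<Longrightarrow> 0 \<le> x i" "\<And>i. i < n \<Longrightarrow> x i \<le> X" and X: "0 \<le> X"
  shows "(\<Sum>\<alpha>\<in>hom_indices n (Suc M). cmod (b \<alpha>) * rmonomial n \<alpha> x)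
    \<le> 2 * sqrt 2 * exp 1 * 2 ^ M * G * X * sqrt (\<Sum>\<beta>\<in>hom_indices n M. rmonomial n \<beta> (\<lambda>i. (x i)\<^sup>2))"
proof -
  let ?H = "hom_indices n M"
  define h where "h = sqrt (\<Sum>\<beta>\<in>?H. rmonomial n \<beta> (\<lambda>i. (x i)\<^sup>2))"
  have h0: "h \<ge> 0" by (auto simp: h_def intro!: sum_nonneg rmonomial_nonneg)
  define d where "d k \<beta> = of_nat (Suc (\<beta> k)) * b (\<beta>(k := Suc (\<beta> k)))" for k \<beta>
  define N where "N = Suc (2 * M)"
  let ?T = "torus_grid n N"
  have N: "N > 0" "N > 2 * M" by (auto simp: N_def)
  define V where "V k = sqrt (\<Sum>\<beta>\<in>?H. (cmod (d k \<beta>))\<^sup>2)" for k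
  have V0: "V k \<ge> 0" for k by (simp add: V_def sum_nonneg)
  have rm2: "rmonomial n \<beta> (\<lambda>i. (x i)\<^sup>2) = (rmonomial n \<beta> x)\<^sup>2" for \<beta>
    by (simp add: rmonomial_def prod_power_distrib mult.commute flip: power_mult)
  have CS: "(\<Sum>\<beta>\<in>?H. rmonomial n \<beta> x * cmod (d k \<beta>)) \<le> h * V k" for k
  proof -
    have "(\<Sum>\<beta>\<in>?H. rmonomial n \<beta> x * cmod (d k \<beta>))\<^sup>2
        \<le> (\<Sum>\<beta>\<in>?H. (rmonomial n \<beta> x)\<^sup>2) * (\<Sum>\<beta>\<in>?H. (cmod (d k \<beta>))\<^sup>2)"
      by (rule Cauchy_Schwarz_ineq_sum)
    also have "\<dots> = (h * V k)\<^sup>2"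
      by (simp add: h_def V_def rm2 power_mult_distrib sum_nonneg)
    finally show ?thesis by (rule power2_le_imp_le) (use h0 V0 in simp)
  qed
  have grad: "(\<Sum>k<n. cmod (\<Sum>\<beta>\<in>?H. d k \<beta> * monomial n \<beta> u)) \<le> real (Suc M) * (exp 1 * G)"
    if u: "u \<in> ?T" for u
  proof -
    define Q where "Q k = (\<Sum>\<beta>\<in>?H. d k \<beta> * monomial n \<beta> u)" for k
    \<comment> \<open>the direction in which the contributions of all partial derivatives at \<open>u\<close> are positive\<close>
    define w where "w k = (if k < n then cnj (sgn (Q k)) else 0)" for k
    have "cmod (\<Sum>\<beta>\<in>?H. dir_deriv n M b w \<beta> * monomial n \<beta> u) \<le> real (Suc M) * (exp 1 * G)"
    proof (rule norm_dir_deriv_le_sup[where K = "{v \<in> cspace n. \<forall>i. cmod (v i) \<le> 1}"])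
      fix v assume "v \<in> {v \<in> cspace n. \<forall>i. cmod (v i) \<le> 1}"
      then show "cmod (\<Sum>\<alpha>\<in>hom_indices n (Suc M). b \<alpha> * monomial n \<alpha> v) \<le> G"
        by (intro G) auto
    next
      fix l assume l: "cmod l = 1 / real (Suc M)"
      have "cmod (u i + l * w i) \<le> 1 + 1 / real (Suc M)" for i
      proof -
        have "cmod (u i + l * w i) \<le> cmod (u i) + cmod l * cmod (w i)"
          using norm_triangle_ineq[of "u i" "l * w i"] by (simp add: norm_mult)
        also have "\<dots> \<le> 1 + cmod l * 1"
          using norm_torus_grid[OF N(1) u] norm_cnj_sgn_le[of "Q i"]
          by (intro add_mono mult_left_mono) (auto simp: w_def)
        finally show ?thesis using l by simp
      qed
      then have "cmod ((u i + l * w i) / of_real (1 + 1 / real (Suc M))) \<le> 1" for i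
        unfolding norm_divide norm_of_real by (subst divide_le_eq_1) (auto simp: add_pos_pos abs_of_pos)
      then show "(\<lambda>i. (u i + l * w i) / of_real (1 + 1 / real (Suc M))) \<in> {v \<in> cspace n. \<forall>i. cmod (v i) \<le> 1}"
        using torus_grid_in_cspace[OF u] by (auto simp: cspace_def w_def)
    qed
    also have "(\<Sum>\<beta>\<in>?H. dir_deriv n M b w \<beta> * monomial n \<beta> u) = (\<Sum>k<n. w k * Q k)"
      unfolding dir_deriv_def Q_def d_def sum_distrib_right sum_distrib_left
      by (subst sum.swap) (simp add: mult_ac)
    also have "\<dots> = of_real (\<Sum>k<n. cmod (Q k))"
      by (simp add: w_def cnj_sgn_mult)
    also have "cmod \<dots> = (\<Sum>k<n. cmod (Q k))"
      unfolding norm_of_real by (simp add: sum_nonneg)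
    finally show ?thesis by (simp only: Q_def)
  qed
  have "real (N ^ n) * (\<Sum>k<n. V k)
      \<le> (\<Sum>k<n. 2 * sqrt 2 * 2 ^ M * (\<Sum>u\<in>?T. cmod (\<Sum>\<beta>\<in>?H. d k \<beta> * monomial n \<beta> u)))"
    unfolding sum_distrib_left V_def by (intro sum_mono order_trans[OF L2_le_L1[OF N(2)]]) (simp add: sum_distrib_left)
  also have "\<dots> = 2 * sqrt 2 * 2 ^ M * (\<Sum>u\<in>?T. \<Sum>k<n. cmod (\<Sum>\<beta>\<in>?H. d k \<beta> * monomial n \<beta> u))"
    by (simp only: sum_distrib_left[symmetric]) (subst sum.swap, rule refl)
  also have "\<dots> \<le> 2 * sqrt 2 * 2 ^ M * (\<Sum>u\<in>?T. real (Suc M) * (exp 1 * G))"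
    by (intro mult_left_mono sum_mono grad) auto
  also have "\<dots> = real (N ^ n) * (2 * sqrt 2 * 2 ^ M * (real (Suc M) * (exp 1 * G)))"
    by (simp add: card_torus_grid N)
  finally have V: "(\<Sum>k<n. V k) \<le> 2 * sqrt 2 * 2 ^ M * (real (Suc M) * (exp 1 * G))"
    using N(1) by (simp only: mult_le_cancel_left_pos[of "real (N ^ n)"] of_nat_0_less_iff zero_less_power)
  have "real (Suc M) * (\<Sum>\<alpha>\<in>hom_indices n (Suc M). cmod (b \<alpha>) * rmonomial n \<alpha> x)
      = (\<Sum>\<beta>\<in>?H. rmonomial n \<beta> x * (\<Sum>k<n. cmod (d k \<beta>) * x k))"
    unfolding euler_identity_coefficients by (simp only: d_def norm_mult norm_of_nat)
  also have "\<dots> = (\<Sum>k<n. x k * (\<Sum>\<beta>\<in>?H. rmonomial n \<beta> x * cmod (d k \<beta>)))"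
    unfolding sum_distrib_left by (subst sum.swap) (simp add: mult_ac)
  also have "\<dots> \<le> (\<Sum>k<n. X * (h * V k))"
    using x X by (intro sum_mono mult_mono CS) (auto intro!: sum_nonneg rmonomial_nonneg mult_nonneg_nonneg)
  also have "\<dots> = X * h * (\<Sum>k<n. V k)" by (simp add: sum_distrib_left mult_ac)
  also have "\<dots> \<le> X * h * (2 * sqrt 2 * 2 ^ M * (real (Suc M) * (exp 1 * G)))"
    using V X h0 by (intro mult_left_mono) auto
  also have "\<dots> = real (Suc M) * (2 * sqrt 2 * exp 1 * 2 ^ M * G * X * h)" by (simp only: mult_ac)
  finally show ?thesis unfolding h_def by (simp only: mult_le_cancel_left_pos of_nat_0_less_iff zero_less_Suc)
qed

lemma power_self_le_exp_fact: "real M ^ M \<le> exp (real M) * fact M"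
proof -
  have "(\<Sum>k\<in>{M}. inverse (fact k) * real M ^ k) \<le> (\<Sum>k. inverse (fact k) * real M ^ k)"
    using summable_exp[of "real M"] by (intro sum_le_suminf) auto
  then have "inverse (fact M) * real M ^ M \<le> exp (real M)" by (simp add: exp_def)
  then show ?thesis by (simp add: field_simps)
qed

lemma powr_power_swap: "x \<ge> 0 \<Longrightarrow> (x powr a) ^ k = (x ^ k) powr (a::real)"
  by (cases "x = 0") (auto simp: powr_power powr_powr mult.commute power_0_left simp flip: powr_realpow)

lemma prod_powr: "(\<And>i. i \<in> A \<Longrightarrow> 0 \<le> f i) \<Longrightarrow> (\<Prod>i\<in>A. f i powr a) = (\<Prod>i\<in>A. f i) powr (a::real)"
  by (induction A rule: infinite_finite_induct) (auto simp: powr_mult prod_nonneg)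

text \<open>Cauchy's inequality on the torus through the point with \<open>y\<^sub>i\<^sup>P = \<beta>\<^sub>i / M\<close>, at which the monomial is
largest on the ball. It gives \<open>(M\<^sup>M / \<beta>\<^sup>\<beta>)\<^sup>1\<^sup>/\<^sup>P\<close>, and \<open>M\<^sup>M \<le> e\<^sup>M M!\<close>.\<close>
lemma norm_coeff_le_lball:
  assumes P: "1 \<le> P" "n > 0"
    and G: "\<And>z. z \<in> lball (ereal P) n \<Longrightarrow> cmod (\<Sum>\<alpha>\<in>hom_indices n M. b \<alpha> * monomial n \<alpha> z) \<le> G"
    and \<beta>: "\<beta> \<in> hom_indices n M"
  shows "cmod (b \<beta>) \<le> G * exp (real M) * (fact M / index_fact n \<beta>) powr (1 / P)"
proof -
  have G0: "0 \<le> G" using order_trans[OF norm_ge_zero G[OF zero_in_lball]] P by simp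
  define t where "t i = real (\<beta> i) / real M" for i
  define y where "y i = (if i < n then t i powr (1 / P) else 0)" for i
  have t0: "t i \<ge> 0" for i by (simp add: t_def)
  have \<beta>M: "(\<Sum>i<n. \<beta> i) = M" using \<beta> by (simp add: hom_indices_def)
  have "(\<Sum>i<n. cmod (complex_of_real (y i)) powr P) = (\<Sum>i<n. t i)"
    using P t0 by (intro sum.cong) (auto simp: y_def powr_powr)
  also have "\<dots> \<le> 1"
    unfolding t_def by (simp only: sum_divide_distrib[symmetric] of_nat_sum[symmetric] \<beta>M) simp
  finally have yb: "(\<lambda>i. complex_of_real (y i)) \<in> lball (ereal P) n"
    using P by (auto simp: lball_real_iff cspace_def y_def)
  have "cmod (b \<beta> * monomial n \<beta> (\<lambda>i. of_real (y i))) \<le> G"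
  proof (rule norm_coeff_le[OF _ \<beta>])
    fix u assume u: "u \<in> cspace n" "\<And>i. cmod (u i) \<le> 1"
    have "(\<lambda>i. of_real (y i) * u i) \<in> lball (ereal P) n"
      using u P by (intro lball_solid[OF _ _ yb]) (auto simp: cspace_def norm_mult mult_left_le)
    from G[OF this] show "cmod (\<Sum>\<alpha>\<in>hom_indices n M. b \<alpha> * monomial n \<alpha> (\<lambda>i. of_real (y i)) * monomial n \<alpha> u) \<le> G"
      by (simp add: monomial_mult mult_ac)
  qed
  then have le: "cmod (b \<beta>) * rmonomial n \<beta> y \<le> G"
    by (simp add: norm_mult norm_monomial) (simp add: rmonomial_def y_def)
  define K where "K = fact M / index_fact n \<beta>"
  have K: "K > 0" using index_fact_pos by (simp add: K_def)
  have MM: "real M ^ M > 0" by (cases M) auto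
  have prod_ge: "(\<Prod>i<n. t i ^ \<beta> i) \<ge> 1 / (exp (real M) * K)"
  proof -
    have "index_fact n \<beta> \<le> (\<Prod>i<n. real (\<beta> i) ^ \<beta> i)"
      unfolding index_fact_def using fact_le_power[where 'a = real] by (intro prod_mono) auto
    then have "index_fact n \<beta> * real M ^ M \<le> (\<Prod>i<n. real (\<beta> i) ^ \<beta> i) * (exp (real M) * fact M)"
      using index_fact_pos[of n \<beta>] by (intro mult_mono power_self_le_exp_fact prod_nonneg) auto
    also have "(\<Prod>i<n. real (\<beta> i) ^ \<beta> i) = (\<Prod>i<n. t i ^ \<beta> i) * real M ^ M"
      unfolding t_def power_divide prod_dividef using MM by (simp add: \<beta>M flip: power_sum)
    also have "\<dots> * (exp (real M) * fact M) = ((\<Prod>i<n. t i ^ \<beta> i) * (exp (real M) * fact M)) * real M ^ M"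
      by (simp only: mult_ac)
    finally have "index_fact n \<beta> \<le> (\<Prod>i<n. t i ^ \<beta> i) * (exp (real M) * fact M)"
      using MM by (rule mult_right_le_imp_le)
    then show ?thesis using index_fact_pos[of n \<beta>] unfolding K_def by (simp add: field_simps)
  qed
  have "rmonomial n \<beta> y = (\<Prod>i<n. t i ^ \<beta> i) powr (1 / P)"
    using t0 by (simp add: rmonomial_def y_def powr_power_swap prod_powr)
  also have "\<dots> \<ge> (1 / (exp (real M) * K)) powr (1 / P)"
    using prod_ge P K by (intro powr_mono2) auto
  finally have ge: "(1 / (exp (real M) * K)) powr (1 / P) \<le> rmonomial n \<beta> y" .
  have "cmod (b \<beta>) * (1 / (exp (real M) * K)) powr (1 / P) \<le> G"
    using le mult_left_mono[OF ge norm_ge_zero[of "b \<beta>"]] by linarith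
  then have "cmod (b \<beta>) \<le> G * (exp (real M) * K) powr (1 / P)"
    using K by (simp add: powr_divide field_simps)
  also have "\<dots> = G * (exp (real M) powr (1 / P) * K powr (1 / P))"
    using K by (simp add: powr_mult)
  also have "exp (real M) powr (1 / P) \<le> exp (real M) powr 1"
    using P by (intro powr_mono) auto
  finally show ?thesis
    using G0 by (simp add: K_def mult_left_mono mult_right_mono mult_ac)
qed

text \<open>For each \<open>\<beta>\<close> of degree \<open>M\<close>, the sum of \<open>(\<beta>\<^sub>k + 1) \<bar>b\<^bsub>\<beta> + e\<^sub>k\<^esub>\<bar> x\<^sub>k\<close> over \<open>k\<close> is the \<open>\<beta>\<close>-coefficient of the
derivative of the polynomial in a direction \<open>w\<close> with \<open>\<bar>w\<^sub>k\<bar> = x\<^sub>k\<close>, with phases adapted to \<open>\<beta>\<close>. Cauchy's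
inequality for this single coefficient replaces a duality argument.\<close>
lemma sum_norm_coeff_lball:
  assumes P: "1 \<le> P" "n > 0"
    and G: "\<And>z. z \<in> lball (ereal P) n \<Longrightarrow> cmod (\<Sum>\<alpha>\<in>hom_indices n (Suc M). b \<alpha> * monomial n \<alpha> z) \<le> G"
    and X: "X > 0" and x: "\<And>i. i < n \<Longrightarrow> 0 \<le> x i" "(\<Sum>i<n. (x i / X) powr P) \<le> 1"
  shows "(\<Sum>\<alpha>\<in>hom_indices n (Suc M). cmod (b \<alpha>) * rmonomial n \<alpha> x)
    \<le> exp (real (Suc M)) * G * X * (\<Sum>\<beta>\<in>hom_indices n M. (fact M / index_fact n \<beta>) powr (1 / P) * rmonomial n \<beta> x)"
proof -
  let ?H = "hom_indices n M"
  have inner: "(\<Sum>k<n. real (Suc (\<beta> k)) * cmod (b (\<beta>(k := Suc (\<beta> k)))) * x k)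
      \<le> X * (real (Suc M) * (exp 1 * G) * exp (real M) * (fact M / index_fact n \<beta>) powr (1 / P))"
    if \<beta>: "\<beta> \<in> ?H" for \<beta>
  proof -
    define w where "w k = (if k < n then cnj (sgn (b (\<beta>(k := Suc (\<beta> k))))) * of_real (x k / X) else 0)" for k
    have nw: "cmod (w k) \<le> x k / X" if "k < n" for k
    proof -
      have "0 \<le> x k / X" using that x(1) X by simp
      then have "cmod (w k) = cmod (cnj (sgn (b (\<beta>(k := Suc (\<beta> k)))))) * (x k / X)"
        using that by (simp only: w_def norm_mult norm_of_real abs_of_nonneg if_True)
      also have "\<dots> \<le> 1 * (x k / X)"
        using \<open>0 \<le> x k / X\<close> by (rule mult_right_mono[OF norm_cnj_sgn_le])
      finally show ?thesis by simp
    qed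
    have wb: "w \<in> lball (ereal P) n"
    proof -
      have "(\<Sum>i<n. cmod (w i) powr P) \<le> (\<Sum>i<n. (x i / X) powr P)"
        using nw P by (intro sum_mono powr_mono2) auto
      then show ?thesis using x(2) P by (auto simp: lball_real_iff cspace_def w_def)
    qed
    have "cmod (dir_deriv n M b w \<beta>) \<le> real (Suc M) * (exp 1 * G) * exp (real M) * (fact M / index_fact n \<beta>) powr (1 / P)"
    proof (rule norm_coeff_le_lball[OF P _ \<beta>])
      fix z assume z: "z \<in> lball (ereal P) n"
      show "cmod (\<Sum>\<alpha>\<in>?H. dir_deriv n M b w \<alpha> * monomial n \<alpha> z) \<le> real (Suc M) * (exp 1 * G)"
      proof (rule norm_dir_deriv_le_sup[OF G])
        fix l assume l: "cmod l = 1 / real (Suc M)"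
        show "(\<lambda>i. (z i + l * w i) / of_real (1 + 1 / real (Suc M))) \<in> lball (ereal P) n"
          using lball_convex_combination[OF _ P(2) z wb, of l] P unfolding l by simp
      qed
    qed
    also have "dir_deriv n M b w \<beta> = (\<Sum>k<n. of_real (real (Suc (\<beta> k)) * cmod (b (\<beta>(k := Suc (\<beta> k)))) * x k / X))"
      unfolding dir_deriv_def
    proof (rule sum.cong[OF refl])
      fix k assume "k \<in> {..<n}"
      then show "w k * (of_nat (Suc (\<beta> k)) * b (\<beta>(k := Suc (\<beta> k))))
          = of_real (real (Suc (\<beta> k)) * cmod (b (\<beta>(k := Suc (\<beta> k)))) * x k / X)"
        using cnj_sgn_mult[of "b (\<beta>(k := Suc (\<beta> k)))"]
        by (simp add: w_def mult_ac del: of_nat_Suc)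
    qed
    also have "\<dots> = of_real ((\<Sum>k<n. real (Suc (\<beta> k)) * cmod (b (\<beta>(k := Suc (\<beta> k)))) * x k) / X)"
      by (simp only: of_real_sum sum_divide_distrib)
    also have "cmod \<dots> = (\<Sum>k<n. real (Suc (\<beta> k)) * cmod (b (\<beta>(k := Suc (\<beta> k)))) * x k) / X"
      unfolding norm_of_real using X x(1) by (intro abs_of_nonneg divide_nonneg_pos sum_nonneg mult_nonneg_nonneg) auto
    finally show ?thesis using X by (simp add: divide_le_eq mult.commute del: of_nat_Suc)
  qed
  have "real (Suc M) * (\<Sum>\<alpha>\<in>hom_indices n (Suc M). cmod (b \<alpha>) * rmonomial n \<alpha> x)
      = (\<Sum>\<beta>\<in>?H. rmonomial n \<beta> x * (\<Sum>k<n. real (Suc (\<beta> k)) * cmod (b (\<beta>(k := Suc (\<beta> k)))) * x k))"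
    by (rule euler_identity_coefficients)
  also have "\<dots> \<le> (\<Sum>\<beta>\<in>?H. rmonomial n \<beta> x *
      (X * (real (Suc M) * (exp 1 * G) * exp (real M) * (fact M / index_fact n \<beta>) powr (1 / P))))"
    using x by (intro sum_mono mult_left_mono inner rmonomial_nonneg) auto
  also have "\<dots> = real (Suc M) * (exp (real (Suc M)) * G * X *
      (\<Sum>\<beta>\<in>?H. (fact M / index_fact n \<beta>) powr (1 / P) * rmonomial n \<beta> x))"
    by (simp add: sum_distrib_left mult_ac exp_add)
  finally show ?thesis by (simp only: mult_le_cancel_left_pos of_nat_0_less_iff zero_less_Suc)
qed

lemma powr_mult_powr_le_add:
  fixes u v :: real
  assumes "0 \<le> u" "0 \<le> v" "0 \<le> \<theta>" "\<theta> \<le> 1"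
  shows "u powr \<theta> * v powr (1 - \<theta>) \<le> u + v"
proof (cases "u \<le> v")
  case True
  then have "u powr \<theta> * v powr (1 - \<theta>) \<le> v powr \<theta> * v powr (1 - \<theta>)"
    using assms by (intro mult_right_mono powr_mono2) auto
  also have "\<dots> \<le> v" using assms by (simp flip: powr_add)
  finally show ?thesis using assms by simp
next
  case False
  then have "u powr \<theta> * v powr (1 - \<theta>) \<le> u powr \<theta> * u powr (1 - \<theta>)"
    using assms by (intro mult_left_mono powr_mono2) auto
  also have "\<dots> \<le> u" using assms by (simp flip: powr_add)
  finally show ?thesis using assms by simp
qed

text \<open>Each summand is a geometric mean with weights \<open>\<theta>\<close> and \<open>1 - \<theta>\<close> of the multinomial term divided by \<open>S\<^sup>M\<close> and of \<open>t\<^sup>M x\<^sup>\<beta>\<close>.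
Both normalised families have a controlled sum, by the multinomial theorem and by
\<open>sum_rmonomial_le_exp\<close>.\<close>
lemma sum_multinomial_powr_le:
  assumes x: "\<And>i. i < n \<Longrightarrow> 0 \<le> x i" "(\<Sum>i<n. x i) \<le> S" "S > 0"
    and t: "t > 0" "\<And>i. i < n \<Longrightarrow> t * x i \<le> 1/2" and \<theta>: "0 \<le> \<theta>" "\<theta> \<le> 1"
  shows "(\<Sum>\<beta>\<in>hom_indices n M. (fact M / index_fact n \<beta>) powr \<theta> * rmonomial n \<beta> x)
     \<le> (S powr \<theta> * t powr (\<theta> - 1)) ^ M * (1 + exp (2 * t * S))"
proof -
  let ?H = "hom_indices n M"
  define W where "W = (S powr \<theta> * t powr (\<theta> - 1)) ^ M"
  have W0: "W \<ge> 0" by (simp add: W_def)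
  define A where "A \<beta> = fact M / index_fact n \<beta> * rmonomial n \<beta> x" for \<beta>
  have summand: "(fact M / index_fact n \<beta>) powr \<theta> * rmonomial n \<beta> x
      \<le> W * (A \<beta> / S ^ M + t ^ M * rmonomial n \<beta> x)" for \<beta>
  proof (cases "rmonomial n \<beta> x = 0")
    case False
    then have B: "rmonomial n \<beta> x > 0" using rmonomial_nonneg[of n x \<beta>] x(1) by (simp add: less_le)
    have K: "fact M / index_fact n \<beta> > 0" using index_fact_pos by simp
    have "(fact M / index_fact n \<beta>) powr \<theta> * rmonomial n \<beta> x
        = (fact M / index_fact n \<beta>) powr \<theta> * (rmonomial n \<beta> x powr \<theta> * rmonomial n \<beta> x powr (1 - \<theta>))"
      using B by (simp flip: powr_add)
    also have "\<dots> = W * ((A \<beta> / S ^ M) powr \<theta> * (t ^ M * rmonomial n \<beta> x) powr (1 - \<theta>))"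
    proof -
      have "W = (S ^ M) powr \<theta> * (t ^ M) powr (\<theta> - 1)"
        using x t by (simp add: W_def power_mult_distrib powr_power_swap)
      moreover have "(t ^ M) powr (\<theta> - 1) * (t ^ M) powr (1 - \<theta>) = 1"
        using t by (simp flip: powr_add)
      moreover have "(S ^ M) powr \<theta> > 0" using x by simp
      moreover have "(A \<beta> / S ^ M) powr \<theta> = (fact M / index_fact n \<beta>) powr \<theta> * rmonomial n \<beta> x powr \<theta> / (S ^ M) powr \<theta>"
      proof -
        have "A \<beta> powr \<theta> = (fact M / index_fact n \<beta>) powr \<theta> * rmonomial n \<beta> x powr \<theta>"
          unfolding A_def by (rule powr_mult)
        moreover have "0 \<le> A \<beta>" unfolding A_def using K B by (intro mult_nonneg_nonneg) auto
        ultimately show ?thesis using x by (simp add: powr_divide)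
      qed
      moreover have "(t ^ M * rmonomial n \<beta> x) powr (1 - \<theta>) = (t ^ M) powr (1 - \<theta>) * rmonomial n \<beta> x powr (1 - \<theta>)"
        using t B by (simp add: powr_mult)
      ultimately show ?thesis by (simp add: mult_ac)
    qed
    also have "\<dots> \<le> W * (A \<beta> / S ^ M + t ^ M * rmonomial n \<beta> x)"
      using x t \<theta> B index_fact_pos[of n \<beta>]
      by (intro mult_left_mono powr_mult_powr_le_add W0) (auto simp: A_def)
    finally show ?thesis .
  qed (simp add: A_def)
  have "(\<Sum>\<beta>\<in>?H. (fact M / index_fact n \<beta>) powr \<theta> * rmonomial n \<beta> x)
      \<le> (\<Sum>\<beta>\<in>?H. W * (A \<beta> / S ^ M + t ^ M * rmonomial n \<beta> x))"
    by (intro sum_mono summand)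
  also have "\<dots> = W * ((\<Sum>\<beta>\<in>?H. A \<beta>) / S ^ M + t ^ M * (\<Sum>\<beta>\<in>?H. rmonomial n \<beta> x))"
    by (simp add: sum.distrib sum_divide_distrib flip: sum_distrib_left)
  also have "\<dots> \<le> W * (1 + exp (2 * t * S))"
  proof (intro mult_left_mono add_mono W0)
    have "(\<Sum>\<beta>\<in>?H. A \<beta>) \<le> S ^ M"
      unfolding A_def multinomial_theorem using x by (intro power_mono sum_nonneg) auto
    then show "(\<Sum>\<beta>\<in>?H. A \<beta>) / S ^ M \<le> 1" using x by simp
    have "t ^ M * (\<Sum>\<beta>\<in>?H. rmonomial n \<beta> x) \<le> exp (2 * t * (\<Sum>i<n. x i))"
      using x t by (intro sum_rmonomial_le_exp) auto
    also have "\<dots> \<le> exp (2 * t * S)" using x t by simp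
    finally show "t ^ M * (\<Sum>\<beta>\<in>?H. rmonomial n \<beta> x) \<le> exp (2 * t * S)" .
  qed
  finally show ?thesis by (simp add: W_def)
qed

section \<open>Lower bounds for large \<open>p\<close>\<close>
lemma ln_mult_powr_le:
  assumes "n \<ge> 1" "\<delta> > 0"
  shows "ln (real n) * real n powr (- \<delta>) \<le> 1 / \<delta>"
proof -
  have "ln (real n) * real n powr (- \<delta>) \<le> real n powr \<delta> / \<delta> * real n powr (- \<delta>)"
    using assms by (intro mult_right_mono ln_powr_bound) auto
  also have "\<dots> = 1 / \<delta>" using assms by (simp add: powr_minus)
  finally show ?thesis .
qed

lemma dominated_by_bohr_radius:
  assumes p: "1 \<le> p" "1 \<le> q" and c: "c > 0"
    and b: "\<And>n. n \<ge> 2 \<Longrightarrow> b n \<ge> 0" "\<And>n. n \<ge> 2 \<Longrightarrow> bohr_ineq p q n (c * b n)"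
  shows "b \<lless> bohr_radius p q"
  unfolding dominated_def
proof (intro exI conjI allI impI)
  show "1 / c > 0" using c by simp
  fix n :: nat assume n: "2 \<le> n"
  have "c * b n \<le> bohr_radius p q n"
    using p n c b by (intro bohr_radius_greatest(3)) auto
  then show "b n \<le> 1 / c * bohr_radius p q n" using c by (simp add: field_simps)
qed

lemma sum_third_powers_le: "(\<Sum>m=1..N. (1/3) ^ m) \<le> (1/2 :: real)"
proof -
  have "(\<Sum>m=1..N. (1/3) ^ m) = (1 - (1/3) ^ N) / (2::real)"
  proof (induction N)
    case (Suc N)
    have "(\<Sum>m=1..Suc N. (1/3) ^ m) = (1 - (1/3) ^ N) / 2 + (1/3 :: real) ^ Suc N"
      by (simp only: Suc.IH[symmetric]) simp
    then show ?case by (simp add: field_simps)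
  qed simp
  then show ?thesis by simp
qed

lemma sum_half_powers_le: "(\<Sum>m=1..N. (1/2) ^ (m - 1)) \<le> (2 :: real)"
proof -
  have "(\<Sum>m=1..N. (1/2) ^ (m - 1)) = 2 - 2 * (1/2 :: real) ^ N"
  proof (induction N)
    case (Suc N)
    have "(\<Sum>m=1..Suc N. (1/2) ^ (m - 1)) = 2 - 2 * (1/2) ^ N + (1/2 :: real) ^ N"
      by (simp only: Suc.IH[symmetric]) simp
    then show ?case by simp
  qed simp
  then show ?thesis by simp
qed

text \<open>Since balls are solid, \<open>v \<mapsto> P (y v)\<close> is bounded on the polydisc for every point \<open>y\<close> of the ball.\<close>
lemma polydisc_substitution:
  assumes p: "1 \<le> p" "n > 0"
    and G: "\<And>z. z \<in> lball p n \<Longrightarrow> cmod (\<Sum>\<alpha>\<in>hom_indices n m. b \<alpha> * monomial n \<alpha> z) \<le> G"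
    and y: "y \<in> lball p n" and v: "v \<in> cspace n" "\<And>i. cmod (v i) \<le> 1"
  shows "cmod (\<Sum>\<alpha>\<in>hom_indices n m. (b \<alpha> * monomial n \<alpha> y) * monomial n \<alpha> v) \<le> G"
proof -
  have "(\<lambda>i. y i * v i) \<in> lball p n"
    using v by (intro lball_solid[OF p y]) (auto simp: cspace_def norm_mult mult_left_le)
  from G[OF this] show ?thesis by (simp add: monomial_mult mult_ac)
qed

lemma powr_in_lball:
  assumes p: "1 \<le> p" "1 \<le> Q" "n > 0" and u: "u \<in> lball (ereal Q) n"
  shows "(\<lambda>i. of_real (cmod (u i) powr (Q * recip p))) \<in> lball p n"
  using p(1)
proof (cases p rule: ge1_ereal_cases)
  case infty
  have "u \<in> cspace n" using u by (simp add: lball_def)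
  then show ?thesis using infty p by (auto simp: lball_infty_iff cspace_def powr_def)
next
  case (real P)
  have "u \<in> cspace n" using u by (simp add: lball_def)
  then show ?thesis using real p u by (auto simp: lball_real_iff cspace_def powr_powr)
qed

lemma recip_le_half: "2 \<le> p \<Longrightarrow> recip p \<le> 1 / 2"
  by (cases p) (auto simp: field_simps)

lemma recip_nonneg: "1 \<le> p \<Longrightarrow> 0 \<le> recip p"
  by (cases p) auto

lemma recip_le_1: "1 \<le> p \<Longrightarrow> recip p \<le> 1"
  by (cases p) auto

text \<open>For \<open>u\<close> in the \<open>q\<close>-ball put \<open>e = q / p\<close>. Then \<open>\<bar>u\<bar>\<^sup>e\<close> lies in the \<open>p\<close>-ball and \<open>\<bar>u\<bar>\<^sup>1\<^sup>-\<^sup>e\<close> in the \<open>2\<close>-ball; the latter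
is the hypothesis \<open>1/2 + 1/p \<le> 1/q\<close>. Parseval and Cauchy-Schwarz bound the absolute sum in degree
\<open>m\<close> by the supremum, and the radius \<open>1/3\<close> makes the geometric series equal to \<open>1/2\<close>.\<close>
lemma bohr_ineq_constant:
  assumes p: "1 \<le> p" "1 \<le> q" "n > 0" and le: "1/2 + recip p \<le> recip q"
  shows "bohr_ineq p q n (1/3)"
proof (rule bohr_ineq_if_homogeneous[where \<kappa> = "\<lambda>m. (1/3) ^ m"])
  have "q \<noteq> \<infinity>"
  proof
    assume "q = \<infinity>"
    then have "recip q = 0" by simp
    then show False using le recip_nonneg[OF p(1)] by linarith
  qed
  then obtain Q where Q: "q = ereal Q" "1 \<le> Q"
    using p(2) ge1_ereal_cases by blast
  define e where "e = Q * recip p"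
  have e: "0 \<le> e" "e + Q / 2 \<le> 1"
  proof -
    show "0 \<le> e" unfolding e_def by (rule mult_nonneg_nonneg[OF _ recip_nonneg[OF p(1)]]) (use Q(2) in linarith)
    have "Q * (1 / 2 + recip p) \<le> Q * recip q" using Q(2) by (intro mult_left_mono le) linarith
    also have "Q * recip q = 1" using Q(2) by (simp add: Q(1))
    finally show "e + Q / 2 \<le> 1" by (simp add: e_def distrib_left)
  qed
  fix m b G u
  assume G: "\<And>z. z \<in> lball p n \<Longrightarrow> cmod (\<Sum>\<alpha>\<in>hom_indices n m. b \<alpha> * monomial n \<alpha> z) \<le> G"
    and u: "u \<in> lball q n"
  define y where "y = (\<lambda>i. complex_of_real (cmod (u i) powr e))"
  define w where "w = (\<lambda>i. cmod (u i) powr (1 - e))"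
  have G0: "G \<ge> 0" using order_trans[OF norm_ge_zero G[OF zero_in_lball]] p by simp
  have y: "y \<in> lball p n" using powr_in_lball[OF p(1) Q(2) p(3)] u Q by (simp add: y_def e_def)
  have yw: "cmod (u i) = cmod (y i) * w i" for i
    unfolding y_def w_def norm_of_real by (simp flip: powr_add)
  let ?H = "hom_indices n m"
  have "(\<Sum>\<alpha>\<in>?H. (cmod (b \<alpha> * monomial n \<alpha> y))\<^sup>2) \<le> G\<^sup>2"
    by (rule sum_norm_coeff_square_le) (rule polydisc_substitution[OF p(1,3) G y])
  moreover have "(\<Sum>\<alpha>\<in>?H. (rmonomial n \<alpha> w)\<^sup>2) \<le> 1"
  proof -
    have "(\<Sum>\<alpha>\<in>?H. (rmonomial n \<alpha> w)\<^sup>2) = (\<Sum>\<alpha>\<in>?H. rmonomial n \<alpha> (\<lambda>i. (w i)\<^sup>2))"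
      by (simp add: rmonomial_def prod_power_distrib mult.commute flip: power_mult)
    also have "\<dots> \<le> (\<Sum>i<n. (w i)\<^sup>2) ^ m" by (intro sum_rmonomial_le_power) auto
    also have "\<dots> \<le> 1 ^ m"
    proof (intro power_mono sum_nonneg)
      have "(\<Sum>i<n. cmod (u i) powr (2 * (1 - e))) \<le> 1"
        using e Q u p by (intro sum_powr_le_1_of_lball[of Q]) auto
      then show "(\<Sum>i<n. (w i)\<^sup>2) \<le> 1"
        by (simp only: w_def power2_eq_square powr_add[symmetric] mult_2)
    qed auto
    finally show ?thesis by simp
  qed
  ultimately have "(\<Sum>\<alpha>\<in>?H. (cmod (b \<alpha> * monomial n \<alpha> y))\<^sup>2) * (\<Sum>\<alpha>\<in>?H. (rmonomial n \<alpha> w)\<^sup>2) \<le> G\<^sup>2 * 1"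
    by (rule mult_mono) (auto intro: sum_nonneg)
  then have "(\<Sum>\<alpha>\<in>?H. cmod (b \<alpha> * monomial n \<alpha> y) * rmonomial n \<alpha> w)\<^sup>2 \<le> G\<^sup>2 * 1"
    by (rule order_trans[OF Cauchy_Schwarz_ineq_sum])
  then have "(\<Sum>\<alpha>\<in>?H. cmod (b \<alpha> * monomial n \<alpha> y) * rmonomial n \<alpha> w) \<le> G"
    unfolding mult_1_right using G0 by (rule power2_le_imp_le)
  moreover have "cmod (b \<alpha> * monomial n \<alpha> y) * rmonomial n \<alpha> w = cmod (b \<alpha>) * rmonomial n \<alpha> (\<lambda>i. cmod (u i))" for \<alpha>
    by (simp add: yw rmonomial_mult norm_mult norm_monomial)
  ultimately have "(\<Sum>\<alpha>\<in>?H. cmod (b \<alpha>) * rmonomial n \<alpha> (\<lambda>i. cmod (u i))) \<le> G" by simp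
  then have "(1/3) ^ m * (\<Sum>\<alpha>\<in>?H. cmod (b \<alpha>) * rmonomial n \<alpha> (\<lambda>i. cmod (u i))) \<le> (1/3) ^ m * G"
    by (intro mult_left_mono) auto
  moreover have "(\<Sum>\<alpha>\<in>?H. cmod (b \<alpha>) * rmonomial n \<alpha> (\<lambda>i. 1/3 * cmod (u i)))
     = (1/3) ^ m * (\<Sum>\<alpha>\<in>?H. cmod (b \<alpha>) * rmonomial n \<alpha> (\<lambda>i. cmod (u i)))"
    unfolding sum_distrib_left
    by (intro sum.cong refl) (simp only: rmonomial_scale[of _ n m "1/3"] mult.left_commute[of "cmod _"])
  ultimately show "(\<Sum>\<alpha>\<in>?H. cmod (b \<alpha>) * rmonomial n \<alpha> (\<lambda>i. 1/3 * cmod (u i))) \<le> (1/3) ^ m * G"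
    by simp
qed (rule p(1), rule p(3), simp, rule sum_third_powers_le)

text \<open>The factor \<open>2\<^sup>M\<close> of \<open>sum_norm_coeff_polydisc\<close> is beaten by using the exponential bound for
\<open>\<Sum> x\<^sup>2\<^sup>\<beta>\<close> with parameter \<open>16\<close>: after the square root it gains \<open>4\<^sup>-\<^sup>M\<close> and costs \<open>n\<^bsup>16 c\<^sup>2\<^esup> \<le> n\<^bsup>\<delta> / 2\<^esup>\<close>. The bound on the
single \<open>x\<^sub>i\<close> provides \<open>n\<^sup>-\<^sup>\<delta>\<close>.\<close>
lemma bohr_ineq_factorised:
  assumes p: "1 \<le> p" and n: "n \<ge> 2" and r: "r \<ge> 0"
    and \<delta>: "\<delta> > 0" and c: "c > 0" "c\<^sup>2 \<le> \<delta> / 32" "4 * sqrt 2 * exp 1 * c * sqrt (1 / \<delta>) \<le> 1 / 2"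
    and factor: "\<And>u. u \<in> lball q n \<Longrightarrow> \<exists>y x. y \<in> lball p n \<and>
       (\<forall>i<n. r * cmod (u i) = cmod (y i) * x i \<and> 0 \<le> x i \<and>
              x i \<le> c * sqrt (ln (real n)) * real n powr (- \<delta>)) \<and>
       (\<Sum>i<n. (x i)\<^sup>2) \<le> c\<^sup>2 * ln (real n)"
  shows "bohr_ineq p q n r"
proof -
  define L where "L = ln (real n)"
  define X where "X = c * sqrt L * real n powr (- \<delta>)"
  have L: "L > 0" using n by (simp add: L_def)
  have X0: "X \<ge> 0" using c L by (simp add: X_def)
  have Ld: "L * real n powr (- d) \<le> 1 / d" if "d > 0" for d
    unfolding L_def using n that by (intro ln_mult_powr_le) auto
  have X2: "16 * X\<^sup>2 \<le> 1 / 2"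
  proof -
    have "X\<^sup>2 = c\<^sup>2 * (L * real n powr (- (2 * \<delta>)))"
    proof -
      have "(real n powr (- \<delta>))\<^sup>2 = real n powr (- (2 * \<delta>))"
        by (simp only: power2_eq_square powr_add[symmetric] mult_2 minus_add_distrib)
      then show ?thesis using L by (simp add: X_def power_mult_distrib)
    qed
    also have "\<dots> \<le> \<delta> / 32 * (1 / (2 * \<delta>))"
      using c \<delta> L by (intro mult_mono Ld) auto
    finally show ?thesis using \<delta> by simp
  qed
  define K where "K = 2 * sqrt 2 * exp 1 * c * sqrt (1 / \<delta>)"
  show ?thesis
  proof (rule bohr_ineq_if_homogeneous[where \<kappa> = "\<lambda>m. K * (1/2) ^ (m - 1)"])
    fix N
    have "(\<Sum>m=1..N. K * (1/2) ^ (m - 1)) = K * (\<Sum>m=1..N. (1/2) ^ (m - 1))"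
      by (simp add: sum_distrib_left)
    also have "\<dots> \<le> K * 2"
      using c \<delta> by (intro mult_left_mono sum_half_powers_le) (auto simp: K_def)
    also have "\<dots> \<le> 1 / 2" using c(3) by (simp add: K_def)
    finally show "(\<Sum>m=1..N. K * (1/2) ^ (m - 1)) \<le> 1 / 2" .
  next
    fix m b G u
    assume m: "1 \<le> m"
      and G: "\<And>z. z \<in> lball p n \<Longrightarrow> cmod (\<Sum>\<alpha>\<in>hom_indices n m. b \<alpha> * monomial n \<alpha> z) \<le> G"
      and u: "u \<in> lball q n"
    obtain M where M: "m = Suc M" using m by (cases m) auto
    have G0: "G \<ge> 0" using order_trans[OF norm_ge_zero G[OF zero_in_lball]] p n by simp
    obtain y x where y: "y \<in> lball p n" and x: "\<And>i. i < n \<Longrightarrow> r * cmod (u i) = cmod (y i) * x i"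
        "\<And>i. i < n \<Longrightarrow> 0 \<le> x i" "\<And>i. i < n \<Longrightarrow> x i \<le> X" "(\<Sum>i<n. (x i)\<^sup>2) \<le> c\<^sup>2 * L"
      using factor[OF u] unfolding X_def L_def by blast
    define h where "h = (\<Sum>\<beta>\<in>hom_indices n M. rmonomial n \<beta> (\<lambda>i. (x i)\<^sup>2))"
    have "16 ^ M * h \<le> exp (2 * 16 * (\<Sum>i<n. (x i)\<^sup>2))"
      unfolding h_def
    proof (rule sum_rmonomial_le_exp)
      fix i assume "i < n"
      then have "(x i)\<^sup>2 \<le> X\<^sup>2" using x by (intro power_mono) auto
      then show "16 * (x i)\<^sup>2 \<le> 1 / 2" using X2 by simp
    qed auto
    also have "\<dots> \<le> exp (\<delta> * L)"
    proof -
      have "2 * 16 * (\<Sum>i<n. (x i)\<^sup>2) \<le> 32 * (\<delta> / 32 * L)"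
        using order_trans[OF x(4) mult_right_mono[OF c(2), of L]] L by simp
      then show ?thesis by simp
    qed
    also have "exp (\<delta> * L) = real n powr \<delta>" using n by (simp add: powr_def L_def)
    finally have "sqrt (16 ^ M * h) \<le> sqrt (real n powr \<delta>)" by (rule real_sqrt_le_mono)
    moreover have "sqrt (16 ^ M * h) = 4 ^ M * sqrt h"
    proof -
      have "(16::real) ^ M = (4 ^ M)\<^sup>2" by (simp add: power2_eq_square flip: power_mult_distrib)
      then show ?thesis by (simp add: real_sqrt_mult)
    qed
    ultimately have h: "4 ^ M * sqrt h \<le> sqrt (real n powr \<delta>)" by simp
    have "(\<Sum>\<alpha>\<in>hom_indices n m. cmod (b \<alpha>) * rmonomial n \<alpha> (\<lambda>i. r * cmod (u i)))
        = (\<Sum>\<alpha>\<in>hom_indices n (Suc M). cmod (b \<alpha> * monomial n \<alpha> y) * rmonomial n \<alpha> x)"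
    proof -
      have "rmonomial n \<alpha> (\<lambda>i. r * cmod (u i)) = rmonomial n \<alpha> (\<lambda>i. cmod (y i) * x i)" for \<alpha>
        unfolding rmonomial_def by (intro prod.cong refl) (simp add: x)
      then show ?thesis by (simp add: M rmonomial_mult norm_mult norm_monomial mult.assoc)
    qed
    also have "\<dots> \<le> 2 * sqrt 2 * exp 1 * 2 ^ M * G * X * sqrt h"
      unfolding h_def using x X0 n
      by (intro sum_norm_coeff_polydisc polydisc_substitution[OF p _ G[unfolded M] y]) auto
    also have "\<dots> = 2 * sqrt 2 * exp 1 * G * (1/2) ^ M * X * (4 ^ M * sqrt h)"
    proof -
      have "(2::real) ^ M = (1/2) ^ M * 4 ^ M" by (simp flip: power_mult_distrib)
      then show ?thesis by (simp only: mult_ac)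
    qed
    also have "\<dots> \<le> 2 * sqrt 2 * exp 1 * G * (1/2) ^ M * X * sqrt (real n powr \<delta>)"
      using G0 X0 by (intro mult_left_mono h) auto
    also have "\<dots> = 2 * sqrt 2 * exp 1 * G * (1/2) ^ M * c * (sqrt L * real n powr (- \<delta>) * sqrt (real n powr \<delta>))"
      by (simp add: X_def mult_ac)
    also have "sqrt L * real n powr (- \<delta>) * sqrt (real n powr \<delta>) = sqrt (L * real n powr (- \<delta>))"
    proof -
      have "sqrt (real n powr a) = real n powr (a / 2)" for a
        using n by (simp add: powr_half_sqrt[symmetric] powr_powr)
      then show ?thesis by (simp add: real_sqrt_mult flip: powr_add)
    qed
    also have "2 * sqrt 2 * exp 1 * G * (1/2) ^ M * c * sqrt (L * real n powr (- \<delta>))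
        \<le> 2 * sqrt 2 * exp 1 * G * (1/2) ^ M * c * sqrt (1 / \<delta>)"
      using G0 c \<delta> by (intro mult_left_mono real_sqrt_le_mono Ld) auto
    also have "\<dots> = K * (1/2) ^ (m - 1) * G" by (simp add: K_def M mult_ac)
    finally show "(\<Sum>\<alpha>\<in>hom_indices n m. cmod (b \<alpha>) * rmonomial n \<alpha> (\<lambda>i. r * cmod (u i))) \<le> K * (1/2) ^ (m - 1) * G" .
  qed (use p n r in \<open>simp_all\<close>)
qed

lemma small_constant_exists:
  fixes A B :: real
  assumes "A > 0" "B > 0"
  obtains c where "c > 0" "c\<^sup>2 \<le> A" "B * c \<le> 1 / 2"
proof
  define c where "c = min (sqrt A) (1 / (2 * B))"
  show "c > 0" using assms by (simp add: c_def)
  have "c \<le> sqrt A" "c \<le> 1 / (2 * B)" by (auto simp: c_def)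
  show "c\<^sup>2 \<le> A"
    using power_mono[OF \<open>c \<le> sqrt A\<close>, of 2] \<open>c > 0\<close> assms by simp
  show "B * c \<le> 1 / 2"
    using mult_left_mono[OF \<open>c \<le> 1 / (2 * B)\<close>, of B] assms by simp
qed

text \<open>A point \<open>u\<close> of the \<open>q\<close>-ball is factorised in two ways. For \<open>q > 2\<close> the factor \<open>y\<close> in the \<open>p\<close>-ball has
equal coordinates \<open>n\<^sup>-\<^sup>1\<^sup>/\<^sup>p\<close>; for \<open>q \<le> 2\<close> it is \<open>\<bar>u\<bar>\<^sup>e\<close> with \<open>e = q / p\<close>. In both cases the other factor
has squared \<open>2\<close>-norm at most \<open>c\<^sup>2 ln n\<close>, and its coordinates are at most \<open>c sqrt (ln n)\<close> times a
negative power of \<open>n\<close>.\<close>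
lemma lower_bound_large_p:
  assumes p: "2 \<le> p" "1 \<le> q" and gt: "1/2 + recip p > recip q"
  shows "(\<lambda>n. sqrt (ln (real n)) / real n powr (1/2 + recip p - recip q)) \<lless> bohr_radius p q"
proof -
  define \<sigma> where "\<sigma> = 1/2 + recip p - recip q"
  have \<sigma>: "\<sigma> > 0" using gt by (simp add: \<sigma>_def)
  have p1: "1 \<le> p" using p(1) by (rule order_trans[rotated]) simp
  \<comment> \<open>the exponent of decay of the single coordinates in the two factorisations\<close>
  define \<delta> where "\<delta> = (if recip q < 1/2 then 1/2 - recip q else \<sigma>)"
  have \<delta>: "\<delta> > 0" using \<sigma> by (auto simp: \<delta>_def)
  obtain c where c: "c > 0" "c\<^sup>2 \<le> \<delta> / 32" "(4 * sqrt 2 * exp 1 * sqrt (1 / \<delta>)) * c \<le> 1 / 2"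
    using small_constant_exists[of "\<delta> / 32" "4 * sqrt 2 * exp 1 * sqrt (1 / \<delta>)"] \<delta> by auto
  have ineq: "bohr_ineq p q n (c * (sqrt (ln (real n)) / real n powr \<sigma>))" if n: "n \<ge> 2" for n
  proof -
    define L where "L = ln (real n)"
    have L: "L > 0" using n by (simp add: L_def)
    define r where "r = c * sqrt L * real n powr (- \<sigma>)"
    have r0: "r \<ge> 0" using c L by (simp add: r_def)
    have r2: "r\<^sup>2 = c\<^sup>2 * L * real n powr (- (2 * \<sigma>))"
    proof -
      have "(real n powr (- \<sigma>))\<^sup>2 = real n powr (- (2 * \<sigma>))"
        by (simp only: power2_eq_square powr_add[symmetric] mult_2 minus_add_distrib)
      then show ?thesis using L by (simp add: r_def power_mult_distrib)
    qed
    have "bohr_ineq p q n r"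
    proof (rule bohr_ineq_factorised[OF p1 n r0 \<delta> c(1,2)])
      show "4 * sqrt 2 * exp 1 * c * sqrt (1 / \<delta>) \<le> 1 / 2" using c(3) by (simp only: mult_ac)
      fix u assume u: "u \<in> lball q n"
      have u1: "cmod (u i) \<le> 1" for i using norm_le_1_of_lball[OF p(2) _ u] n by simp
      show "\<exists>y x. y \<in> lball p n \<and>
       (\<forall>i<n. r * cmod (u i) = cmod (y i) * x i \<and> 0 \<le> x i \<and>
              x i \<le> c * sqrt (ln (real n)) * real n powr (- \<delta>)) \<and>
       (\<Sum>i<n. (x i)\<^sup>2) \<le> c\<^sup>2 * ln (real n)"
      proof (cases "recip q < 1/2")
        case True
        define N where "N = real n powr recip p"
        have N: "N > 0" using n by (simp add: N_def)
        define y where "y = (\<lambda>i. if i < n then complex_of_real (1 / N) else 0)"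
        define x where "x = (\<lambda>i. r * N * cmod (u i))"
        have ny: "cmod (y i) = 1 / N" if "i < n" for i
          using that N unfolding y_def by (simp only: if_True norm_of_real) simp
        have "y \<in> lball p n"
          using p1
        proof (cases p rule: ge1_ereal_cases)
          case infty
          then have "N = 1" using n by (simp add: N_def)
          then show ?thesis using n infty by (auto simp: lball_infty_iff y_def cspace_def)
        next
          case (real P)
          have "N powr P = real n" using n real by (simp add: N_def powr_powr)
          then have "(1 / N) powr P = 1 / real n" using N by (simp add: powr_divide)
          then have "(\<Sum>i<n. cmod (y i) powr P) = 1"
            using n by (simp add: ny)
          then show ?thesis using real by (auto simp: lball_real_iff y_def cspace_def)
        qed
        moreover have "r * cmod (u i) = cmod (y i) * x i" if "i < n" for i
          using that N by (simp add: ny x_def)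
        moreover have "0 \<le> x i" for i using r0 N by (simp add: x_def)
        moreover have "x i \<le> c * sqrt L * real n powr (- \<delta>)" for i
        proof -
          have "x i \<le> r * N * 1"
            unfolding x_def using u1 r0 N by (intro mult_left_mono) auto
          also have "\<dots> = c * sqrt L * (real n powr (- \<sigma>) * N)" by (simp add: r_def)
          also have "real n powr (- \<sigma>) * N = real n powr (- \<sigma> + recip p)"
            unfolding N_def by (rule powr_add[symmetric])
          also have "- \<sigma> + recip p = - \<delta>" using True by (simp add: \<sigma>_def \<delta>_def)
          finally show ?thesis .
        qed
        moreover have "(\<Sum>i<n. (x i)\<^sup>2) \<le> c\<^sup>2 * L"
        proof -
          have "(\<Sum>i<n. (x i)\<^sup>2) = r\<^sup>2 * N\<^sup>2 * (\<Sum>i<n. (cmod (u i))\<^sup>2)"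
            by (simp add: x_def power_mult_distrib sum_distrib_left)
          also have "(\<Sum>i<n. (cmod (u i))\<^sup>2) = (\<Sum>i<n. cmod (u i) powr 2)" by simp
          also have "r\<^sup>2 * N\<^sup>2 * \<dots> \<le> r\<^sup>2 * N\<^sup>2 * real n powr (1 - 2 * recip q)"
            using True n u p by (intro mult_left_mono sum_powr_le_of_lball) auto
          also have "\<dots> = c\<^sup>2 * L * (real n powr (- (2 * \<sigma>)) * N\<^sup>2 * real n powr (1 - 2 * recip q))"
            by (simp add: r2)
          also have "N\<^sup>2 = real n powr (recip p + recip p)"
            by (simp only: N_def power2_eq_square powr_add)
          also have "real n powr (- (2 * \<sigma>)) * real n powr (recip p + recip p) * real n powr (1 - 2 * recip q)
              = real n powr (- (2 * \<sigma>) + (recip p + recip p) + (1 - 2 * recip q))"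
            by (simp only: powr_add)
          also have "- (2 * \<sigma>) + (recip p + recip p) + (1 - 2 * recip q) = 0"
            by (simp add: \<sigma>_def)
          finally show ?thesis using n by simp
        qed
        ultimately show ?thesis unfolding L_def by blast
      next
        case False
        obtain Q where Q: "q = ereal Q" "1 \<le> Q"
          using p(2) False by (cases q rule: ge1_ereal_cases) auto
        have Q2: "Q \<le> 2" using False Q by (simp add: field_simps)
        define e where "e = Q * recip p"
        have e: "0 \<le> e" "e \<le> 1"
        proof -
          show "0 \<le> e" unfolding e_def by (rule mult_nonneg_nonneg[OF _ recip_nonneg[OF p1]]) (use Q(2) in linarith)
          have "e \<le> 2 * (1 / 2)" unfolding e_def
            by (rule mult_mono[OF Q2 recip_le_half[OF p(1)] _ recip_nonneg[OF p1]]) simp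
          then show "e \<le> 1" by simp
        qed
        have eQ: "2 * (1 - e) / Q = 1 - 2 * \<sigma>"
        proof -
          have "e / Q = recip p" using Q by (simp add: e_def)
          moreover have "2 * (1 - e) / Q = 2 * (1 / Q) - 2 * (e / Q)"
            by (simp add: diff_divide_distrib right_diff_distrib)
          ultimately show ?thesis using Q by (simp add: \<sigma>_def)
        qed
        define y where "y = (\<lambda>i. complex_of_real (cmod (u i) powr e))"
        define x where "x = (\<lambda>i. r * cmod (u i) powr (1 - e))"
        have "y \<in> lball p n"
          using powr_in_lball[OF p1 Q(2)] u Q n by (simp add: y_def e_def)
        moreover have "r * cmod (u i) = cmod (y i) * x i" for i
          by (simp add: y_def x_def flip: powr_add)
        moreover have "0 \<le> x i" for i using r0 by (simp add: x_def)
        moreover have "x i \<le> c * sqrt L * real n powr (- \<delta>)" for i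
        proof -
          have "x i \<le> r * 1"
            unfolding x_def using u1 r0 e by (intro mult_left_mono powr_le1) auto
          then show ?thesis using False by (simp add: r_def \<delta>_def)
        qed
        moreover have "(\<Sum>i<n. (x i)\<^sup>2) \<le> c\<^sup>2 * L"
        proof -
          have "(\<Sum>i<n. (x i)\<^sup>2) = r\<^sup>2 * (\<Sum>i<n. cmod (u i) powr (2 * (1 - e)))"
          proof -
            have "(x i)\<^sup>2 = r\<^sup>2 * cmod (u i) powr (2 * (1 - e))" for i
              by (simp only: x_def power_mult_distrib power2_eq_square[of "_ powr _"] powr_add[symmetric] mult_2)
            then show ?thesis by (simp add: sum_distrib_left)
          qed
          also have "\<dots> \<le> r\<^sup>2 * real n powr (1 - 2 * (1 - e) * recip q)"
            using n u p e eQ \<sigma> Q by (intro mult_left_mono sum_powr_le_of_lball) auto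
          also have "1 - 2 * (1 - e) * recip q = 2 * \<sigma>" using eQ Q by simp
          also have "r\<^sup>2 * real n powr (2 * \<sigma>) = c\<^sup>2 * L"
            using n by (simp add: r2 powr_minus)
          finally show ?thesis .
        qed
        ultimately show ?thesis unfolding L_def by blast
      qed
    qed
    moreover have "r = c * (sqrt (ln (real n)) / real n powr \<sigma>)"
      by (simp add: r_def L_def powr_minus divide_inverse)
    ultimately show ?thesis by simp
  qed
  show ?thesis
    by (rule dominated_by_bohr_radius[OF p1 p(2) c(1) _ ineq[unfolded \<sigma>_def]]) simp_all
qed

section \<open>Lower bounds for small \<open>p\<close> and for \<open>q = 1\<close>\<close>
lemma bohr_ineq_mono_p:
  assumes "bohr_ineq p q n r" "lball p n \<subseteq> lball p' n"
  shows "bohr_ineq p' q n r"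
  unfolding bohr_ineq_def
proof (intro allI impI)
  fix a f assume "entire_series n a f"
  then have "(SUP z\<in>scaled r (lball q n). \<Sum>\<^sub>\<infinity>\<alpha>\<in>multiindices n. ennreal (cmod (a \<alpha> * monomial n \<alpha> z)))
      \<le> (SUP z\<in>lball p n. ennreal (cmod (f z)))"
    using assms(1) by (simp add: bohr_ineq_def)
  also have "\<dots> \<le> (SUP z\<in>lball p' n. ennreal (cmod (f z)))"
    using assms(2) by (rule SUP_subset_mono) simp
  finally show "(SUP z\<in>scaled r (lball q n). \<Sum>\<^sub>\<infinity>\<alpha>\<in>multiindices n. ennreal (cmod (a \<alpha> * monomial n \<alpha> z)))
      \<le> (SUP z\<in>lball p' n. ennreal (cmod (f z)))" .
qed

lemma lball_1_subset:
  assumes "1 \<le> p" "n > 0"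
  shows "lball 1 n \<subseteq> lball p n"
proof
  fix z assume z: "z \<in> lball 1 n"
  from assms(1) show "z \<in> lball p n"
  proof (cases p rule: ge1_ereal_cases)
    case infty
    then show ?thesis using z norm_le_1_of_lball[of 1 n z] assms(2)
      by (auto simp: lball_infty_iff) (auto simp: lball_def)
  next
    case (real P)
    then have "(\<Sum>i<n. cmod (z i) powr P) \<le> 1"
      using z assms(2) sum_powr_le_1_of_lball[of 1 P n z] by (simp add: one_ereal_def)
    then show ?thesis using z real by (auto simp: lball_real_iff) (auto simp: lball_def)
  qed
qed

text \<open>The radius is chosen so that the scaled \<open>q\<close>-ball lies in the \<open>1\<close>-ball of radius \<open>1/9\<close>. There the absolute sum in degree \<open>m\<close> is
at most \<open>(e / 9)\<^sup>m\<close> times the supremum by the multinomial theorem, and \<open>e \<le> 3\<close>.\<close>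
lemma bohr_ineq_p_1:
  assumes q: "1 \<le> q" and n: "n \<ge> 2"
  shows "bohr_ineq 1 q n (1 / 9 * real n powr (- (1 - recip q)))"
proof -
  define r where "r = 1 / 9 * real n powr (- (1 - recip q))"
  have r: "r > 0" using n by (simp add: r_def)
  have "bohr_ineq (ereal 1) q n r"
  proof (rule bohr_ineq_if_homogeneous[where \<kappa> = "\<lambda>m. (1/3) ^ m"])
    fix m b G u
    assume m: "1 \<le> m"
      and G: "\<And>z. z \<in> lball (ereal 1) n \<Longrightarrow> cmod (\<Sum>\<alpha>\<in>hom_indices n m. b \<alpha> * monomial n \<alpha> z) \<le> G"
      and u: "u \<in> lball q n"
    obtain M where M: "m = Suc M" using m by (cases m) auto
    have G0: "G \<ge> 0" using order_trans[OF norm_ge_zero G[OF zero_in_lball]] n by simp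
    let ?x = "\<lambda>i. r * cmod (u i)"
    have x: "(\<Sum>i<n. ?x i) \<le> 1 / 9"
    proof -
      have "(\<Sum>i<n. cmod (u i) powr 1) \<le> real n powr (1 - 1 * recip q)"
        using q recip_le_1[OF q] n u by (intro sum_powr_le_of_lball) auto
      then have "r * (\<Sum>i<n. cmod (u i)) \<le> r * real n powr (1 - recip q)"
        using r by simp
      also have "\<dots> = 1 / 9 * (real n powr (- (1 - recip q)) * real n powr (1 - recip q))"
        by (simp only: r_def mult.assoc)
      also have "\<dots> = 1 / 9" using n by (simp flip: powr_add)
      finally show ?thesis by (simp add: sum_distrib_left)
    qed
    have "(\<Sum>\<alpha>\<in>hom_indices n (Suc M). cmod (b \<alpha>) * rmonomial n \<alpha> ?x)
      \<le> exp (real (Suc M)) * G * (1 / 9) * (\<Sum>\<beta>\<in>hom_indices n M. (fact M / index_fact n \<beta>) powr (1 / 1) * rmonomial n \<beta> ?x)"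
    proof (rule sum_norm_coeff_lball)
      have "(\<Sum>i<n. (?x i / (1 / 9)) powr 1) = 9 * (\<Sum>i<n. ?x i)"
        using r by (simp add: sum_distrib_left mult_ac)
      then show "(\<Sum>i<n. (?x i / (1 / 9)) powr 1) \<le> 1" using x by simp
      show "\<And>z. z \<in> lball (ereal 1) n \<Longrightarrow> cmod (\<Sum>\<alpha>\<in>hom_indices n (Suc M). b \<alpha> * monomial n \<alpha> z) \<le> G"
        using G unfolding M .
    qed (use n r in auto)
    also have "(\<Sum>\<beta>\<in>hom_indices n M. (fact M / index_fact n \<beta>) powr (1 / 1) * rmonomial n \<beta> ?x)
        = (\<Sum>i<n. ?x i) ^ M"
      unfolding multinomial_theorem[symmetric] using index_fact_pos[of n]
      by (intro sum.cong refl) (simp add: less_imp_le)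
    also have "exp (real (Suc M)) * G * (1 / 9) * (\<Sum>i<n. ?x i) ^ M \<le> exp (real (Suc M)) * G * (1 / 9) * (1 / 9) ^ M"
      using x G0 r by (intro mult_left_mono power_mono sum_nonneg) auto
    also have "\<dots> = (exp 1 / 9) ^ Suc M * G"
    proof -
      have "exp (real (Suc M)) = exp 1 ^ Suc M" using exp_of_nat_mult[of "Suc M" "1::real"] by simp
      then show ?thesis by (simp only: power_divide power_Suc) (simp add: power_divide)
    qed
    also have "\<dots> \<le> (1 / 3) ^ Suc M * G"
      using exp_le G0 by (intro mult_right_mono power_mono) auto
    finally show "(\<Sum>\<alpha>\<in>hom_indices n m. cmod (b \<alpha>) * rmonomial n \<alpha> ?x) \<le> (1/3) ^ m * G"
      by (simp only: M)
  next
    show "(\<Sum>m=1..N. (1/3) ^ m) \<le> (1/2 :: real)" for N by (rule sum_third_powers_le)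
  qed (use n r in simp_all)
  then show ?thesis by (simp add: r_def one_ereal_def)
qed

text \<open>The \<open>P\<close>-norm is at most \<open>n\<^bsup>1/P - 1/q\<^esup>\<close> on the \<open>q\<close>-ball if \<open>P \<le> q\<close>, and at most \<open>1\<close> if \<open>P \<ge> q\<close>.\<close>
lemma scaled_point_in_lball:
  assumes q: "1 \<le> q" "1 \<le> P" "n > 0" and u: "u \<in> lball q n"
  shows "(\<Sum>i<n. (cmod (u i) / real n powr max 0 (1 / P - recip q)) powr P) \<le> 1"
proof (cases "P * recip q \<le> 1")
  case True
  have "recip q \<le> 1 / P" using True q by (simp add: field_simps)
  then have mx: "max 0 (1 / P - recip q) = 1 / P - recip q" by simp
  have "(\<Sum>i<n. (cmod (u i) / real n powr (1 / P - recip q)) powr P)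
      = (\<Sum>i<n. cmod (u i) powr P) / real n powr (1 - P * recip q)"
  proof -
    have "(real n powr (1 / P - recip q)) powr P = real n powr (1 - P * recip q)"
    proof -
      have "(1 / P - recip q) * P = 1 - P * recip q" using q by (simp add: left_diff_distrib)
      then show ?thesis by (simp add: powr_powr)
    qed
    then show ?thesis by (simp add: powr_divide sum_divide_distrib)
  qed
  also have "\<dots> \<le> 1"
    using sum_powr_le_of_lball[OF q(1) _ True q(3) u] q by simp
  finally show ?thesis by (simp only: mx)
next
  case False
  then have ne: "q \<noteq> \<infinity>" by auto
  obtain Q where Q: "q = ereal Q" "1 \<le> Q" using q(1) ne by (cases q rule: ge1_ereal_cases) auto
  have QP: "Q \<le> P" using False Q by (simp add: field_simps)
  then have "1 / P \<le> recip q" using Q by (simp add: field_simps)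
  then have mx: "max 0 (1 / P - recip q) = 0" by simp
  show ?thesis unfolding mx using sum_powr_le_1_of_lball[OF Q(2) QP q(3)] u Q q by simp
qed

text \<open>On the scaled \<open>q\<close>-ball the \<open>1\<close>-norm is at most \<open>S = c L\<^bsup>1 - \<theta>\<^esup>\<close> with \<open>L = ln n\<close> and \<open>\<theta> = 1/P\<close>. The
parameter \<open>t = L\<^sup>\<theta>\<close> is forced: it makes \<open>t S = c L\<close>, so the exponential is the small power
\<open>n\<^bsup>2 c\<^esup>\<close>, and it cancels all logarithms in \<open>S\<^sup>\<theta> t\<^bsup>\<theta> - 1\<^esup> = c\<^sup>\<theta>\<close>. The one remaining factor \<open>X\<close>, a bound
for the \<open>P\<close>-norm, decays like a power of \<open>n\<close>, as \<open>P > 1\<close> and \<open>q \<noteq> 1\<close>.\<close>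
lemma lower_bound_small_p:
  assumes P: "1 < P" "P \<le> 2" and q: "1 \<le> q" "q \<noteq> 1"
  shows "(\<lambda>n. ln (real n) powr (1 - 1 / P) / real n powr (1 - recip q)) \<lless> bohr_radius (ereal P) q"
proof -
  define \<theta> where "\<theta> = 1 / P"
  have \<theta>: "1 / 2 \<le> \<theta>" "\<theta> < 1"
  proof -
    show "1 / 2 \<le> \<theta>" unfolding \<theta>_def using P by (intro frac_le) simp_all
    show "\<theta> < 1" unfolding \<theta>_def using P by simp
  qed
  define \<delta> where "\<delta> = 1 - recip q"
  have \<delta>: "\<delta> > 0"
    using q(1)
  proof (cases q rule: ge1_ereal_cases)
    case (real Q)
    then have "Q > 1" using q(2) by (simp add: one_ereal_def)
    then show ?thesis using real by (simp add: \<delta>_def)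
  qed (simp add: \<delta>_def)
  \<comment> \<open>the exponent of decay of the \<open>P\<close>-norm on the scaled ball, up to logarithms\<close>
  define d where "d = min \<delta> (1 - \<theta>)"
  have d: "d > 0" "d \<le> \<delta>" "d \<le> 1 - \<theta>" using \<delta> \<theta> by (auto simp: d_def)
  \<comment> \<open>a bound for \<open>L\<^bsup>1 - \<theta>\<^esup> n\<^bsup>- d / 2\<^esup>\<close>\<close>
  define D where "D = 1 + 2 / d"
  have D: "D > 0" using d by (simp add: D_def add_pos_pos)
  \<comment> \<open>the three bounds ensure \<open>n\<^bsup>2 c\<^esup> \<le> n\<^bsup>d / 2\<^esup>\<close>, \<open>e c\<^sup>\<theta> \<le> 1/2\<close>, and that the series over all degrees is at most \<open>1/2\<close>\<close>
  define c where "c = min (d / 4) (min (1 / 36) (1 / (8 * exp 1 * D)))"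
  have c0: "c > 0" using d D by (simp add: c_def)
  have c: "c \<le> d / 4" "c \<le> 1 / 36" "c \<le> 1 / (8 * exp 1 * D)" by (simp_all add: c_def)
  have ineq: "bohr_ineq (ereal P) q n (c * (ln (real n) powr (1 - \<theta>) / real n powr \<delta>))" if n: "n \<ge> 2" for n
  proof -
    define L where "L = ln (real n)"
    have L: "L > 0" using n by (simp add: L_def)
    have n1: "real n \<ge> 1" using n by simp
    define S where "S = c * L powr (1 - \<theta>)"
    define r where "r = S * real n powr (- \<delta>)"
    define t where "t = L powr \<theta>"
    define X where "X = r * real n powr max 0 (\<theta> - recip q)"
    have pos: "S > 0" "r > 0" "t > 0" "X > 0" using c0 L n by (auto simp: S_def r_def t_def X_def)
    have tS: "t * S = c * L"
    proof -
      have "t * S = c * (L powr \<theta> * L powr (1 - \<theta>))" by (simp add: t_def S_def)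
      also have "L powr \<theta> * L powr (1 - \<theta>) = L" using L by (simp flip: powr_add)
      finally show ?thesis .
    qed
    have Ld: "L * real n powr (- a) \<le> 1 / a" if "a > 0" for a
      unfolding L_def using n that by (intro ln_mult_powr_le) auto
    have St: "S powr \<theta> * t powr (\<theta> - 1) = c powr \<theta>"
    proof -
      have "S powr \<theta> * t powr (\<theta> - 1) = c powr \<theta> * (L powr ((1 - \<theta>) * \<theta>) * L powr (\<theta> * (\<theta> - 1)))"
        by (simp add: S_def t_def powr_mult powr_powr)
      also have "L powr ((1 - \<theta>) * \<theta>) * L powr (\<theta> * (\<theta> - 1)) = L powr ((1 - \<theta>) * \<theta> + \<theta> * (\<theta> - 1))"
        by (rule powr_add[symmetric])
      also have "(1 - \<theta>) * \<theta> + \<theta> * (\<theta> - 1) = 0" by (simp add: algebra_simps)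
      finally show ?thesis using L by simp
    qed
    have c\<theta>: "exp 1 * c powr \<theta> \<le> 1 / 2"
    proof -
      have "c powr \<theta> \<le> (1 / 36) powr \<theta>" using c(2) c0 \<theta> by (intro powr_mono2) auto
      also have "\<dots> \<le> (1 / 36) powr (1 / 2)" using \<theta> by (intro powr_mono') auto
      also have "\<dots> = sqrt (1 / 36)" by (rule powr_half_sqrt) simp
      also have "\<dots> = 1 / 6" using real_sqrt_abs[of "1 / 6"] by (simp add: power2_eq_square)
      finally have "exp 1 * c powr \<theta> \<le> 3 * (1 / 6)" using exp_le by (intro mult_mono) auto
      then show ?thesis by simp
    qed
    have XD: "X * (1 + exp (2 * t * S)) \<le> 2 * c * D"
    proof -
      have "exp (2 * t * S) = real n powr (2 * c)"
        using n by (simp add: tS mult.assoc powr_def L_def)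
      also have "\<dots> \<le> real n powr (d / 2)" using c(1) n1 by (intro powr_mono) auto
      finally have e: "1 + exp (2 * t * S) \<le> 2 * real n powr (d / 2)"
        using ge_one_powr_ge_zero[OF n1, of "d / 2"] d by linarith
      have Xn: "X \<le> S * real n powr (- d)"
      proof -
        have "X = S * (real n powr (- \<delta>) * real n powr max 0 (\<theta> - recip q))"
          by (simp add: X_def r_def)
        also have "real n powr (- \<delta>) * real n powr max 0 (\<theta> - recip q) = real n powr (- \<delta> + max 0 (\<theta> - recip q))"
          by (rule powr_add[symmetric])
        also have "S * \<dots> \<le> S * real n powr (- d)"
          using pos n1 by (intro mult_left_mono powr_mono) (auto simp: \<delta>_def d_def max_def min_def)
        finally show ?thesis .
      qed
      have LL: "L powr (1 - \<theta>) * real n powr (- (d / 2)) \<le> D"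
      proof -
        have "L powr (1 - \<theta>) \<le> 1 + L"
        proof (cases "L \<le> 1")
          case True
          then have "L powr (1 - \<theta>) \<le> 1" using L \<theta> by (intro powr_le1) auto
          then show ?thesis using L by linarith
        next
          case False
          then have "L powr (1 - \<theta>) \<le> L powr 1" using \<theta> by (intro powr_mono) auto
          then show ?thesis using L by simp
        qed
        then have "L powr (1 - \<theta>) * real n powr (- (d / 2)) \<le> (1 + L) * real n powr (- (d / 2))"
          by (intro mult_right_mono) auto
        also have "\<dots> = real n powr (- (d / 2)) + L * real n powr (- (d / 2))" by (simp add: algebra_simps)
        also have "\<dots> \<le> 1 + 1 / (d / 2)"
        proof (intro add_mono Ld)
          have "real n powr (- (d / 2)) \<le> real n powr 0" using d n1 by (intro powr_mono) auto
          then show "real n powr (- (d / 2)) \<le> 1" using n by simp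
        qed (use d in simp)
        finally show ?thesis by (simp add: D_def)
      qed
      have "X * (1 + exp (2 * t * S)) \<le> (S * real n powr (- d)) * (2 * real n powr (d / 2))"
        using Xn e pos by (intro mult_mono) (auto intro: add_nonneg_nonneg)
      also have "\<dots> = 2 * c * (L powr (1 - \<theta>) * (real n powr (- d) * real n powr (d / 2)))"
        by (simp add: S_def)
      also have "real n powr (- d) * real n powr (d / 2) = real n powr (- (d / 2))"
        by (simp flip: powr_add)
      also have "2 * c * (L powr (1 - \<theta>) * real n powr (- (d / 2))) \<le> 2 * c * D"
        using c0 by (intro mult_left_mono LL) auto
      finally show ?thesis .
    qed
    define K where "K = 2 * c * D * exp 1"
    have K: "K * 2 \<le> 1 / 2"
    proof -
      have "0 < 8 * exp 1 * D" using D by simp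
      from c(3)[unfolded pos_le_divide_eq[OF this]] have "c * (8 * exp 1 * D) \<le> 1" .
      moreover have "K * 2 = c * (8 * exp 1 * D) / 2" by (simp add: K_def)
      ultimately show ?thesis by linarith
    qed
    have "bohr_ineq (ereal P) q n r"
    proof (rule bohr_ineq_if_homogeneous[where \<kappa> = "\<lambda>m. K * (1/2) ^ (m - 1)"])
      fix N
      have "(\<Sum>m=1..N. K * (1/2) ^ (m - 1)) = K * (\<Sum>m=1..N. (1/2) ^ (m - 1))"
        by (simp add: sum_distrib_left)
      also have "\<dots> \<le> K * 2"
        using c0 D by (intro mult_left_mono sum_half_powers_le) (auto simp: K_def)
      also note K
      finally show "(\<Sum>m=1..N. K * (1/2) ^ (m - 1)) \<le> 1 / 2" .
    next
      fix m b G u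
      assume m: "1 \<le> m"
        and G: "\<And>z. z \<in> lball (ereal P) n \<Longrightarrow> cmod (\<Sum>\<alpha>\<in>hom_indices n m. b \<alpha> * monomial n \<alpha> z) \<le> G"
        and u: "u \<in> lball q n"
      obtain M where M: "m = Suc M" using m by (cases m) auto
      have n0: "n > 0" using n by simp
      have G0: "G \<ge> 0" using order_trans[OF norm_ge_zero G[OF zero_in_lball]] n P by simp
      let ?x = "\<lambda>i. r * cmod (u i)"
      have x0: "0 \<le> ?x i" for i using pos by simp
      have xS: "(\<Sum>i<n. ?x i) \<le> S"
      proof -
        have "(\<Sum>i<n. cmod (u i) powr 1) \<le> real n powr (1 - 1 * recip q)"
          using q recip_le_1[OF q(1)] n u by (intro sum_powr_le_of_lball) auto
        then have "r * (\<Sum>i<n. cmod (u i)) \<le> r * real n powr \<delta>"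
          using pos by (simp add: \<delta>_def)
        also have "\<dots> = S" using n by (simp add: r_def powr_minus)
        finally show ?thesis by (simp add: sum_distrib_left)
      qed
      have tx: "t * ?x i \<le> 1 / 2" for i
      proof -
        have "cmod (u i) \<le> 1" by (rule norm_le_1_of_lball[OF q(1) n0 u])
        then have "r * cmod (u i) \<le> r * 1" by (rule mult_left_mono[OF _ less_imp_le[OF pos(2)]])
        then have "t * ?x i \<le> t * (r * 1)" by (rule mult_left_mono[OF _ less_imp_le[OF pos(3)]])
        also have "\<dots> = c * (L * real n powr (- \<delta>))" by (simp add: r_def tS mult.assoc[symmetric])
        also have "\<dots> \<le> c * (1 / \<delta>)" using c0 \<delta> by (intro mult_left_mono Ld) auto
        also have "c * (1 / \<delta>) \<le> 1 / 2"
        proof -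
          have "c \<le> 1 / 2 * \<delta>" using c(1) d by linarith
          then show ?thesis using \<delta> by (simp add: pos_divide_le_eq)
        qed
        finally show ?thesis .
      qed
      have "(\<Sum>\<alpha>\<in>hom_indices n (Suc M). cmod (b \<alpha>) * rmonomial n \<alpha> ?x)
        \<le> exp (real (Suc M)) * G * X * (\<Sum>\<beta>\<in>hom_indices n M. (fact M / index_fact n \<beta>) powr (1 / P) * rmonomial n \<beta> ?x)"
      proof (rule sum_norm_coeff_lball)
        have "?x i / X = cmod (u i) / real n powr max 0 (1 / P - recip q)" for i
          using pos by (simp add: X_def \<theta>_def)
        then show "(\<Sum>i<n. (?x i / X) powr P) \<le> 1"
          using scaled_point_in_lball[OF q(1) _ n0 u, of P] P by simp
        show "\<And>z. z \<in> lball (ereal P) n \<Longrightarrow> cmod (\<Sum>\<alpha>\<in>hom_indices n (Suc M). b \<alpha> * monomial n \<alpha> z) \<le> G"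
          using G unfolding M .
      qed (rule less_imp_le[OF P(1)], rule n0, rule pos(4), rule x0)
      also have "\<dots> \<le> exp (real (Suc M)) * G * X * ((S powr \<theta> * t powr (\<theta> - 1)) ^ M * (1 + exp (2 * t * S)))"
      proof (rule mult_left_mono)
        show "(\<Sum>\<beta>\<in>hom_indices n M. (fact M / index_fact n \<beta>) powr (1 / P) * rmonomial n \<beta> ?x)
            \<le> (S powr \<theta> * t powr (\<theta> - 1)) ^ M * (1 + exp (2 * t * S))"
          unfolding \<theta>_def[symmetric]
          using \<theta> by (intro sum_multinomial_powr_le[OF x0 xS pos(1,3) tx]) simp_all
        show "0 \<le> exp (real (Suc M)) * G * X" using G0 pos(4) by simp
      qed
      also have "\<dots> = exp (real (Suc M)) * G * (c powr \<theta>) ^ M * (X * (1 + exp (2 * t * S)))"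
        by (simp only: St mult_ac)
      also have "\<dots> \<le> exp (real (Suc M)) * G * (c powr \<theta>) ^ M * (2 * c * D)"
        using G0 by (intro mult_left_mono[OF XD]) simp
      also have "\<dots> = K * (exp 1 * c powr \<theta>) ^ M * G"
      proof -
        have "exp (real (Suc M)) = exp 1 * exp 1 ^ M" using exp_of_nat_mult[of "Suc M" "1::real"] by simp
        then show ?thesis by (simp only: K_def power_mult_distrib mult_ac)
      qed
      also have "\<dots> \<le> K * (1 / 2) ^ M * G"
      proof (rule mult_right_mono[OF mult_left_mono[OF power_mono[OF c\<theta>]] G0])
        show "0 \<le> K" using c0 D by (simp add: K_def)
      qed simp
      finally show "(\<Sum>\<alpha>\<in>hom_indices n m. cmod (b \<alpha>) * rmonomial n \<alpha> ?x) \<le> K * (1/2) ^ (m - 1) * G"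
        by (simp add: M)
    qed (use n P pos in simp_all)
    moreover have "r = c * (ln (real n) powr (1 - \<theta>) / real n powr \<delta>)"
      by (simp add: r_def S_def L_def powr_minus divide_inverse)
    ultimately show ?thesis by simp
  qed
  show ?thesis
    by (rule dominated_by_bohr_radius[OF _ q(1) c0 _ ineq[unfolded \<theta>_def \<delta>_def]]) (use P in simp_all)
qed


lemma recip_1 [simp]: "recip 1 = 1"
  by (simp add: recip_def)

lemma lower_bound_p_1:
  assumes q: "1 \<le> q"
  shows "(\<lambda>n. ln (real n) powr (1 - 1) / real n powr (1 - recip q)) \<lless> bohr_radius 1 q"
proof (rule dominated_by_bohr_radius[OF order_refl q, of "1 / 9"])
  fix n :: nat assume n: "n \<ge> 2"
  have "ln (real n) \<noteq> 0" using n by simp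
  then have "ln (real n) powr (1 - 1) / real n powr (1 - recip q) = real n powr (- (1 - recip q))"
    unfolding powr_minus_divide by simp
  then show "bohr_ineq 1 q n (1 / 9 * (ln (real n) powr (1 - 1) / real n powr (1 - recip q)))"
    using bohr_ineq_p_1[OF q n] by (simp only:)
qed simp_all

lemma lower_bound_q_1:
  assumes p: "1 \<le> p"
  shows "(\<lambda>n. 1) \<lless> bohr_radius p 1"
proof (rule dominated_by_bohr_radius[OF p order_refl, of "1 / 9"])
  fix n :: nat assume n: "n \<ge> 2"
  have "bohr_ineq 1 1 n (1 / 9 * real n powr (- (1 - recip 1)))" using n by (rule bohr_ineq_p_1[OF order_refl])
  then have "bohr_ineq 1 1 n (1 / 9 * 1)" using n by simp
  then show "bohr_ineq p 1 n (1 / 9 * 1)"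
    by (rule bohr_ineq_mono_p) (use n p in \<open>simp add: lball_1_subset\<close>)
qed simp_all

lemma lower_bound_constant:
  assumes "1 \<le> p" "1 \<le> q" "1/2 + recip p \<le> recip q"
  shows "(\<lambda>n. 1) \<lless> bohr_radius p q"
proof (rule dominated_by_bohr_radius[OF assms(1,2), of "1 / 3"])
  fix n :: nat assume n: "n \<ge> 2"
  then show "bohr_ineq p q n (1 / 3 * 1)" using bohr_ineq_constant[OF assms(1,2) _ assms(3), of n] by simp
qed simp_all

section \<open>Signs that make many sums small\<close>
lemma exp_add_exp_minus_le:
  fixes x :: real
  shows "exp x + exp (- x) \<le> 2 * exp (x\<^sup>2)"
proof -
  have main: "exp x + exp (- x) \<le> 2 * exp (x\<^sup>2)" if x: "0 \<le> x" for x :: real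
  proof (cases "x \<le> 1")
    case True
    have 1: "exp x \<le> 1 + x + x\<^sup>2" using exp_bound[OF x True] .
    have "exp (- x) \<le> 1 / (1 + x)"
      unfolding exp_minus' using x exp_ge_add_one_self[of x] by (intro divide_left_mono) auto
    also have "\<dots> \<le> 1 - x + x\<^sup>2"
    proof -
      have "(1 - x + x\<^sup>2) * (1 + x) = 1 + x ^ 3" by (simp add: algebra_simps power2_eq_square power3_eq_cube)
      then have "1 \<le> (1 - x + x\<^sup>2) * (1 + x)" using x by simp
      then show ?thesis using x by (simp add: pos_divide_le_eq)
    qed
    finally show ?thesis using 1 exp_ge_add_one_self[of "x\<^sup>2"] by linarith
  next
    case False
    then have "1 * x \<le> x * x" by (intro mult_right_mono) auto
    then have "exp x \<le> exp (x\<^sup>2)" by (simp add: power2_eq_square)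
    moreover have "exp (- x) \<le> exp x" using x by simp
    ultimately show ?thesis by linarith
  qed
  show ?thesis using main[of x] main[of "- x"] by (cases "0 \<le> x") auto
qed

text \<open>The signs are chosen one after the other. For each new element the two possible values of the
potential have the mean factor \<open>cosh (v s g) \<le> exp ((v s g)\<^sup>2)\<close>, so one of the two signs does not
exceed it.\<close>
lemma exists_balancing_signs:
  fixes v :: "'t \<Rightarrow> 'g \<Rightarrow> real" and c :: "'t \<Rightarrow> real"
  assumes "finite G" "finite T" "\<And>s. s \<in> T \<Longrightarrow> 0 \<le> c s"
  shows "\<exists>\<epsilon>. (\<forall>g. \<epsilon> g = 1 \<or> \<epsilon> g = -1) \<and>
     (\<Sum>s\<in>T. c s * exp (\<Sum>g\<in>G. \<epsilon> g * v s g)) \<le> (\<Sum>s\<in>T. c s * exp (\<Sum>g\<in>G. (v s g)\<^sup>2))"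
  using assms(1,3)
proof (induction G arbitrary: c rule: finite_induct)
  case empty
  show ?case by (rule exI[of _ "\<lambda>_. 1"]) simp
next
  case (insert g G)
  define E where "E s = exp (\<Sum>g\<in>G. (v s g)\<^sup>2)" for s
  define W where "W \<sigma> = (\<Sum>s\<in>T. c s * exp (\<sigma> * v s g) * E s)" for \<sigma> :: real
  have ext: "\<exists>\<epsilon>. (\<forall>g. \<epsilon> g = 1 \<or> \<epsilon> g = -1) \<and>
     (\<Sum>s\<in>T. c s * exp (\<Sum>g\<in>insert g G. \<epsilon> g * v s g)) \<le> W \<sigma>" if \<sigma>: "\<sigma> = 1 \<or> \<sigma> = -1" for \<sigma>
  proof -
    obtain \<epsilon> where \<epsilon>: "\<forall>g. \<epsilon> g = 1 \<or> \<epsilon> g = -1"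
        "(\<Sum>s\<in>T. (c s * exp (\<sigma> * v s g)) * exp (\<Sum>g\<in>G. \<epsilon> g * v s g)) \<le> W \<sigma>"
      using insert.IH[of "\<lambda>s. c s * exp (\<sigma> * v s g)"] insert.prems unfolding W_def E_def by auto
    have "(\<Sum>h\<in>insert g G. (\<epsilon>(g := \<sigma>)) h * v s h) = \<sigma> * v s g + (\<Sum>h\<in>G. \<epsilon> h * v s h)" for s
      using insert.hyps by (simp, intro sum.cong) auto
    then have "(\<Sum>s\<in>T. c s * exp (\<Sum>h\<in>insert g G. (\<epsilon>(g := \<sigma>)) h * v s h)) \<le> W \<sigma>"
      using \<epsilon>(2) by (simp only: exp_add mult.assoc)
    then show ?thesis using \<epsilon>(1) \<sigma> by (intro exI[of _ "\<epsilon>(g := \<sigma>)"]) auto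
  qed
  let ?R = "\<Sum>s\<in>T. c s * exp (\<Sum>g\<in>insert g G. (v s g)\<^sup>2)"
  have "W 1 + W (-1) = (\<Sum>s\<in>T. c s * E s * (exp (v s g) + exp (- v s g)))"
    by (simp add: W_def sum.distrib[symmetric] algebra_simps)
  also have "\<dots> \<le> (\<Sum>s\<in>T. c s * E s * (2 * exp ((v s g)\<^sup>2)))"
    using insert.prems by (intro sum_mono mult_left_mono exp_add_exp_minus_le) (auto simp: E_def)
  also have "\<dots> = 2 * ?R"
    using insert.hyps by (simp add: E_def exp_add sum_distrib_left mult_ac)
  finally have "W 1 \<le> ?R \<or> W (-1) \<le> ?R" by linarith
  then show ?case using ext[of 1] ext[of "-1"] by (meson order_trans)
qed

text \<open>The potential is taken over all vectors, multiplied by the four units \<open>\<plusminus>1\<close> and \<open>\<plusminus>\<i>\<close>: a bound for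
the real parts of the multiples bounds the modulus. With exponent one in the
potential the bound is the logarithm of the number of vectors; optimising the exponent would replace
it by its square root, a difference of no importance when powers of \<open>n\<close> may be lost.\<close>
lemma exists_signs_all_small:
  fixes v :: "'t \<Rightarrow> 'g \<Rightarrow> complex"
  assumes G: "finite G" and T: "finite T" and v: "\<And>t. t \<in> T \<Longrightarrow> (\<Sum>g\<in>G. (cmod (v t g))\<^sup>2) \<le> 1"
  obtains \<epsilon> :: "'g \<Rightarrow> real" where "\<And>g. \<epsilon> g = 1 \<or> \<epsilon> g = -1"
    "\<And>t. t \<in> T \<Longrightarrow> cmod (\<Sum>g\<in>G. of_real (\<epsilon> g) * v t g) \<le> 2 * (ln (4 * real (card T)) + 1)"
proof -
  let ?Ph = "{1, -1, \<i>, -\<i>}"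
  let ?S = "T \<times> ?Ph"
  have cardPh: "card ?Ph \<le> 4" by (simp add: card_insert_if)
  obtain \<epsilon> :: "'g \<Rightarrow> real" where \<epsilon>: "\<And>g. \<epsilon> g = 1 \<or> \<epsilon> g = -1"
    and le: "(\<Sum>s\<in>?S. 1 * exp (\<Sum>g\<in>G. \<epsilon> g * Re (snd s * v (fst s) g)))
         \<le> (\<Sum>s\<in>?S. 1 * exp (\<Sum>g\<in>G. (Re (snd s * v (fst s) g))\<^sup>2))"
    using exists_balancing_signs[of G ?S "\<lambda>_. 1" "\<lambda>s g. Re (snd s * v (fst s) g)"] G T by auto
  have "(\<Sum>s\<in>?S. 1 * exp (\<Sum>g\<in>G. (Re (snd s * v (fst s) g))\<^sup>2)) \<le> (\<Sum>s\<in>?S. exp 1)"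
  proof (rule sum_mono)
    fix s assume s: "s \<in> ?S"
    have "(\<Sum>g\<in>G. (Re (snd s * v (fst s) g))\<^sup>2) \<le> (\<Sum>g\<in>G. (cmod (v (fst s) g))\<^sup>2)"
    proof (rule sum_mono)
      fix g
      have "\<bar>Re (snd s * v (fst s) g)\<bar> \<le> cmod (snd s * v (fst s) g)" by (rule abs_Re_le_cmod)
      also have "\<dots> = cmod (v (fst s) g)" using s by (auto simp: norm_mult)
      finally have "\<bar>Re (snd s * v (fst s) g)\<bar>\<^sup>2 \<le> (cmod (v (fst s) g))\<^sup>2" by (rule power_mono) simp
      then show "(Re (snd s * v (fst s) g))\<^sup>2 \<le> (cmod (v (fst s) g))\<^sup>2" by simp
    qed
    also have "\<dots> \<le> 1" using s by (intro v) auto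
    finally show "1 * exp (\<Sum>g\<in>G. (Re (snd s * v (fst s) g))\<^sup>2) \<le> exp 1" by simp
  qed
  also have "\<dots> = real (card T) * real (card ?Ph) * exp 1" by (simp add: card_cartesian_product)
  also have "\<dots> \<le> real (card T) * 4 * exp 1"
    using cardPh by (intro mult_right_mono mult_left_mono) auto
  finally have tot: "(\<Sum>s\<in>?S. exp (\<Sum>g\<in>G. \<epsilon> g * Re (snd s * v (fst s) g))) \<le> 4 * real (card T) * exp 1"
    using le by simp
  show ?thesis
  proof (rule that[OF \<epsilon>])
    fix t assume t: "t \<in> T"
    define X where "X = (\<Sum>g\<in>G. of_real (\<epsilon> g) * v t g)"
    have cT: "real (card T) > 0" using T t by (auto simp: card_gt_0_iff)
    have R: "Re (ph * X) \<le> ln (4 * real (card T)) + 1" if ph: "ph \<in> ?Ph" for ph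
    proof -
      have "exp (\<Sum>g\<in>G. \<epsilon> g * Re (snd (t, ph) * v (fst (t, ph)) g))
          \<le> (\<Sum>s\<in>?S. exp (\<Sum>g\<in>G. \<epsilon> g * Re (snd s * v (fst s) g)))"
        using t ph T by (intro member_le_sum[of "(t, ph)"]) auto
      also note tot
      also have "4 * real (card T) * exp 1 = exp (ln (4 * real (card T)) + 1)"
        using cT by (simp add: exp_add)
      finally have "(\<Sum>g\<in>G. \<epsilon> g * Re (ph * v t g)) \<le> ln (4 * real (card T)) + 1" by simp
      moreover have "Re (ph * X) = (\<Sum>g\<in>G. \<epsilon> g * Re (ph * v t g))"
        unfolding X_def sum_distrib_left Re_sum by (intro sum.cong refl) (simp add: algebra_simps)
      ultimately show ?thesis by simp
    qed
    have "cmod X \<le> \<bar>Re X\<bar> + \<bar>Im X\<bar>" by (rule cmod_le)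
    then show "cmod X \<le> 2 * (ln (4 * real (card T)) + 1)"
      using R[of 1] R[of "-1"] R[of \<i>] R[of "-\<i>"] by simp
  qed
qed

section \<open>Polynomials that are flat on the Euclidean ball\<close>
definition lattice_disc :: "nat \<Rightarrow> complex set" where
  "lattice_disc K = (\<lambda>(a, b). Complex (of_int a / real K) (of_int b / real K)) ` ({- int K..int K} \<times> {- int K..int K})"

lemma finite_lattice_disc [simp]: "finite (lattice_disc K)"
  by (simp add: lattice_disc_def)

lemma card_lattice_disc: "card (lattice_disc K) \<le> (2 * K + 1)\<^sup>2"
proof -
  have "card (lattice_disc K) \<le> card ({- int K..int K} \<times> {- int K..int K})"
    unfolding lattice_disc_def by (rule card_image_le) simp
  also have "\<dots> = (2 * K + 1)\<^sup>2"
    by (simp add: card_cartesian_product power2_eq_square nat_add_distrib nat_mult_distrib algebra_simps)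
  finally show ?thesis .
qed

lemma round_towards_zero:
  assumes K: "K > 0" and x: "\<bar>x\<bar> \<le> 1"
  obtains a where "a \<in> {- int K..int K}" "\<bar>of_int a / real K\<bar> \<le> \<bar>x\<bar>" "\<bar>x - of_int a / real K\<bar> \<le> 1 / real K"
proof -
  have main: "\<exists>a. 0 \<le> a \<and> a \<le> int K \<and> of_int a / real K \<le> y \<and> y - of_int a / real K \<le> 1 / real K"
    if y: "0 \<le> y" "y \<le> 1" for y
  proof (intro exI[of _ "\<lfloor>y * real K\<rfloor>"] conjI)
    have K': "real K > 0" using K by simp
    show "0 \<le> \<lfloor>y * real K\<rfloor>" using y K by simp
    have "y * real K \<le> 1 * real K" using y K by (intro mult_right_mono) auto
    then have "of_int \<lfloor>y * real K\<rfloor> \<le> real K" using of_int_floor_le[of "y * real K"] by linarith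
    then show "\<lfloor>y * real K\<rfloor> \<le> int K" by linarith
    show "of_int \<lfloor>y * real K\<rfloor> / real K \<le> y"
      unfolding pos_divide_le_eq[OF K'] by (rule of_int_floor_le)
    have "y * real K - of_int \<lfloor>y * real K\<rfloor> \<le> 1" by linarith
    then have "(y * real K - of_int \<lfloor>y * real K\<rfloor>) / real K \<le> 1 / real K" using K' by (intro divide_right_mono) auto
    then show "y - of_int \<lfloor>y * real K\<rfloor> / real K \<le> 1 / real K" using K' by (simp add: diff_divide_distrib)
  qed
  obtain a where a: "0 \<le> a" "a \<le> int K" "of_int a / real K \<le> \<bar>x\<bar>" "\<bar>x\<bar> - of_int a / real K \<le> 1 / real K"
    using main[of "\<bar>x\<bar>"] x by auto
  have a0: "0 \<le> of_int a / real K" using a by simp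
  show ?thesis
  proof (cases "0 \<le> x")
    case True
    show ?thesis using a a0 True by (intro that[of a]) auto
  next
    case False
    show ?thesis using a a0 False by (intro that[of "- a"]) auto
  qed
qed

text \<open>Rounding towards zero keeps the approximation inside every solid set, in particular inside the
Euclidean ball.\<close>
lemma lattice_disc_approximation:
  assumes K: "K > 0" and w: "cmod w \<le> 1"
  obtains d where "d \<in> lattice_disc K" "cmod d \<le> cmod w" "cmod (w - d) \<le> 2 / real K"
proof -
  have "\<bar>Re w\<bar> \<le> 1" "\<bar>Im w\<bar> \<le> 1"
    using abs_Re_le_cmod[of w] abs_Im_le_cmod[of w] w by linarith+
  then obtain a b where a: "a \<in> {- int K..int K}" "\<bar>of_int a / real K\<bar> \<le> \<bar>Re w\<bar>" "\<bar>Re w - of_int a / real K\<bar> \<le> 1 / real K"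
    and b: "b \<in> {- int K..int K}" "\<bar>of_int b / real K\<bar> \<le> \<bar>Im w\<bar>" "\<bar>Im w - of_int b / real K\<bar> \<le> 1 / real K"
    using round_towards_zero[OF K] by metis
  let ?d = "Complex (of_int a / real K) (of_int b / real K)"
  show ?thesis
  proof (rule that)
    show "?d \<in> lattice_disc K" 
      using a(1) b(1) unfolding lattice_disc_def by (intro image_eqI[of _ _ "(a, b)"]) auto
    show "cmod ?d \<le> cmod w"
      unfolding cmod_def using a(2) b(2)
      by (intro real_sqrt_le_mono add_mono) (auto simp: abs_le_square_iff[symmetric])
    have "cmod (w - ?d) \<le> \<bar>Re (w - ?d)\<bar> + \<bar>Im (w - ?d)\<bar>" by (rule cmod_le)
    also have "\<dots> \<le> 1 / real K + 1 / real K"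
      unfolding minus_complex.sel complex.sel by (intro add_mono a b)
    finally show "cmod (w - ?d) \<le> 2 / real K" by simp
  qed
qed

lemma norm_monomial_diff_le:
  assumes \<gamma>: "\<gamma> \<in> hom_indices n M"
    and "\<And>i. i < n \<Longrightarrow> cmod (w i) \<le> 1" "\<And>i. i < n \<Longrightarrow> cmod (u i) \<le> 1" "\<And>i. i < n \<Longrightarrow> cmod (w i - u i) \<le> \<delta>"
  shows "cmod (monomial n \<gamma> w - monomial n \<gamma> u) \<le> real M * \<delta>"
proof -
  have "cmod (monomial n \<gamma> w - monomial n \<gamma> u) \<le> (\<Sum>i<n. cmod (w i ^ \<gamma> i - u i ^ \<gamma> i))"
    unfolding monomial_def using assms by (intro norm_prod_diff) (auto simp: norm_power power_le_one)
  also have "\<dots> \<le> (\<Sum>i<n. real (\<gamma> i) * \<delta>)"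
  proof (rule sum_mono)
    fix i assume "i \<in> {..<n}"
    then have "cmod (w i ^ \<gamma> i - u i ^ \<gamma> i) \<le> real (\<gamma> i) * cmod (w i - u i)"
      using assms by (intro norm_power_diff) auto
    also have "\<dots> \<le> real (\<gamma> i) * \<delta>" using assms(4) \<open>i \<in> {..<n}\<close> by (intro mult_left_mono) auto
    finally show "cmod (w i ^ \<gamma> i - u i ^ \<gamma> i) \<le> real (\<gamma> i) * \<delta>" .
  qed
  also have "\<dots> = real M * \<delta>"
    using \<gamma> by (simp add: hom_indices_def flip: sum_distrib_right of_nat_sum)
  finally show ?thesis .
qed

lemma sum_multinomial_coeff: "(\<Sum>\<gamma>\<in>hom_indices n M. fact M / index_fact n \<gamma>) = real n ^ M"
  using multinomial_theorem[of M n "\<lambda>_. 1"] by (simp add: rmonomial_def)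

lemma sum_hom_indices_above:
  fixes \<phi> :: "(nat \<Rightarrow> nat) \<Rightarrow> 'a::comm_monoid_add"
  assumes \<beta>: "\<beta> \<in> hom_indices n k"
  shows "(\<Sum>\<gamma>\<in>hom_indices n M. \<phi> (\<lambda>i. \<beta> i + \<gamma> i))
       = (\<Sum>\<alpha>\<in>{\<alpha> \<in> hom_indices n (k + M). \<forall>i. \<beta> i \<le> \<alpha> i}. \<phi> \<alpha>)"
proof (rule sum.reindex_bij_witness[where i = "\<lambda>\<alpha> i. \<alpha> i - \<beta> i" and j = "\<lambda>\<gamma> i. \<beta> i + \<gamma> i"])
  fix \<alpha> assume a: "\<alpha> \<in> {\<alpha> \<in> hom_indices n (k + M). \<forall>i. \<beta> i \<le> \<alpha> i}"
  then show "(\<lambda>i. \<beta> i + (\<alpha> i - \<beta> i)) = \<alpha>" by auto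
  have "(\<Sum>i<n. \<alpha> i - \<beta> i) = (\<Sum>i<n. \<alpha> i) - (\<Sum>i<n. \<beta> i)"
    using a by (intro sum_subtractf_nat) auto
  then show "(\<lambda>i. \<alpha> i - \<beta> i) \<in> hom_indices n M"
    using a \<beta> by (auto simp: hom_indices_def multiindices_def)
qed (use \<beta> in \<open>auto simp: hom_indices_def multiindices_def sum.distrib\<close>)

text \<open>The variance of the signed polynomial. One of the two factors \<open>M! / \<gamma>!\<close> is bounded by \<open>M!\<close>, the other one
is summed by the multinomial theorem.\<close>
lemma sum_multinomial_square_le:
  assumes "(\<Sum>i<n. (cmod (u i))\<^sup>2) \<le> 1"
  shows "(\<Sum>\<gamma>\<in>hom_indices n M. (fact M / index_fact n \<gamma> * cmod (monomial n \<gamma> u))\<^sup>2) \<le> fact M"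
proof -
  have "(\<Sum>\<gamma>\<in>hom_indices n M. (fact M / index_fact n \<gamma> * cmod (monomial n \<gamma> u))\<^sup>2)
      \<le> (\<Sum>\<gamma>\<in>hom_indices n M. fact M * (fact M / index_fact n \<gamma> * rmonomial n \<gamma> (\<lambda>i. (cmod (u i))\<^sup>2)))"
  proof (rule sum_mono)
    fix \<gamma> assume "\<gamma> \<in> hom_indices n M"
    have sq: "rmonomial n \<gamma> (\<lambda>i. (cmod (u i))\<^sup>2) = (cmod (monomial n \<gamma> u))\<^sup>2"
      unfolding norm_monomial by (simp add: rmonomial_def prod_power_distrib mult.commute flip: power_mult)
    have "1 \<le> index_fact n \<gamma>" unfolding index_fact_def by (intro prod_ge_1) auto
    then have K: "fact M / index_fact n \<gamma> \<le> fact M / 1"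
      by (intro divide_left_mono) auto
    have "(fact M / index_fact n \<gamma>) * (fact M / index_fact n \<gamma>) \<le> fact M * (fact M / index_fact n \<gamma>)"
      using K index_fact_pos[of n \<gamma>] by (intro mult_right_mono) auto
    then have "(fact M / index_fact n \<gamma>) * (fact M / index_fact n \<gamma>) * (cmod (monomial n \<gamma> u))\<^sup>2
        \<le> fact M * (fact M / index_fact n \<gamma>) * (cmod (monomial n \<gamma> u))\<^sup>2"
      by (rule mult_right_mono) simp
    then show "(fact M / index_fact n \<gamma> * cmod (monomial n \<gamma> u))\<^sup>2
        \<le> fact M * (fact M / index_fact n \<gamma> * rmonomial n \<gamma> (\<lambda>i. (cmod (u i))\<^sup>2))"
      unfolding sq power_mult_distrib power2_eq_square[of "fact M / index_fact n \<gamma>"] by (simp only: mult.assoc)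
  qed
  also have "\<dots> = fact M * (\<Sum>i<n. (cmod (u i))\<^sup>2) ^ M"
    by (simp only: sum_distrib_left[symmetric] multinomial_theorem)
  also have "\<dots> \<le> fact M * 1 ^ M"
    using assms by (intro mult_left_mono power_mono) (auto intro: sum_nonneg)
  finally show ?thesis by simp
qed

text \<open>As \<open>n \<le> e\<^sup>m\<close>, the logarithm of the size of the net is at most \<open>n\<close> times a polynomial in \<open>m\<close>, hence
exponential in \<open>m\<close>.\<close>
lemma net_size_bound:
  assumes n: "n \<ge> 1" "real n \<le> exp (real m)" and m: "m \<ge> 1" and K: "K = 2 * m * n ^ m"
    and T: "T > 0" "real T \<le> real (((m + 1) * (2 * K + 1)\<^sup>2) ^ n)"
  shows "2 * (ln (4 * real T) + 1) + 1 \<le> exp (7 * real m)"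
proof -
  define x where "x = real m"
  have x1: "x \<ge> 1" using m by (simp add: x_def)
  have xe: "x + 1 \<le> exp x" using exp_ge_add_one_self[of x] by linarith
  have n1: "real n \<ge> 1" using n by simp
  have nm: "real n ^ m \<le> exp (x\<^sup>2)"
  proof -
    have "real n ^ m \<le> exp x ^ m" using n by (intro power_mono) (auto simp: x_def)
    also have "\<dots> = exp (x * x)" by (simp add: exp_of_nat_mult[symmetric] x_def)
    finally show ?thesis by (simp add: power2_eq_square)
  qed
  have K1: "2 * real K + 1 \<le> exp (5 * x + x\<^sup>2)"
  proof -
    have "1 \<le> real n ^ m" using n1 by (rule one_le_power)
    then have "1 * 1 \<le> x * real n ^ m" by (rule mult_mono[OF x1]) (use x1 in linarith, simp)
    moreover have "2 * real K = 4 * (x * real n ^ m)" by (simp add: K x_def)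
    ultimately have "2 * real K + 1 \<le> 5 * x * real n ^ m" by linarith
    also have "5 * x \<le> exp (5 * x)" using exp_ge_add_one_self[of "5 * x"] by linarith
    then have "5 * x * real n ^ m \<le> exp (5 * x) * exp (x\<^sup>2)"
      using nm by (intro mult_mono) auto
    finally show ?thesis by (simp add: exp_add)
  qed
  have "ln (4 * real T) \<le> ln (4 * ((x + 1) * (2 * real K + 1)\<^sup>2) ^ n)"
  proof (rule ln_mono)
    have "real (((m + 1) * (2 * K + 1)\<^sup>2) ^ n) = ((x + 1) * (2 * real K + 1)\<^sup>2) ^ n"
      by (simp only: of_nat_power of_nat_mult of_nat_add of_nat_1 of_nat_numeral x_def)
    then show "4 * real T \<le> 4 * ((x + 1) * (2 * real K + 1)\<^sup>2) ^ n" using T(2) by simp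
  qed (use T in simp)
  also have "\<dots> \<le> ln (exp 3 * (exp x * (exp (5 * x + x\<^sup>2))\<^sup>2) ^ n)"
  proof (rule ln_mono)
    show "4 * ((x + 1) * (2 * real K + 1)\<^sup>2) ^ n \<le> exp 3 * (exp x * (exp (5 * x + x\<^sup>2))\<^sup>2) ^ n"
      using K1 xe x1 exp_ge_add_one_self[of 3] by (intro mult_mono power_mono) auto
    show "0 < 4 * ((x + 1) * (2 * real K + 1)\<^sup>2) ^ n" using x1 by (intro mult_pos_pos zero_less_power) auto
  qed
  also have "\<dots> = 3 + real n * (11 * x + 2 * x\<^sup>2)"
  proof -
    have "exp x * (exp (5 * x + x\<^sup>2))\<^sup>2 = exp (x + 2 * (5 * x + x\<^sup>2))"
      by (simp only: exp_double exp_add)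
    also have "x + 2 * (5 * x + x\<^sup>2) = 11 * x + 2 * x\<^sup>2" by (simp add: algebra_simps)
    finally have "exp 3 * (exp x * (exp (5 * x + x\<^sup>2))\<^sup>2) ^ n = exp (3 + real n * (11 * x + 2 * x\<^sup>2))"
      by (simp only: exp_of_nat_mult exp_add)
    then show ?thesis by (simp only: ln_exp)
  qed
  also have "\<dots> \<le> 16 * (real n * x\<^sup>2)"
  proof -
    have "1 * x \<le> x * x" using x1 by (intro mult_right_mono) linarith+
    then have xx: "x \<le> x\<^sup>2" "1 \<le> x\<^sup>2" unfolding power2_eq_square using x1 by linarith+
    then have "11 * x + 2 * x\<^sup>2 \<le> 13 * x\<^sup>2" by linarith
    then have "real n * (11 * x + 2 * x\<^sup>2) \<le> real n * (13 * x\<^sup>2)" by (intro mult_left_mono) auto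
    moreover have "1 * 1 \<le> real n * x\<^sup>2" by (rule mult_mono[OF n1 xx(2)]) simp_all
    moreover have "real n * (13 * x\<^sup>2) = 13 * (real n * x\<^sup>2)" by simp
    ultimately show ?thesis by linarith
  qed
  finally have l: "ln (4 * real T) \<le> 16 * (real n * x\<^sup>2)" .
  have "real n * x\<^sup>2 \<le> exp x * (2 * exp x)"
  proof (rule mult_mono)
    show "real n \<le> exp x" using n by (simp add: x_def)
    have "1 + x + x\<^sup>2 / 2 \<le> exp x" using x1 by (intro exp_lower_Taylor_quadratic) auto
    then show "x\<^sup>2 \<le> 2 * exp x" using x1 by simp
  qed auto
  moreover have "exp x * (2 * exp x) = 2 * exp (2 * x)"
    by (simp only: exp_double power2_eq_square mult.left_commute)
  ultimately have b: "real n * x\<^sup>2 \<le> 2 * exp (2 * x)" by linarith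
  have e2: "exp (2 * x) \<ge> 1" using x1 by simp
  have "2 * (ln (4 * real T) + 1) + 1 \<le> 67 * exp (2 * x)"
  proof -
    have "2 * (a + 1) + 1 \<le> 67 * e" if "a \<le> 16 * b" "b \<le> 2 * e" "1 \<le> e" for a b e :: real
    proof -
      have "16 * b \<le> 32 * e" using that(2) by simp
      then have "a \<le> 32 * e" using that(1) by (rule order_trans[rotated])
      then show ?thesis using that(3) by simp
    qed
    from this[OF l b e2] show ?thesis .
  qed
  also have "\<dots> \<le> exp (5 * x) * exp (2 * x)"
  proof (rule mult_right_mono)
    have "(67::real) \<le> 2.5 ^ 5" by (simp add: power_divide)
    also have "\<dots> \<le> exp 1 ^ 5"
      using exp_lower_Taylor_quadratic[of 1] by (intro power_mono) auto
    also have "\<dots> = exp (5::real)" using exp_of_nat_mult[of 5 "1::real"] by simp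
    also have "\<dots> \<le> exp (5 * x)" using x1 by simp
    finally show "67 \<le> exp (5 * x)" .
  qed simp
  also have "\<dots> = exp (7 * x)" by (simp flip: exp_add)
  finally show ?thesis by (simp add: x_def)
qed

text \<open>The balancing signs are applied to all slices at all points of a lattice net of the ball
simultaneously, each slice divided by \<open>sqrt (M!)\<close> so that its variance is at most \<open>1\<close>. The mesh of the net is so fine that the
trivial Lipschitz bound passes from the net to the ball. The slices of \<open>\<Sum> \<plusminus> m!/\<alpha>! z\<^sup>\<alpha>\<close> are included
because points of the \<open>p\<close>-ball with \<open>p < 2\<close> will be split into two parts.\<close>
lemma exists_flat_signs:
  assumes n: "n \<ge> 1" "real n \<le> exp (real m)" and m: "m \<ge> 1"
  obtains \<epsilon> :: "(nat \<Rightarrow> nat) \<Rightarrow> real" where "\<And>\<alpha>. \<epsilon> \<alpha> = 1 \<or> \<epsilon> \<alpha> = -1"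
    "\<And>\<beta> k M w. \<beta> \<in> hom_indices n k \<Longrightarrow> k + M = m \<Longrightarrow> (\<Sum>i<n. (cmod (w i))\<^sup>2) \<le> 1 \<Longrightarrow>
       cmod (\<Sum>\<gamma>\<in>hom_indices n M. of_real (\<epsilon> (\<lambda>i. \<beta> i + \<gamma> i) * (fact M / index_fact n \<gamma>)) * monomial n \<gamma> w)
         \<le> exp (7 * real m) * sqrt (fact M)"
proof -
  \<comment> \<open>a lattice so fine that rounding to it changes no slice by more than \<open>1\<close>\<close>
  define K where "K = 2 * m * n ^ m"
  have K: "K > 0" using n m by (simp add: K_def)
  define U where "U = {u \<in> choices n (\<lambda>_. lattice_disc K). (\<Sum>i<n. (cmod (u i))\<^sup>2) \<le> 1}"
  define T where "T = low_indices n m \<times> U"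
  define deg where "deg \<beta> = (\<Sum>i<n. \<beta> i)" for \<beta> :: "nat \<Rightarrow> nat"
  define q where "q \<beta> u \<gamma> = of_real (fact (m - deg \<beta>) / index_fact n \<gamma>) * monomial n \<gamma> u / of_real (sqrt (fact (m - deg \<beta>)))"
    for \<beta> u \<gamma>
  \<comment> \<open>the normalised slice at \<open>\<beta>\<close>, indexed by all \<open>\<alpha>\<close> of degree \<open>m\<close> and zero unless \<open>\<alpha>\<close> exceeds \<open>\<beta>\<close>\<close>
  define v where "v t \<alpha> = (if \<forall>i. fst t i \<le> \<alpha> i then q (fst t) (snd t) (\<lambda>i. \<alpha> i - fst t i) else 0)" for t \<alpha>
  have finC: "finite (choices n (\<lambda>_. lattice_disc K))" by (simp add: finite_choices)
  have finU: "finite U" using finC by (simp add: U_def)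
  have finT: "finite T" using finU by (simp add: T_def)
  have degk: "deg \<beta> = k" if "\<beta> \<in> hom_indices n k" for \<beta> k using that by (simp add: deg_def hom_indices_def)
  have vsum: "(\<Sum>\<alpha>\<in>hom_indices n m. f \<alpha> (v (\<beta>, u) \<alpha>)) = (\<Sum>\<gamma>\<in>hom_indices n (m - k). f (\<lambda>i. \<beta> i + \<gamma> i) (q \<beta> u \<gamma>))"
    if \<beta>: "\<beta> \<in> hom_indices n k" and k: "k \<le> m" and f: "\<And>\<alpha>. f \<alpha> 0 = 0"
    for f :: "_ \<Rightarrow> complex \<Rightarrow> 'z::comm_monoid_add" and \<beta> k u
  proof -
    have "(\<Sum>\<gamma>\<in>hom_indices n (m - k). f (\<lambda>i. \<beta> i + \<gamma> i) (q \<beta> u \<gamma>))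
        = (\<Sum>\<gamma>\<in>hom_indices n (m - k). (\<lambda>\<alpha>. f \<alpha> (v (\<beta>, u) \<alpha>)) (\<lambda>i. \<beta> i + \<gamma> i))"
      by (simp add: v_def)
    also have "\<dots> = (\<Sum>\<alpha>\<in>{\<alpha> \<in> hom_indices n (k + (m - k)). \<forall>i. \<beta> i \<le> \<alpha> i}. f \<alpha> (v (\<beta>, u) \<alpha>))"
      by (rule sum_hom_indices_above[OF \<beta>])
    also have "\<dots> = (\<Sum>\<alpha>\<in>hom_indices n m. f \<alpha> (v (\<beta>, u) \<alpha>))"
      using k f by (intro sum.mono_neutral_left) (auto simp: v_def)
    finally show ?thesis by simp
  qed
  have var: "(\<Sum>\<alpha>\<in>hom_indices n m. (cmod (v t \<alpha>))\<^sup>2) \<le> 1" if t: "t \<in> T" for t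
  proof -
    obtain \<beta> u k where t: "t = (\<beta>, u)" "k \<le> m" "\<beta> \<in> hom_indices n k" and u: "u \<in> U"
      using t by (auto simp: T_def low_indices_def)
    have "(\<Sum>\<alpha>\<in>hom_indices n m. (cmod (v t \<alpha>))\<^sup>2) = (\<Sum>\<gamma>\<in>hom_indices n (m - k). (cmod (q \<beta> u \<gamma>))\<^sup>2)"
      unfolding t(1) by (rule vsum[OF t(3,2)]) simp
    also have "\<dots> = (\<Sum>\<gamma>\<in>hom_indices n (m - k). (fact (m - k) / index_fact n \<gamma> * cmod (monomial n \<gamma> u))\<^sup>2) / fact (m - k)"
      unfolding sum_divide_distrib
    proof (rule sum.cong[OF refl])
      fix \<gamma>
      have "cmod (q \<beta> u \<gamma>) = fact (m - k) / index_fact n \<gamma> * cmod (monomial n \<gamma> u) / sqrt (fact (m - k))"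
        unfolding q_def degk[OF t(3)] norm_divide norm_mult norm_of_real
        using index_fact_pos[of n \<gamma>] by simp
      then show "(cmod (q \<beta> u \<gamma>))\<^sup>2 = (fact (m - k) / index_fact n \<gamma> * cmod (monomial n \<gamma> u))\<^sup>2 / fact (m - k)"
        by (simp only: power_divide real_sqrt_pow2[OF fact_ge_zero])
    qed
    also have "\<dots> \<le> 1"
      using sum_multinomial_square_le[of u n "m - k"] u by (simp add: U_def)
    finally show ?thesis .
  qed
  obtain \<epsilon> :: "(nat \<Rightarrow> nat) \<Rightarrow> real" where \<epsilon>: "\<And>\<alpha>. \<epsilon> \<alpha> = 1 \<or> \<epsilon> \<alpha> = -1"
    and small: "\<And>t. t \<in> T \<Longrightarrow> cmod (\<Sum>\<alpha>\<in>hom_indices n m. of_real (\<epsilon> \<alpha>) * v t \<alpha>) \<le> 2 * (ln (4 * real (card T)) + 1)"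
    using exists_signs_all_small[where v = v and T = T and G = "hom_indices n m", OF finite_hom_indices finT var] by blast
  \<comment> \<open>one more unit is kept for the error of the net\<close>
  define E where "E = 2 * (ln (4 * real (card T)) + 1)"
  have E: "E + 1 \<le> exp (7 * real m)"
    unfolding E_def
  proof (rule net_size_bound[OF n m K_def])
    have "0 \<in> lattice_disc K"
      unfolding lattice_disc_def by (rule image_eqI[of _ _ "(0, 0)"]) (auto simp: zero_complex.code)
    then have "((\<lambda>_. 0), (\<lambda>_. 0)) \<in> T"
      by (auto simp: T_def U_def choices_def low_indices_def hom_indices_0 intro: bexI[of _ 0])
    then show "card T > 0" using finT by (auto simp: card_gt_0_iff)
    have "card (low_indices n m) \<le> card (choices n (\<lambda>_. {..m}))"
      using finite_choices[of n "\<lambda>_. {..m}"] hom_indices_subset_choices[of n]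
      by (intro card_mono) (auto simp: low_indices_def choices_def subset_iff intro: order_trans)
    also have "\<dots> = (m + 1) ^ n" by (simp add: card_choices)
    finally have "card (low_indices n m) \<le> (m + 1) ^ n" .
    moreover have "card U \<le> ((2 * K + 1)\<^sup>2) ^ n"
    proof -
      have "card U \<le> card (choices n (\<lambda>_. lattice_disc K))" using finC by (intro card_mono) (auto simp: U_def)
      also have "\<dots> = card (lattice_disc K) ^ n" by (simp add: card_choices)
      also have "\<dots> \<le> ((2 * K + 1)\<^sup>2) ^ n" by (intro power_mono card_lattice_disc) auto
      finally show ?thesis .
    qed
    ultimately have "card T \<le> ((m + 1) * (2 * K + 1)\<^sup>2) ^ n"
      unfolding T_def card_cartesian_product power_mult_distrib[of "m + 1"] by (rule mult_le_mono)
    then show "real (card T) \<le> real (((m + 1) * (2 * K + 1)\<^sup>2) ^ n)" by (simp only: of_nat_le_iff)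
  qed
  show ?thesis
  proof (rule that[OF \<epsilon>])
    fix \<beta> k M w
    assume \<beta>: "\<beta> \<in> hom_indices n k" and kM: "k + M = m" and w: "(\<Sum>i<n. (cmod (w i))\<^sup>2) \<le> 1"
    have M: "M = m - k" "k \<le> m" using kM by auto
    define Q where "Q z = (\<Sum>\<gamma>\<in>hom_indices n M. of_real (\<epsilon> (\<lambda>i. \<beta> i + \<gamma> i) * (fact M / index_fact n \<gamma>)) * monomial n \<gamma> z)" for z
    have w1: "cmod (w i) \<le> 1" if "i < n" for i
    proof -
      have "(cmod (w i))\<^sup>2 \<le> (\<Sum>i<n. (cmod (w i))\<^sup>2)" using that by (intro member_le_sum) auto
      then have "(cmod (w i))\<^sup>2 \<le> 1\<^sup>2" using w by simp
      then show ?thesis by (rule power2_le_imp_le) simp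
    qed
    have "\<forall>i\<in>{..<n}. \<exists>d. d \<in> lattice_disc K \<and> cmod d \<le> cmod (w i) \<and> cmod (w i - d) \<le> 2 / real K"
      using lattice_disc_approximation[OF K] w1 by (metis lessThan_iff)
    then obtain d where d: "\<And>i. i < n \<Longrightarrow> d i \<in> lattice_disc K \<and> cmod (d i) \<le> cmod (w i) \<and> cmod (w i - d i) \<le> 2 / real K"
      by (metis lessThan_iff)
    define u where "u i = (if i < n then d i else 0)" for i
    have "(\<Sum>i<n. (cmod (u i))\<^sup>2) \<le> (\<Sum>i<n. (cmod (w i))\<^sup>2)"
      using d by (intro sum_mono power_mono) (auto simp: u_def)
    then have u: "u \<in> U" using w d by (auto simp: U_def choices_def u_def)
    have t: "(\<beta>, u) \<in> T" using u \<beta> M(2) by (auto simp: T_def low_indices_def)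
    have Qu: "cmod (Q u) \<le> E * sqrt (fact M)"
    proof -
      have "(\<Sum>\<alpha>\<in>hom_indices n m. of_real (\<epsilon> \<alpha>) * v (\<beta>, u) \<alpha>) = (\<Sum>\<gamma>\<in>hom_indices n M. of_real (\<epsilon> (\<lambda>i. \<beta> i + \<gamma> i)) * q \<beta> u \<gamma>)"
        unfolding M(1) by (rule vsum[OF \<beta> M(2)]) simp
      also have "\<dots> = Q u / of_real (sqrt (fact M))"
        unfolding Q_def q_def degk[OF \<beta>] M(1)[symmetric] sum_divide_distrib
        by (intro sum.cong refl) simp
      finally have "cmod (Q u / of_real (sqrt (fact M))) \<le> E" using small[OF t] by (simp add: E_def)
      then have "cmod (Q u) / sqrt (fact M) \<le> E" by (simp add: norm_divide)
      then show ?thesis by (simp add: pos_divide_le_eq)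
    qed
    have "cmod (Q w - Q u) \<le> (\<Sum>\<gamma>\<in>hom_indices n M. fact M / index_fact n \<gamma> * (real M * (2 / real K)))"
      unfolding Q_def sum_subtractf[symmetric] right_diff_distrib[symmetric]
    proof (rule sum_norm_le)
      fix \<gamma> assume \<gamma>: "\<gamma> \<in> hom_indices n M"
      have "cmod (of_real (\<epsilon> (\<lambda>i. \<beta> i + \<gamma> i) * (fact M / index_fact n \<gamma>))) = fact M / index_fact n \<gamma>"
        unfolding norm_of_real abs_mult using \<epsilon>[of "\<lambda>i. \<beta> i + \<gamma> i"] index_fact_pos[of n \<gamma>] by auto
      moreover have "cmod (monomial n \<gamma> w - monomial n \<gamma> u) \<le> real M * (2 / real K)"
        using w1 d by (intro norm_monomial_diff_le[OF \<gamma>]) (auto simp: u_def intro: order_trans)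
      ultimately show "cmod (of_real (\<epsilon> (\<lambda>i. \<beta> i + \<gamma> i) * (fact M / index_fact n \<gamma>)) * (monomial n \<gamma> w - monomial n \<gamma> u))
          \<le> fact M / index_fact n \<gamma> * (real M * (2 / real K))"
        unfolding norm_mult using index_fact_pos[of n \<gamma>] by (simp only:) (intro mult_left_mono, auto)
    qed
    also have "\<dots> = real n ^ M * (real M * (2 / real K))"
      by (simp only: sum_distrib_right[symmetric] sum_multinomial_coeff)
    also have "\<dots> \<le> real n ^ m * (real m * (2 / real K))"
      using n M by (intro mult_mono power_increasing) auto
    also have "\<dots> = 1" using n m by (simp add: K_def)
    finally have "cmod (Q w - Q u) \<le> 1 * sqrt (fact M)"
      using order_trans[of _ 1 "sqrt (fact M)"] by simp
    then have "cmod (Q w) \<le> (E + 1) * sqrt (fact M)"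
      using Qu norm_triangle_ineq[of "Q w - Q u" "Q u"] by (simp add: distrib_right)
    also have "\<dots> \<le> exp (7 * real m) * sqrt (fact M)" using E by (intro mult_right_mono) auto
    finally show "cmod (\<Sum>\<gamma>\<in>hom_indices n M. of_real (\<epsilon> (\<lambda>i. \<beta> i + \<gamma> i) * (fact M / index_fact n \<gamma>)) * monomial n \<gamma> w)
         \<le> exp (7 * real m) * sqrt (fact M)" by (simp only: Q_def)
  qed
qed

section \<open>Upper bounds\<close>
lemma bohr_ineq_signed_test:
  assumes r: "bohr_ineq p q n r" "r \<ge> 0" and p: "1 \<le> p" "1 \<le> q" and n: "n > 0" and m: "m \<ge> 1"
    and \<epsilon>: "\<And>\<alpha>. \<epsilon> \<alpha> = 1 \<or> \<epsilon> \<alpha> = (-1::real)" and B: "B \<ge> 0"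
    and le: "\<And>z. z \<in> lball p n \<Longrightarrow>
      cmod (\<Sum>\<alpha>\<in>hom_indices n m. of_real (\<epsilon> \<alpha> * (fact m / index_fact n \<alpha>)) * monomial n \<alpha> z) \<le> B ^ m"
  shows "r \<le> B / real n powr (1 - recip q)"
proof -
  \<comment> \<open>the common coordinate of the test point, which has \<open>q\<close>-norm \<open>1\<close>\<close>
  define s where "s = real n powr (- recip q)"
  define u where "u = (\<lambda>i. if i < n then complex_of_real s else 0)"
  have s: "s > 0" using n by (simp add: s_def)
  have nu: "cmod (u i) = s" if "i < n" for i using that s by (simp add: u_def)
  have u: "u \<in> lball q n"
    using p(2)
  proof (cases q rule: ge1_ereal_cases)
    case infty
    then have "s = 1" using n by (simp add: s_def)
    then show ?thesis using infty n by (auto simp: lball_infty_iff u_def cspace_def)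
  next
    case (real Q)
    have "s powr Q = real n powr (- 1)" using real by (simp add: s_def powr_powr)
    then have "s powr Q = 1 / real n" using n by (simp add: powr_minus_divide)
    then have "(\<Sum>i<n. cmod (u i) powr Q) = 1" using n by (simp add: nu)
    then show ?thesis using real by (auto simp: lball_real_iff u_def cspace_def)
  qed
  have "r ^ m * (\<Sum>\<alpha>\<in>hom_indices n m. cmod (of_real (\<epsilon> \<alpha> * (fact m / index_fact n \<alpha>))) * rmonomial n \<alpha> (\<lambda>i. cmod (u i))) \<le> B ^ m"
    by (rule bohr_ineq_homogeneous[OF r p(1) n le u])
  also have "(\<Sum>\<alpha>\<in>hom_indices n m. cmod (of_real (\<epsilon> \<alpha> * (fact m / index_fact n \<alpha>))) * rmonomial n \<alpha> (\<lambda>i. cmod (u i)))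
      = (\<Sum>\<alpha>\<in>hom_indices n m. fact m / index_fact n \<alpha> * rmonomial n \<alpha> (\<lambda>i. cmod (u i)))"
  proof (rule sum.cong[OF refl])
    fix \<alpha>
    have "cmod (of_real (\<epsilon> \<alpha> * (fact m / index_fact n \<alpha>))) = fact m / index_fact n \<alpha>"
      unfolding norm_of_real abs_mult using \<epsilon>[of \<alpha>] index_fact_pos[of n \<alpha>] by auto
    then show "cmod (of_real (\<epsilon> \<alpha> * (fact m / index_fact n \<alpha>))) * rmonomial n \<alpha> (\<lambda>i. cmod (u i))
        = fact m / index_fact n \<alpha> * rmonomial n \<alpha> (\<lambda>i. cmod (u i))" by (simp only:)
  qed
  also have "\<dots> = (\<Sum>i<n. cmod (u i)) ^ m" by (rule multinomial_theorem)
  also have "(\<Sum>i<n. cmod (u i)) = real n * s" by (simp add: nu)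
  also have "\<dots> = real n powr (1 - recip q)"
    using n by (simp add: s_def powr_diff powr_minus divide_inverse)
  finally have "(r * real n powr (1 - recip q)) ^ m \<le> B ^ m" by (simp only: power_mult_distrib)
  then have "r * real n powr (1 - recip q) \<le> B"
    using m B by (metis power_mono_iff r(2) mult_nonneg_nonneg powr_ge_zero zero_less_one less_le_trans)
  then show ?thesis using n by (simp add: pos_le_divide_eq)
qed

lemma sqrt_fact_le: "sqrt (fact M) \<le> sqrt (real M) ^ M"
proof -
  have "(fact M :: real) \<le> real M ^ M" using fact_le_power[where 'a = real, of M] by simp
  then have "sqrt (fact M) \<le> sqrt (real M ^ M)" by (rule real_sqrt_le_mono)
  then show ?thesis by (simp add: real_sqrt_power)
qed

text \<open>The degree of the test polynomials is \<open>ln n\<close> rounded up. Rounding at most doubles it since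
\<open>ln 2 \<ge> 1/2\<close>.\<close>
lemma ceiling_ln_properties:
  assumes "n \<ge> 2"
  obtains m where "m \<ge> 1" "real n \<le> exp (real m)" "real m \<le> 2 * ln (real n)"
proof
  define m where "m = nat \<lceil>ln (real n)\<rceil>"
  have "exp (1 / 2) \<le> (2::real)"
  proof -
    have "exp (1 / 2) * exp (1 / 2) \<le> (3::real)" using exp_le by (simp flip: exp_add)
    then have "exp (1 / 2) * exp (1 / 2) \<le> (2::real) * 2" by linarith
    then have "(exp (1 / 2))\<^sup>2 \<le> (2::real)\<^sup>2" by (simp only: power2_eq_square)
    then show ?thesis by (rule power2_le_imp_le) simp
  qed
  then have "exp (1 / 2) \<le> real n" using assms by linarith
  then have l: "1 / 2 \<le> ln (real n)" using assms by (subst ln_ge_iff) auto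
  have mreal: "real m = of_int \<lceil>ln (real n)\<rceil>" using l by (simp add: m_def)
  then show "real m \<le> 2 * ln (real n)"
  proof (cases "ln (real n) \<le> 1")
    case True
    then have "\<lceil>ln (real n)\<rceil> \<le> 1" by (simp add: ceiling_le_iff)
    then have "real m \<le> 1" using mreal by simp
    then show ?thesis using l by linarith
  next
    case False
    have "real m \<le> ln (real n) + 1" using mreal ceiling_correct[of "ln (real n)"] by linarith
    then show ?thesis using False by linarith
  qed
  have ge: "ln (real n) \<le> real m" using mreal le_of_int_ceiling[of "ln (real n)"] by simp
  then show "m \<ge> 1" using l by (cases m) auto
  have "real n = exp (ln (real n))" using assms by simp
  also have "\<dots> \<le> exp (real m)" using ge by simp
  finally show "real n \<le> exp (real m)" .
qed

lemma bohr_radius_dominated: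
  assumes p: "1 \<le> p" "1 \<le> q" and C: "C > 0"
    and le: "\<And>n r. n \<ge> 2 \<Longrightarrow> r \<ge> 0 \<Longrightarrow> bohr_ineq p q n r \<Longrightarrow> r \<le> C * b n"
  shows "bohr_radius p q \<lless> b"
  unfolding dominated_def
proof (intro exI conjI allI impI)
  fix n :: nat assume n: "2 \<le> n"
  then have n0: "n > 0" by simp
  show "bohr_radius p q n \<le> C * b n"
    by (rule le[OF n bohr_radius_greatest(1,2)[OF p n0]])
qed (rule C)

lemma upper_bound_constant:
  assumes "1 \<le> p" "1 \<le> q"
  shows "bohr_radius p q \<lless> (\<lambda>n. 1)"
proof (rule bohr_radius_dominated[OF assms, of 1])
  fix n r assume "2 \<le> (n::nat)" "r \<ge> 0" "bohr_ineq p q n r"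
  then show "r \<le> 1 * 1" using bohr_ineq_le_1[of p q n r] assms by simp
qed simp

text \<open>For \<open>p \<ge> 2\<close> the \<open>p\<close>-ball is contained in \<open>\<rho> = n\<^bsup>1/2 - 1/p\<^esup>\<close> times the Euclidean ball, where the signed
polynomial is at most \<open>e\<^sup>7\<^sup>m sqrt (m!)\<close>.\<close>
lemma upper_bound_large_p:
  assumes p: "2 \<le> p" "1 \<le> q"
  shows "bohr_radius p q \<lless> (\<lambda>n. sqrt (ln (real n)) / real n powr (1/2 + recip p - recip q))"
proof -
  have p1: "1 \<le> p" using p(1) by (rule order_trans[rotated]) simp
  show ?thesis
  proof (rule bohr_radius_dominated[OF p1 p(2), of "exp 7 * sqrt 2"])
    fix n r assume n: "2 \<le> (n::nat)" and r: "r \<ge> 0" "bohr_ineq p q n r"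
    obtain m where m: "m \<ge> 1" "real n \<le> exp (real m)" "real m \<le> 2 * ln (real n)"
      using ceiling_ln_properties[OF n] .
    have n1: "n \<ge> 1" "n > 0" using n by auto
    obtain \<epsilon> :: "(nat \<Rightarrow> nat) \<Rightarrow> real" where \<epsilon>: "\<And>\<alpha>. \<epsilon> \<alpha> = 1 \<or> \<epsilon> \<alpha> = -1"
      and flat: "\<And>\<beta> k M w. \<beta> \<in> hom_indices n k \<Longrightarrow> k + M = m \<Longrightarrow> (\<Sum>i<n. (cmod (w i))\<^sup>2) \<le> 1 \<Longrightarrow>
       cmod (\<Sum>\<gamma>\<in>hom_indices n M. of_real (\<epsilon> (\<lambda>i. \<beta> i + \<gamma> i) * (fact M / index_fact n \<gamma>)) * monomial n \<gamma> w)
         \<le> exp (7 * real m) * sqrt (fact M)"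
      using exists_flat_signs[OF n1(1) m(2,1)] by blast
    define h where "h = 1 / 2 - recip p"
    define \<rho> where "\<rho> = real n powr h"
    have \<rho>: "\<rho> > 0" using n1 by (simp add: \<rho>_def)
    have "r \<le> (\<rho> * (exp 7 * sqrt (real m))) / real n powr (1 - recip q)"
    proof (rule bohr_ineq_signed_test[OF r(2,1) p1 p(2) n1(2) m(1) \<epsilon>])
      fix z assume z: "z \<in> lball p n"
      define w where "w = (\<lambda>i. z i / of_real \<rho>)"
      have zw: "z = (\<lambda>i. of_real \<rho> * w i)" using \<rho> by (simp add: w_def)
      have "(\<Sum>i<n. (cmod (w i))\<^sup>2) = (\<Sum>i<n. cmod (z i) powr 2) / \<rho>\<^sup>2"
        using \<rho> by (simp add: w_def norm_divide power_divide sum_divide_distrib)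
      also have "\<dots> \<le> 1"
      proof -
        have "(\<Sum>i<n. cmod (z i) powr 2) \<le> real n powr (1 - 2 * recip p)"
          using recip_le_half[OF p(1)] by (intro sum_powr_le_of_lball[OF p1 _ _ n1(2) z]) linarith+
        also have "1 - 2 * recip p = h + h" by (simp add: h_def)
        also have "real n powr (h + h) = \<rho>\<^sup>2" by (simp only: powr_add \<rho>_def power2_eq_square)
        finally show ?thesis using \<rho> by (simp add: pos_divide_le_eq)
      qed
      finally have w: "(\<Sum>i<n. (cmod (w i))\<^sup>2) \<le> 1" .
      have z0: "(\<lambda>_. 0) \<in> hom_indices n 0" by (simp add: hom_indices_0)
      let ?c = "\<lambda>\<alpha>. complex_of_real (\<epsilon> \<alpha> * (fact m / index_fact n \<alpha>))"
      have "(\<Sum>\<alpha>\<in>hom_indices n m. ?c \<alpha> * monomial n \<alpha> z)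
          = of_real \<rho> ^ m * (\<Sum>\<alpha>\<in>hom_indices n m. ?c \<alpha> * monomial n \<alpha> w)"
        unfolding sum_distrib_left
        by (subst zw, intro sum.cong refl) (simp only: monomial_scale[of _ n m] mult.left_commute)
      then have "cmod (\<Sum>\<alpha>\<in>hom_indices n m. ?c \<alpha> * monomial n \<alpha> z)
          = \<rho> ^ m * cmod (\<Sum>\<alpha>\<in>hom_indices n m. ?c \<alpha> * monomial n \<alpha> w)"
        using \<rho> by (simp only: norm_mult norm_power norm_of_real abs_of_pos)
      also have "\<dots> \<le> \<rho> ^ m * (exp (7 * real m) * sqrt (fact m))"
        using flat[OF z0 _ w, of m] \<rho> by (intro mult_left_mono) simp_all
      also have "\<dots> \<le> \<rho> ^ m * (exp 7 ^ m * sqrt (real m) ^ m)"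
      proof (intro mult_left_mono mult_mono)
        show "exp (7 * real m) \<le> exp 7 ^ m" by (simp add: exp_of_nat_mult[symmetric] mult.commute)
        show "sqrt (fact m) \<le> sqrt (real m) ^ m" by (rule sqrt_fact_le)
      qed (use \<rho> in simp_all)
      finally show "cmod (\<Sum>\<alpha>\<in>hom_indices n m. ?c \<alpha> * monomial n \<alpha> z) \<le> (\<rho> * (exp 7 * sqrt (real m))) ^ m"
        by (simp only: power_mult_distrib)
    qed (use \<rho> in simp)
    also have "\<dots> \<le> (\<rho> * (exp 7 * sqrt (2 * ln (real n)))) / real n powr (1 - recip q)"
      using m(3) \<rho> by (intro divide_right_mono mult_left_mono real_sqrt_le_mono) simp_all
    also have "\<dots> = exp 7 * sqrt 2 * (sqrt (ln (real n)) * (\<rho> / real n powr (1 - recip q)))"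
      by (simp add: real_sqrt_mult)
    also have "\<rho> / real n powr (1 - recip q) = real n powr (h - (1 - recip q))"
      unfolding \<rho>_def by (rule powr_diff[symmetric])
    also have "h - (1 - recip q) = - (1/2 + recip p - recip q)" by (simp add: h_def)
    also have "sqrt (ln (real n)) * real n powr (- (1/2 + recip p - recip q))
        = sqrt (ln (real n)) / real n powr (1/2 + recip p - recip q)"
      by (simp only: powr_minus divide_inverse)
    finally show "r \<le> exp 7 * sqrt 2 * (sqrt (ln (real n)) / real n powr (1/2 + recip p - recip q))" .
  qed simp
qed

text \<open>A multi-index splits uniquely into a part supported on \<open>A\<close> and a part supported off \<open>A\<close>.\<close>
lemma sum_split_support:
  fixes \<phi> :: "(nat \<Rightarrow> nat) \<Rightarrow> 'a::comm_monoid_add"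
  assumes A: "A \<subseteq> {..<n}"
  shows "(\<Sum>\<alpha>\<in>hom_indices n m. \<phi> \<alpha>) =
    (\<Sum>k\<le>m. \<Sum>\<beta>\<in>{\<beta> \<in> hom_indices n k. \<forall>i. i \<notin> A \<longrightarrow> \<beta> i = 0}.
       \<Sum>\<gamma>\<in>{\<gamma> \<in> hom_indices n (m - k). \<forall>i\<in>A. \<gamma> i = 0}. \<phi> (\<lambda>i. \<beta> i + \<gamma> i))"
proof -
  define S where "S = (SIGMA k:{..m}. {\<beta> \<in> hom_indices n k. \<forall>i. i \<notin> A \<longrightarrow> \<beta> i = 0} \<times>
      {\<gamma> \<in> hom_indices n (m - k). \<forall>i\<in>A. \<gamma> i = 0})"
  have "(\<Sum>\<alpha>\<in>hom_indices n m. \<phi> \<alpha>) = (\<Sum>(k, \<beta>, \<gamma>)\<in>S. \<phi> (\<lambda>i. \<beta> i + \<gamma> i))"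
  proof (rule sum.reindex_bij_witness[where
      j = "\<lambda>\<alpha>. (\<Sum>i<n. if i \<in> A then \<alpha> i else 0, \<lambda>i. if i \<in> A then \<alpha> i else 0, \<lambda>i. if i \<in> A then 0 else \<alpha> i)"
      and i = "\<lambda>(k, \<beta>, \<gamma>) i. \<beta> i + \<gamma> i"], goal_cases)
    case (2 \<alpha>)
    have *: "(\<Sum>i<n. if i \<in> A then \<alpha> i else 0) + (\<Sum>i<n. if i \<in> A then 0 else \<alpha> i) = (\<Sum>i<n. \<alpha> i)"
      unfolding sum.distrib[symmetric] by (intro sum.cong) auto
    then show ?case using 2 by (auto simp: S_def hom_indices_def multiindices_def)
  next
    case (3 s)
    obtain k \<beta> \<gamma> where s: "s = (k, \<beta>, \<gamma>)" by (cases s)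
    have b: "\<beta> \<in> hom_indices n k" "\<And>i. i \<notin> A \<Longrightarrow> \<beta> i = 0" "\<And>i. i \<in> A \<Longrightarrow> \<gamma> i = 0"
      using 3 by (auto simp: s S_def)
    then have 1: "(\<lambda>i. if i \<in> A then \<beta> i + \<gamma> i else 0) = \<beta>" "(\<lambda>i. if i \<in> A then 0 else \<beta> i + \<gamma> i) = \<gamma>"
      by (auto simp: fun_eq_iff)
    have "(\<Sum>i<n. if i \<in> A then \<beta> i + \<gamma> i else 0) = k"
      using b(1) by (simp only: fun_cong[OF 1(1)]) (simp add: hom_indices_def)
    then show ?case unfolding s prod.case by (simp add: 1)
  next
    case (4 s)
    then show ?case by (auto simp: S_def hom_indices_def multiindices_def sum.distrib)
  next
    case (1 \<alpha>)
    show ?case unfolding prod.case by (simp add: fun_eq_iff)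
  next
    case (5 \<alpha>)
    have "(\<lambda>i. (if i \<in> A then \<alpha> i else 0) + (if i \<in> A then 0 else \<alpha> i)) = \<alpha>" by (simp add: fun_eq_iff)
    then show ?case unfolding prod.case by (rule arg_cong)
  qed
  also have "\<dots> = (\<Sum>k\<le>m. \<Sum>\<beta>\<in>{\<beta> \<in> hom_indices n k. \<forall>i. i \<notin> A \<longrightarrow> \<beta> i = 0}.
       \<Sum>\<gamma>\<in>{\<gamma> \<in> hom_indices n (m - k). \<forall>i\<in>A. \<gamma> i = 0}. \<phi> (\<lambda>i. \<beta> i + \<gamma> i))"
    unfolding S_def sum.cartesian_product
    by (subst sum.Sigma) (simp_all add: case_prod_unfold)
  finally show ?thesis .
qed

lemma index_fact_add_disjoint:
  assumes "\<And>i. i \<notin> A \<Longrightarrow> \<beta> i = 0" "\<And>i. i \<in> A \<Longrightarrow> \<gamma> i = 0"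
  shows "index_fact n (\<lambda>i. \<beta> i + \<gamma> i) = index_fact n \<beta> * index_fact n \<gamma>"
  unfolding index_fact_def prod.distrib[symmetric]
proof (rule prod.cong[OF refl])
  fix i show "fact (\<beta> i + \<gamma> i) = fact (\<beta> i) * (fact (\<gamma> i) :: real)"
    using assms[of i] by (cases "i \<in> A") simp_all
qed

text \<open>Expanding in the coordinates in \<open>A\<close>, the coefficient of \<open>z\<^sup>\<beta>\<close> is a multiple of the slice at \<open>\<beta>\<close> evaluated at
the other coordinates. In degree \<open>k\<close> the sum over \<open>\<beta>\<close> is a multinomial sum \<open>\<rho>\<^sup>k\<close>, the slices give
\<open>sqrt ((m - k)!) \<sigma>\<^bsup>m - k\<^esup>\<close>, and the remaining weights are binomial coefficients.\<close>
lemma norm_split_polynomial_le: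
  assumes A: "A \<subseteq> {..<n}"
    and \<rho>: "(\<Sum>i\<in>A. cmod (z i)) \<le> \<rho>" "\<rho> \<ge> 0"
    and \<sigma>: "(\<Sum>i\<in>{..<n} - A. (cmod (z i))\<^sup>2) \<le> \<sigma>\<^sup>2" "\<sigma> > 0"
    and E: "E \<ge> 0"
    and flat: "\<And>\<beta> k M w. \<beta> \<in> hom_indices n k \<Longrightarrow> k + M = m \<Longrightarrow> (\<Sum>i<n. (cmod (w i))\<^sup>2) \<le> 1 \<Longrightarrow>
       cmod (\<Sum>\<gamma>\<in>hom_indices n M. of_real (\<epsilon> (\<lambda>i. \<beta> i + \<gamma> i) * (fact M / index_fact n \<gamma>)) * monomial n \<gamma> w)
         \<le> E * sqrt (fact M)"
  shows "cmod (\<Sum>\<alpha>\<in>hom_indices n m. of_real (\<epsilon> \<alpha> * (fact m / index_fact n \<alpha>)) * monomial n \<alpha> z)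
       \<le> E * (\<rho> + sqrt (real m) * \<sigma>) ^ m"
proof -
  define x where "x = (\<lambda>i. if i \<in> A then z i else 0)"
  define w where "w = (\<lambda>i. if i \<in> A then 0 else z i / of_real \<sigma>)"
  let ?B = "\<lambda>k. {\<beta> \<in> hom_indices n k. \<forall>i. i \<notin> A \<longrightarrow> \<beta> i = 0}"
  let ?C = "\<lambda>k. {\<gamma> \<in> hom_indices n (m - k). \<forall>i\<in>A. \<gamma> i = 0}"
  define Q :: "(nat \<Rightarrow> nat) \<Rightarrow> nat \<Rightarrow> complex" where "Q \<beta> M = (\<Sum>\<gamma>\<in>hom_indices n M. of_real (\<epsilon> (\<lambda>i. \<beta> i + \<gamma> i) * (fact M / index_fact n \<gamma>)) * monomial n \<gamma> w)" for \<beta> M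
  have w1: "(\<Sum>i<n. (cmod (w i))\<^sup>2) \<le> 1"
  proof -
    have "(\<Sum>i<n. (cmod (w i))\<^sup>2) = (\<Sum>i\<in>{..<n} - A. (cmod (w i))\<^sup>2)"
      by (rule sum.mono_neutral_right) (auto simp: w_def)
    also have "\<dots> = (\<Sum>i\<in>{..<n} - A. (cmod (z i))\<^sup>2) / \<sigma>\<^sup>2"
      unfolding sum_divide_distrib
      by (intro sum.cong refl) (simp add: w_def norm_divide power_divide)
    also have "\<dots> \<le> 1" using \<sigma> by (simp add: pos_divide_le_eq)
    finally show ?thesis .
  qed
  have inner: "(\<Sum>\<gamma>\<in>?C k. of_real (\<epsilon> (\<lambda>i. \<beta> i + \<gamma> i) * (fact m / index_fact n (\<lambda>i. \<beta> i + \<gamma> i))) * monomial n (\<lambda>i. \<beta> i + \<gamma> i) z)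
      = of_real (real (m choose k) * \<sigma> ^ (m - k) * (fact k / index_fact n \<beta>)) * monomial n \<beta> x * Q \<beta> (m - k)"
    if k: "k \<le> m" and \<beta>: "\<beta> \<in> ?B k" for k \<beta>
  proof -
    have "real (fact k * fact (m - k) * (m choose k)) = real (fact m)"
      by (simp only: binomial_fact_lemma[OF k])
    then have fm: "fact m = real (m choose k) * fact k * fact (m - k)"
      unfolding of_nat_mult of_nat_fact by (metis mult.assoc mult.commute)
    have "(\<Sum>\<gamma>\<in>?C k. of_real (\<epsilon> (\<lambda>i. \<beta> i + \<gamma> i) * (fact m / index_fact n (\<lambda>i. \<beta> i + \<gamma> i))) * monomial n (\<lambda>i. \<beta> i + \<gamma> i) z)
      = (\<Sum>\<gamma>\<in>?C k. of_real (real (m choose k) * \<sigma> ^ (m - k) * (fact k / index_fact n \<beta>)) * monomial n \<beta> x *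
          (of_real (\<epsilon> (\<lambda>i. \<beta> i + \<gamma> i) * (fact (m - k) / index_fact n \<gamma>)) * monomial n \<gamma> w))"
    proof (rule sum.cong[OF refl])
      fix \<gamma> assume \<gamma>: "\<gamma> \<in> ?C k"
      have f: "index_fact n (\<lambda>i. \<beta> i + \<gamma> i) = index_fact n \<beta> * index_fact n \<gamma>"
        using \<beta> \<gamma> by (intro index_fact_add_disjoint[of A]) auto
      have mb: "monomial n \<beta> z = monomial n \<beta> x"
        unfolding monomial_def using \<beta> by (intro prod.cong refl) (auto simp: x_def)
      have mg: "monomial n \<gamma> z = of_real \<sigma> ^ (m - k) * monomial n \<gamma> w"
      proof -
        have "monomial n \<gamma> z = monomial n \<gamma> (\<lambda>i. of_real \<sigma> * w i)"
          unfolding monomial_def using \<gamma> \<sigma>(2) by (intro prod.cong refl) (auto simp: w_def)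
        then show ?thesis using \<gamma> monomial_scale[of \<gamma> n "m - k"] by simp
      qed
      have c: "fact m / (index_fact n \<beta> * index_fact n \<gamma>)
          = real (m choose k) * (fact k / index_fact n \<beta>) * (fact (m - k) / index_fact n \<gamma>)"
        by (simp add: fm)
      show "of_real (\<epsilon> (\<lambda>i. \<beta> i + \<gamma> i) * (fact m / index_fact n (\<lambda>i. \<beta> i + \<gamma> i))) * monomial n (\<lambda>i. \<beta> i + \<gamma> i) z
        = of_real (real (m choose k) * \<sigma> ^ (m - k) * (fact k / index_fact n \<beta>)) * monomial n \<beta> x *
          (of_real (\<epsilon> (\<lambda>i. \<beta> i + \<gamma> i) * (fact (m - k) / index_fact n \<gamma>)) * monomial n \<gamma> w)"
        unfolding monomial_add mb mg f c of_real_mult of_real_power by (simp only: mult_ac)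
    qed
    also have "\<dots> = of_real (real (m choose k) * \<sigma> ^ (m - k) * (fact k / index_fact n \<beta>)) * monomial n \<beta> x *
        (\<Sum>\<gamma>\<in>?C k. of_real (\<epsilon> (\<lambda>i. \<beta> i + \<gamma> i) * (fact (m - k) / index_fact n \<gamma>)) * monomial n \<gamma> w)"
      by (rule sum_distrib_left[symmetric])
    also have "(\<Sum>\<gamma>\<in>?C k. of_real (\<epsilon> (\<lambda>i. \<beta> i + \<gamma> i) * (fact (m - k) / index_fact n \<gamma>)) * monomial n \<gamma> w) = Q \<beta> (m - k)"
      unfolding Q_def
    proof (rule sum.mono_neutral_left)
      show "\<forall>\<gamma>\<in>hom_indices n (m - k) - ?C k. of_real (\<epsilon> (\<lambda>i. \<beta> i + \<gamma> i) * (fact (m - k) / index_fact n \<gamma>)) * monomial n \<gamma> w = 0"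
      proof
        fix \<gamma> assume "\<gamma> \<in> hom_indices n (m - k) - ?C k"
        then obtain i where i: "i \<in> A" "\<gamma> i \<noteq> 0" by auto
        then have "monomial n \<gamma> w = 0"
          unfolding monomial_def using A by (intro prod_zero) (auto simp: w_def intro!: bexI[of _ i])
        then show "of_real (\<epsilon> (\<lambda>i. \<beta> i + \<gamma> i) * (fact (m - k) / index_fact n \<gamma>)) * monomial n \<gamma> w = 0"
          by (simp only: mult_zero_right)
      qed
    qed auto
    finally show ?thesis .
  qed
  have "cmod (\<Sum>\<alpha>\<in>hom_indices n m. of_real (\<epsilon> \<alpha> * (fact m / index_fact n \<alpha>)) * monomial n \<alpha> z)
      = cmod (\<Sum>k\<le>m. \<Sum>\<beta>\<in>?B k. of_real (real (m choose k) * \<sigma> ^ (m - k) * (fact k / index_fact n \<beta>)) * monomial n \<beta> x * Q \<beta> (m - k))"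
    unfolding sum_split_support[OF A] by (intro arg_cong[where f = cmod] sum.cong refl inner) auto
  also have "\<dots> \<le> (\<Sum>k\<le>m. \<Sum>\<beta>\<in>?B k. real (m choose k) * \<sigma> ^ (m - k) * (fact k / index_fact n \<beta>) *
      rmonomial n \<beta> (\<lambda>i. cmod (x i)) * (E * sqrt (fact (m - k))))"
  proof (intro sum_norm_le)
    fix k \<beta> assume k: "k \<in> {..m}" and \<beta>: "\<beta> \<in> ?B k"
    have h1: "cmod (Q \<beta> (m - k)) \<le> E * sqrt (fact (m - k))"
      unfolding Q_def using k \<beta> by (intro flat[OF _ _ w1]) auto
    have h0: "0 \<le> real (m choose k) * \<sigma> ^ (m - k) * (fact k / index_fact n \<beta>)"
      using \<sigma>(2) index_fact_pos[of n \<beta>] by simp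
    show "cmod (of_real (real (m choose k) * \<sigma> ^ (m - k) * (fact k / index_fact n \<beta>)) * monomial n \<beta> x * Q \<beta> (m - k))
       \<le> real (m choose k) * \<sigma> ^ (m - k) * (fact k / index_fact n \<beta>) * rmonomial n \<beta> (\<lambda>i. cmod (x i)) * (E * sqrt (fact (m - k)))"
      unfolding norm_mult norm_monomial norm_of_real abs_of_nonneg[OF h0]
      by (rule mult_left_mono[OF h1 mult_nonneg_nonneg[OF h0 rmonomial_nonneg]]) simp
  qed
  also have "\<dots> \<le> (\<Sum>k\<le>m. E * (real (m choose k) * \<rho> ^ k * (sqrt (real m) * \<sigma>) ^ (m - k)))"
  proof (rule sum_mono)
    fix k assume k: "k \<in> {..m}"
    have nn: "0 \<le> fact k / index_fact n \<beta> * rmonomial n \<beta> (\<lambda>i. cmod (x i))" for \<beta>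
      by (rule mult_nonneg_nonneg[OF divide_nonneg_pos[OF fact_ge_zero index_fact_pos] rmonomial_nonneg]) simp
    have sB: "(\<Sum>\<beta>\<in>?B k. fact k / index_fact n \<beta> * rmonomial n \<beta> (\<lambda>i. cmod (x i))) \<le> \<rho> ^ k"
    proof -
      have "(\<Sum>\<beta>\<in>?B k. fact k / index_fact n \<beta> * rmonomial n \<beta> (\<lambda>i. cmod (x i)))
          \<le> (\<Sum>\<beta>\<in>hom_indices n k. fact k / index_fact n \<beta> * rmonomial n \<beta> (\<lambda>i. cmod (x i)))"
        by (rule sum_mono2[OF finite_hom_indices _ nn]) blast
      also have "\<dots> = (\<Sum>i<n. cmod (x i)) ^ k" by (rule multinomial_theorem)
      also have "(\<Sum>i<n. cmod (x i)) = (\<Sum>i\<in>A. cmod (z i))"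
        by (rule sum.mono_neutral_cong_right) (use A in \<open>auto simp: x_def\<close>)
      also have "\<dots> ^ k \<le> \<rho> ^ k" using \<rho>(1) by (intro power_mono sum_nonneg) auto
      finally show ?thesis .
    qed
    have sf: "sqrt (fact (m - k)) \<le> sqrt (real m) ^ (m - k)"
    proof -
      have "sqrt (fact (m - k)) \<le> sqrt (real (m - k)) ^ (m - k)" by (rule sqrt_fact_le)
      also have "\<dots> \<le> sqrt (real m) ^ (m - k)" by (intro power_mono) auto
      finally show ?thesis .
    qed
    have "(\<Sum>\<beta>\<in>?B k. real (m choose k) * \<sigma> ^ (m - k) * (fact k / index_fact n \<beta>) *
        rmonomial n \<beta> (\<lambda>i. cmod (x i)) * (E * sqrt (fact (m - k))))
      = (E * real (m choose k) * \<sigma> ^ (m - k)) * (sqrt (fact (m - k)) *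
         (\<Sum>\<beta>\<in>?B k. fact k / index_fact n \<beta> * rmonomial n \<beta> (\<lambda>i. cmod (x i))))"
      unfolding sum_distrib_left by (intro sum.cong refl) (simp only: mult_ac)
    also have "\<dots> \<le> (E * real (m choose k) * \<sigma> ^ (m - k)) * (sqrt (real m) ^ (m - k) * \<rho> ^ k)"
    proof (intro mult_left_mono mult_mono sB sf)
      show "0 \<le> (\<Sum>\<beta>\<in>?B k. fact k / index_fact n \<beta> * rmonomial n \<beta> (\<lambda>i. cmod (x i)))"
        by (rule sum_nonneg[OF nn])
    qed (use E \<sigma>(2) in simp_all)
    also have "\<dots> = E * (real (m choose k) * \<rho> ^ k * (sqrt (real m) * \<sigma>) ^ (m - k))"
      by (simp only: power_mult_distrib mult_ac)
    finally show "(\<Sum>\<beta>\<in>?B k. real (m choose k) * \<sigma> ^ (m - k) * (fact k / index_fact n \<beta>) *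
        rmonomial n \<beta> (\<lambda>i. cmod (x i)) * (E * sqrt (fact (m - k))))
      \<le> E * (real (m choose k) * \<rho> ^ k * (sqrt (real m) * \<sigma>) ^ (m - k))" .
  qed
  also have "\<dots> = E * (\<rho> + sqrt (real m) * \<sigma>) ^ m"
    by (simp only: sum_distrib_left[symmetric] binomial_ring)
  finally show ?thesis .
qed

text \<open>The coordinates are separated at \<open>\<tau> = m\<^bsup>-1/P\<^esup>\<close>. Above \<open>\<tau>\<close> the \<open>1\<close>-norm is at most \<open>\<rho> = m\<^bsup>1 - 1/P\<^esup>\<close>, below
\<open>\<tau>\<close> the \<open>2\<close>-norm is at most \<open>\<sigma> = m\<^bsup>1/2 - 1/P\<^esup>\<close>, and the threshold is chosen such that
\<open>sqrt m \<sigma> = \<rho>\<close>: both parts contribute equally.\<close>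
lemma upper_bound_small_p:
  assumes P: "1 \<le> P" "P \<le> 2" and q: "1 \<le> q"
  shows "bohr_radius (ereal P) q \<lless> (\<lambda>n. ln (real n) powr (1 - 1 / P) / real n powr (1 - recip q))"
proof -
  have p1: "1 \<le> ereal P" using P by simp
  show ?thesis
  proof (rule bohr_radius_dominated[OF p1 q, of "exp 7 * 2 * 2"])
    fix n r assume n: "2 \<le> (n::nat)" and r: "r \<ge> 0" "bohr_ineq (ereal P) q n r"
    obtain m where m: "m \<ge> 1" "real n \<le> exp (real m)" "real m \<le> 2 * ln (real n)"
      using ceiling_ln_properties[OF n] .
    have n1: "n \<ge> 1" "n > 0" using n by auto
    have m0: "real m > 0" using m by simp
    obtain \<epsilon> :: "(nat \<Rightarrow> nat) \<Rightarrow> real" where \<epsilon>: "\<And>\<alpha>. \<epsilon> \<alpha> = 1 \<or> \<epsilon> \<alpha> = -1"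
      and flat: "\<And>\<beta> k M w. \<beta> \<in> hom_indices n k \<Longrightarrow> k + M = m \<Longrightarrow> (\<Sum>i<n. (cmod (w i))\<^sup>2) \<le> 1 \<Longrightarrow>
       cmod (\<Sum>\<gamma>\<in>hom_indices n M. of_real (\<epsilon> (\<lambda>i. \<beta> i + \<gamma> i) * (fact M / index_fact n \<gamma>)) * monomial n \<gamma> w)
         \<le> exp (7 * real m) * sqrt (fact M)"
      using exists_flat_signs[OF n1(1) m(2,1)] by blast
    define \<theta> where "\<theta> = 1 / P"
    have \<theta>: "0 \<le> 1 - \<theta>" "1 - \<theta> \<le> 1" "\<theta> * P = 1" using P by (simp_all add: \<theta>_def)
    define \<tau> where "\<tau> = real m powr (- \<theta>)"
    define \<rho> where "\<rho> = real m powr (1 - \<theta>)"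
    define \<sigma> where "\<sigma> = real m powr (1 / 2 - \<theta>)"
    have pos: "\<tau> > 0" "\<rho> > 0" "\<sigma> > 0" using m0 by (simp_all add: \<tau>_def \<rho>_def \<sigma>_def)
    have \<rho>\<sigma>: "sqrt (real m) * \<sigma> = \<rho>"
    proof -
      have "sqrt (real m) = real m powr (1 / 2)" using m0 by (simp add: powr_half_sqrt)
      then have "sqrt (real m) * \<sigma> = real m powr (1 / 2 + (1 / 2 - \<theta>))" by (simp only: \<sigma>_def powr_add)
      also have "1 / 2 + (1 / 2 - \<theta>) = 1 - \<theta>" by simp
      finally show ?thesis by (simp only: \<rho>_def)
    qed
    have "r \<le> (exp 7 * (\<rho> + \<rho>)) / real n powr (1 - recip q)"
    proof (rule bohr_ineq_signed_test[OF r(2,1) p1 q n1(2) m(1) \<epsilon>])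
      fix z assume z: "z \<in> lball (ereal P) n"
      define A where "A = {i. i < n \<and> \<tau> < cmod (z i)}"
      have zP: "(\<Sum>i<n. cmod (z i) powr P) \<le> 1" using z P by (simp add: lball_real_iff)
      have A: "A \<subseteq> {..<n}" by (auto simp: A_def)
      have big: "(\<Sum>i\<in>A. cmod (z i)) \<le> \<rho>"
      proof -
        have "(\<Sum>i\<in>A. cmod (z i)) \<le> (\<Sum>i\<in>A. cmod (z i) powr P * \<tau> powr (1 - P))"
        proof (rule sum_mono)
          fix i assume "i \<in> A"
          then have i: "\<tau> < cmod (z i)" by (simp add: A_def)
          then have "cmod (z i) > 0" using pos by linarith
          then have "cmod (z i) = cmod (z i) powr P * cmod (z i) powr (1 - P)"
            by (simp flip: powr_add)
          also have "\<dots> \<le> cmod (z i) powr P * \<tau> powr (1 - P)"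
            using i pos(1) P by (intro mult_left_mono powr_mono2') simp_all
          finally show "cmod (z i) \<le> cmod (z i) powr P * \<tau> powr (1 - P)" .
        qed
        also have "\<dots> = (\<Sum>i\<in>A. cmod (z i) powr P) * \<tau> powr (1 - P)" by (simp only: sum_distrib_right)
        also have "\<dots> \<le> 1 * \<tau> powr (1 - P)"
        proof (rule mult_right_mono)
          have "(\<Sum>i\<in>A. cmod (z i) powr P) \<le> (\<Sum>i<n. cmod (z i) powr P)"
            using A by (intro sum_mono2) simp_all
          then show "(\<Sum>i\<in>A. cmod (z i) powr P) \<le> 1" using zP by linarith
        qed simp
        also have "\<tau> powr (1 - P) = real m powr (- \<theta> * (1 - P))" by (simp only: \<tau>_def powr_powr)
        also have "- \<theta> * (1 - P) = 1 - \<theta>" using \<theta>(3) by (simp add: right_diff_distrib)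
        finally show ?thesis by (simp add: \<rho>_def)
      qed
      have small: "(\<Sum>i\<in>{..<n} - A. (cmod (z i))\<^sup>2) \<le> \<sigma>\<^sup>2"
      proof -
        have "(\<Sum>i\<in>{..<n} - A. (cmod (z i))\<^sup>2) \<le> (\<Sum>i\<in>{..<n} - A. cmod (z i) powr P * \<tau> powr (2 - P))"
        proof (rule sum_mono)
          fix i assume "i \<in> {..<n} - A"
          then have i: "cmod (z i) \<le> \<tau>" by (auto simp: A_def)
          have "(cmod (z i))\<^sup>2 = cmod (z i) powr (P + (2 - P))" by simp
          also have "\<dots> = cmod (z i) powr P * cmod (z i) powr (2 - P)" by (rule powr_add)
          also have "\<dots> \<le> cmod (z i) powr P * \<tau> powr (2 - P)"
            using i P by (intro mult_left_mono powr_mono2) simp_all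
          finally show "(cmod (z i))\<^sup>2 \<le> cmod (z i) powr P * \<tau> powr (2 - P)" .
        qed
        also have "\<dots> = (\<Sum>i\<in>{..<n} - A. cmod (z i) powr P) * \<tau> powr (2 - P)" by (simp only: sum_distrib_right)
        also have "\<dots> \<le> 1 * \<tau> powr (2 - P)"
        proof (rule mult_right_mono)
          have "(\<Sum>i\<in>{..<n} - A. cmod (z i) powr P) \<le> (\<Sum>i<n. cmod (z i) powr P)"
            by (intro sum_mono2) auto
          then show "(\<Sum>i\<in>{..<n} - A. cmod (z i) powr P) \<le> 1" using zP by linarith
        qed simp
        also have "\<tau> powr (2 - P) = real m powr (- \<theta> * (2 - P))" by (simp only: \<tau>_def powr_powr)
        also have "- \<theta> * (2 - P) = (1 / 2 - \<theta>) + (1 / 2 - \<theta>)" using \<theta>(3) by (simp add: right_diff_distrib)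
        also have "1 * real m powr ((1 / 2 - \<theta>) + (1 / 2 - \<theta>)) = \<sigma>\<^sup>2"
          by (simp only: powr_add \<sigma>_def power2_eq_square mult_1_left)
        finally show ?thesis .
      qed
      have "cmod (\<Sum>\<alpha>\<in>hom_indices n m. of_real (\<epsilon> \<alpha> * (fact m / index_fact n \<alpha>)) * monomial n \<alpha> z)
          \<le> exp (7 * real m) * (\<rho> + sqrt (real m) * \<sigma>) ^ m"
        by (rule norm_split_polynomial_le[OF A big _ small pos(3) _ flat]) (use pos in simp_all)
      also have "\<dots> = (exp 7 * (\<rho> + \<rho>)) ^ m"
        by (simp only: \<rho>\<sigma> power_mult_distrib exp_of_nat_mult[symmetric] mult.commute[of "real m"])
      finally show "cmod (\<Sum>\<alpha>\<in>hom_indices n m. of_real (\<epsilon> \<alpha> * (fact m / index_fact n \<alpha>)) * monomial n \<alpha> z)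
          \<le> (exp 7 * (\<rho> + \<rho>)) ^ m" .
    qed (use pos in simp)
    also have "\<dots> = exp 7 * 2 * \<rho> / real n powr (1 - recip q)" by simp
    also have "\<dots> \<le> exp 7 * 2 * (2 * ln (real n) powr (1 - \<theta>)) / real n powr (1 - recip q)"
    proof (intro divide_right_mono mult_left_mono)
      have l: "ln (real n) > 0" using n by simp
      have "\<rho> \<le> (2 * ln (real n)) powr (1 - \<theta>)"
        unfolding \<rho>_def using m(3) \<theta> by (intro powr_mono2) simp_all
      also have "\<dots> = 2 powr (1 - \<theta>) * ln (real n) powr (1 - \<theta>)" by (rule powr_mult)
      also have "\<dots> \<le> 2 powr 1 * ln (real n) powr (1 - \<theta>)"
        using \<theta> by (intro mult_right_mono powr_mono) simp_all
      finally show "\<rho> \<le> 2 * ln (real n) powr (1 - \<theta>)" by simp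
    qed simp_all
    finally show "r \<le> exp 7 * 2 * 2 * (ln (real n) powr (1 - 1 / P) / real n powr (1 - recip q))"
      by (simp add: \<theta>_def)
  qed simp
qed

section \<open>The order of the Bohr radius\<close>
theorem theorem1p2:
  fixes p q :: ereal
  assumes "1 \<le> p" and "1 \<le> q"
  shows "(q \<noteq> 1 \<longrightarrow>
      (2 \<le> p \<and> 1/2 + recip p \<le> recip q \<longrightarrow>
         bohr_radius p q \<asymp> (\<lambda>n. 1)) \<and>
      (2 \<le> p \<and> 1/2 + recip p > recip q \<longrightarrow>
         bohr_radius p q \<asymp> (\<lambda>n. sqrt (ln (real n)) / real n powr (1/2 + recip p - recip q))) \<and>
      (p \<le> 2 \<longrightarrow>
         bohr_radius p q \<asymp> (\<lambda>n. ln (real n) powr (1 - recip p) / real n powr (1 - recip q)))) \<and>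
    (q = 1 \<longrightarrow> bohr_radius p q \<asymp> (\<lambda>n. 1))"
proof (intro conjI impI)
  assume "2 \<le> p \<and> 1/2 + recip p \<le> recip q"
  then show "bohr_radius p q \<asymp> (\<lambda>n. 1)"
    using upper_bound_constant[OF assms] lower_bound_constant[OF assms] by (simp add: same_order_def)
next
  assume a: "2 \<le> p \<and> 1/2 + recip p > recip q"
  then have p: "2 \<le> p" and gt: "1/2 + recip p > recip q" by blast+
  show "bohr_radius p q \<asymp> (\<lambda>n. sqrt (ln (real n)) / real n powr (1/2 + recip p - recip q))"
    unfolding same_order_def
    by (rule conjI[OF upper_bound_large_p[OF p assms(2)] lower_bound_large_p[OF p assms(2) gt]])
next
  assume q: "q \<noteq> 1" and p: "p \<le> 2"
  have "p \<noteq> \<infinity>" using p by auto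
  then obtain P where P: "p = ereal P" "1 \<le> P" using assms(1) by (cases p) auto
  have P2: "P \<le> 2" using p by (simp add: P)
  have "(\<lambda>n. ln (real n) powr (1 - recip p) / real n powr (1 - recip q)) \<lless> bohr_radius p q"
  proof (cases "P = 1")
    case True
    then have "p = 1" by (simp add: P one_ereal_def)
    then show ?thesis using lower_bound_p_1[OF assms(2)] by simp
  next
    case False
    then show ?thesis using lower_bound_small_p[OF _ P2 assms(2) q] P by simp
  qed
  moreover have "bohr_radius p q \<lless> (\<lambda>n. ln (real n) powr (1 - recip p) / real n powr (1 - recip q))"
    using upper_bound_small_p[OF P(2) P2 assms(2)] by (simp add: P)
  ultimately show "bohr_radius p q \<asymp> (\<lambda>n. ln (real n) powr (1 - recip p) / real n powr (1 - recip q))"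
    by (simp add: same_order_def)
next
  assume "q = 1"
  then show "bohr_radius p q \<asymp> (\<lambda>n. 1)"
    using upper_bound_constant[OF assms] lower_bound_q_1[OF assms(1)] by (simp add: same_order_def)
qed

end
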